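(* Let $H\in(0,\frac12)$ and $T>0$, and let $b:[0,T]\times\mathbb{R}\to\mathbb{R}$ be Borel measurable such that (i) there is a constant $K>0$ with $|b(t,x)-b(t,y)|\le K|x-y|$ for all $x,y\in\mathbb{R}$, $t\in[0,T]$, and (ii) $t\mapsto b(t,0)$ is bounded on $[0,T]$. Let $P_Tf(x)=\mathbb{E}f(X_T^x)$, where $X^x$ is the solution of $dX_t=b(t,X_t)\,dt+dB_t^H$, $X_0=x$. Then for every $p>1$, every nonnegative bounded measurable $f:\mathbb{R}\to\mathbb{R}$ and all $x,y\in\mathbb{R}$, $$(P_Tf(y))^p\le P_Tf^p(x)\,\exp\left[\frac{p}{p-1}\,C(T,K,H)\,|x-y|^2\right],$$ where $$C(T,K,H)=\left(\frac{\mathrm{B}(\frac32-H,\frac12-H)}{\Gamma(\frac12-H)}\right)^2\frac{T^{2-2H}}{K^{-2}(1-e^{-2KT})^2(1-H)}.$$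
   Context: $\Gamma$ is the Gamma function and $\mathrm{B}(\cdot,\cdot)$ is the Euler Beta function. $B^H=(B^H_t)_{t\in[0,T]}$ is a fractional Brownian motion with Hurst parameter $H$, with the normalization given by the integral representation $B^H_t=\int_0^tK_H(t,s)\,dW_s$, where $W$ is a standard one-dimensional Wiener process and, for $0<s<t\le T$, $$K_H(t,s)=\Gamma(H+\tfrac12)^{-1}(t-s)^{H-\frac12}F\left(H-\tfrac12,\tfrac12-H,H+\tfrac12,1-\tfrac ts\right),$$ $F$ being the Gauss hypergeometric function (analytically continued). Thus $B^H$ is a centered Gaussian process with covariance $\mathbb{E}(B^H_tB^H_s)=\int_0^{t\wedge s}K_H(t,r)K_H(s,r)\,dr$, which is proportional to $t^{2H}+s^{2H}-|t-s|^{2H}$. A solution $X^x$ of the equation is a continuous adapted process with $X^x_t=x+\int_0^tb(s,X^x_s)\,ds+B^H_t$ for $t\in[0,T]$; under the stated hypotheses on $b$ there is a unique (strong) solution. *)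

theory Defs
  imports
    "HOL-Probability.Probability"
    "HOL-Probability.Stopping_Time"
    "HOL-Complex_Analysis.Complex_Analysis"
begin

definition slit_plane :: "complex set" where
  "slit_plane = - (complex_of_real ` {1..})"

text \<open>The Gauss hypergeometric function: the value at \<open>z\<close> of the holomorphic continuation of the
  hypergeometric series from the unit disc to the plane cut along \<open>[1, \<infinity>)\<close>.
  By the identity theorem this value does not depend on the continuation \<open>g\<close>.\<close>

definition hypergeometric_2F1 :: "complex \<Rightarrow> complex \<Rightarrow> complex \<Rightarrow> complex \<Rightarrow> complex" where
  "hypergeometric_2F1 a b c z =
     (THE w. \<exists>g. g holomorphic_on slit_plane \<and>
        (\<forall>u. norm u < 1 \<longrightarrow> g u = eval_fps (fps_hypergeo [a, b] [c] 1) u) \<and> w = g z)"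

text \<open>For \<open>0 < s < t\<close> the argument \<open>1 - t / s\<close> is a negative real, where the hypergeometric function
  with real parameters is real; \<open>Re\<close> only changes the type.\<close>

definition K_kernel :: "real \<Rightarrow> real \<Rightarrow> real \<Rightarrow> real" where
  "K_kernel H t s =
     inverse (Gamma (H + 1/2)) * (t - s) powr (H - 1/2) *
     Re (hypergeometric_2F1 (of_real (H - 1/2)) (of_real (1/2 - H)) (of_real (H + 1/2))
           (of_real (1 - t / s)))"

locale filtered_prob_space = prob_space M + filtration "space M" F
  for M :: "'a measure" and F :: "real \<Rightarrow> 'a measure" +
  assumes subalgebra_F: "subalgebra M (F t)"

locale wiener_process = filtered_prob_space M F
  for M :: "'a measure" and F :: "real \<Rightarrow> 'a measure" +
  fixes T :: real and W :: "real \<Rightarrow> 'a \<Rightarrow> real"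
  assumes W_0: "AE \<omega> in M. W 0 \<omega> = 0"
    and W_adapted: "t \<in> {0..T} \<Longrightarrow> W t \<in> borel_measurable (F t)"
    and W_increments: "\<lbrakk>0 \<le> s; s < t; t \<le> T\<rbrakk> \<Longrightarrow>
      distributed M lborel (\<lambda>\<omega>. W t \<omega> - W s \<omega>) (normal_density 0 (sqrt (t - s)))"
    and W_indep: "\<lbrakk>0 \<le> s; s < t; t \<le> T\<rbrakk> \<Longrightarrow>
      indep_set (sets (vimage_algebra (space M) (\<lambda>\<omega>. W t \<omega> - W s \<omega>) borel)) (sets (F s))"
    and W_continuous: "AE \<omega> in M. continuous_on {0..T} (\<lambda>t. W t \<omega>)"

text \<open>A list of triples \<open>(c, u, v)\<close> represents the step function that is the sum of the functions
  \<open>c\<close> times the indicator of \<open>(u, v]\<close>.\<close>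

definition step_fun :: "(real \<times> real \<times> real) list \<Rightarrow> real \<Rightarrow> real" where
  "step_fun es s = (\<Sum>(c, u, v) \<leftarrow> es. c * indicator {u<..v} s)"

definition step_integral ::
  "(real \<Rightarrow> 'a \<Rightarrow> real) \<Rightarrow> (real \<times> real \<times> real) list \<Rightarrow> 'a \<Rightarrow> real" where
  "step_integral W es \<omega> = (\<Sum>(c, u, v) \<leftarrow> es. c * (W v \<omega> - W u \<omega>))"

text \<open>\<open>I\<close> is a version of the Wiener integral of the deterministic function \<open>f\<close> over \<open>(0, t)\<close>:
  the mean-square limit of the integrals of step functions converging to \<open>f\<close> in \<open>L\<^sup>2(0, t)\<close>.
  The squared distances are extended nonnegative integrals, so no integrability is tacitly assumed.\<close>

definition is_wiener_integral ::
  "'a measure \<Rightarrow> (real \<Rightarrow> 'a \<Rightarrow> real) \<Rightarrow> real \<Rightarrow> (real \<Rightarrow> real) \<Rightarrow> ('a \<Rightarrow> real) \<Rightarrow> bool" where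
  "is_wiener_integral M W t f I \<longleftrightarrow>
     set_borel_measurable lborel {0<..<t} f \<and> I \<in> borel_measurable M \<and>
     (\<exists>es :: nat \<Rightarrow> (real \<times> real \<times> real) list.
        (\<forall>n. \<forall>(c, u, v) \<in> set (es n). 0 \<le> u \<and> u \<le> v \<and> v \<le> t) \<and>
        (\<lambda>n. \<integral>\<^sup>+ s \<in> {0<..<t}. ennreal ((step_fun (es n) s - f s)\<^sup>2) \<partial>lborel) \<longlonglongrightarrow> 0 \<and>
        (\<lambda>n. \<integral>\<^sup>+ \<omega>. ennreal ((step_integral W (es n) \<omega> - I \<omega>)\<^sup>2) \<partial>M) \<longlonglongrightarrow> 0)"

locale fractional_brownian_motion = wiener_process M F T W
  for M :: "'a measure" and F :: "real \<Rightarrow> 'a measure" and T :: real and W :: "real \<Rightarrow> 'a \<Rightarrow> real" +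
  fixes H :: real and B :: "real \<Rightarrow> 'a \<Rightarrow> real"
  assumes B_representation: "t \<in> {0..T} \<Longrightarrow> is_wiener_integral M W t (K_kernel H t) (B t)"
    and B_continuous: "AE \<omega> in M. continuous_on {0..T} (\<lambda>t. B t \<omega>)"

definition is_solution ::
  "'a measure \<Rightarrow> (real \<Rightarrow> 'a measure) \<Rightarrow> real \<Rightarrow> (real \<Rightarrow> 'a \<Rightarrow> real) \<Rightarrow>
   (real \<Rightarrow> real \<Rightarrow> real) \<Rightarrow> real \<Rightarrow> (real \<Rightarrow> 'a \<Rightarrow> real) \<Rightarrow> bool" where
  "is_solution M F T B b x X \<longleftrightarrow>
     (\<forall>t \<in> {0..T}. X t \<in> borel_measurable (F t)) \<and>
     (AE \<omega> in M. continuous_on {0..T} (\<lambda>t. X t \<omega>) \<and>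
        (\<forall>t \<in> {0..T}. set_integrable lborel {0..t} (\<lambda>s. b s (X s \<omega>)) \<and>
           X t \<omega> = x + (LINT s:{0..t}|lborel. b s (X s \<omega>)) + B t \<omega>))"

text \<open>Here \<open>X x\<close> is the solution started at \<open>x\<close>.\<close>

definition transition_op ::
  "'a measure \<Rightarrow> real \<Rightarrow> (real \<Rightarrow> real \<Rightarrow> 'a \<Rightarrow> real) \<Rightarrow> (real \<Rightarrow> real) \<Rightarrow> real \<Rightarrow> real" where
  "transition_op M T X f x = (LINT \<omega>|M. f (X x T \<omega>))"

definition harnack_const :: "real \<Rightarrow> real \<Rightarrow> real \<Rightarrow> real" where
  "harnack_const T K H =
     (Beta (3/2 - H) (1/2 - H) / Gamma (1/2 - H))\<^sup>2 *
     (T powr (2 - 2 * H) / (K powi (-2) * (1 - exp (- 2 * K * T))\<^sup>2 * (1 - H)))"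

end

theory Submission
  imports Defs
begin

text \<open>Coupling and change of measure. Put \<open>\<alpha> = 1/2 - H\<close> and let \<open>X\<close> solve the equation from \<open>x\<close>. The process
\<open>Y t = X t + (y - x) * (1 - t / T)\<close> starts at \<open>y\<close> and satisfies \<open>Y T = X T\<close>. It solves the same
equation driven by \<open>B + \<integral>u\<close>, where \<open>u t = b t (X t) - b t (Y t) - (y - x) / T\<close> is bounded by
\<open>\<bar>x - y\<bar> * (K + 1 / T)\<close>. If a density \<open>R\<close> turns \<open>B + \<integral>u\<close> into a fractional Brownian motion, then
\<open>E f(X\<^sup>y T) = E (R * f (X\<^sup>x T))\<close>, and Hoelder's inequality leaves only a moment of \<open>R\<close> to be bounded.

Adding \<open>\<integral>u\<close> to \<open>B\<close> means shifting the Wiener process by \<open>\<integral>h\<close> with \<open>\<integral> K_kernel H t s * h s ds = \<integral>u\<close>, an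
integral equation of Volterra type. It is solved by a weighted Riemann-Liouville integral
(\<open>fractional_density\<close>, lemma \<open>nn_integral_K_kernel_fractional_density\<close>), which bounds \<open>\<bar>h s\<bar>\<close> by
\<open>Beta (1 + \<alpha>) \<alpha> / Gamma \<alpha> * s powr \<alpha>\<close> times the bound of \<open>u\<close>. Integrating the square over \<open>(0, T)\<close> gives
the constant, because \<open>K + 1 / T \<le> 2 * K / (1 - exp (- 2 * K * T))\<close>.

The inequality is proved for the Euler scheme with \<open>n\<close> steps, in which \<open>B\<close> enters only through its
values at \<open>n + 1\<close> times, and with each of these values replaced by an integral of a step function
against \<open>W\<close>. There the noise is a linear image of finitely many independent Gaussian variables, the
shift in each variable depends only on the earlier ones, and the change of measure is an iterated
substitution (\<open>nn_integral_girsanov\<close>). The bounds do not depend on the discretisation: the shift of an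
increment is the integral of \<open>h\<close> over its interval, so that the energy is controlled by \<open>\<integral>h\<^sup>2\<close>
(\<open>grid_energy\<close>). The step functions then converge to the kernel (\<open>euler_harnack_fbm\<close>), the Euler scheme
converges to the solution (\<open>euler_path_tendsto_solution\<close>), and an \<open>L\<^sup>1\<close> approximation passes from
Lipschitz functions to bounded measurable ones
(\<open>power_moment_bound_extend\<close>).\<close>

section \<open>The Euler integral of the hypergeometric function\<close>

text \<open>Difference quotients converge pointwise, and Cauchy's estimate on a smaller disc dominates them by a
multiple of the local majorant \<open>g\<close>; dominated convergence then differentiates under the integral.\<close>

lemma holomorphic_on_integral:
  fixes f :: "complex \<Rightarrow> 'a \<Rightarrow> complex"
  assumes "open S"
    and hol: "\<And>x. x \<in> space M \<Longrightarrow> (\<lambda>z. f z x) holomorphic_on S"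
    and int: "\<And>z. z \<in> S \<Longrightarrow> integrable M (f z)"
    and bound: "\<And>z. z \<in> S \<Longrightarrow> \<exists>r>0. cball z r \<subseteq> S \<and>
        (\<exists>g. integrable M g \<and> (\<forall>w\<in>cball z r. \<forall>x\<in>space M. norm (f w x) \<le> g x))"
  shows "(\<lambda>z. \<integral>x. f z x \<partial>M) holomorphic_on S"
proof -
  have "(\<lambda>z. \<integral>x. f z x \<partial>M) field_differentiable (at z)" if "z \<in> S" for z
  proof -
    from bound[OF that] obtain r g where r: "r > 0" "cball z r \<subseteq> S" and g: "integrable M g"
      and fg: "\<And>w x. w \<in> cball z r \<Longrightarrow> x \<in> space M \<Longrightarrow> norm (f w x) \<le> g x" by blast
    have der: "((\<lambda>z. f z x) has_field_derivative deriv (\<lambda>z. f z x) w) (at w)"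
      if "w \<in> S" "x \<in> space M" for w x
      using hol[OF that(2)] that(1) \<open>open S\<close> holomorphic_derivI by blast
    have dbound: "norm (deriv (\<lambda>z. f z x) w) \<le> g x / (r / 2)"
      if "w \<in> cball z (r/2)" "x \<in> space M" for w x
    proof -
      have sub: "cball w (r/2) \<subseteq> cball z r"
        using that(1) by (simp add: cball_subset_cball_iff dist_commute)
      have "norm ((deriv ^^ 1) (\<lambda>z. f z x) w) \<le> fact 1 * g x / (r/2) ^ 1"
      proof (rule Cauchy_inequality)
        show "(\<lambda>z. f z x) holomorphic_on ball w (r/2)"
          using hol[OF that(2)] sub r(2) ball_subset_cball by (meson holomorphic_on_subset subset_trans)
        show "continuous_on (cball w (r/2)) (\<lambda>z. f z x)"
          using hol[OF that(2)] sub r(2)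
          by (meson holomorphic_on_imp_continuous_on holomorphic_on_subset subset_trans)
        show "norm (f v x) \<le> g x" if "norm (w - v) = r/2" for v
          using fg[of v x] sub that \<open>x \<in> space M\<close> by (auto simp: dist_norm)
      qed (use r in auto)
      then show ?thesis by simp
    qed
    have lip: "norm ((f w x - f z x) / (w - z)) \<le> g x / (r/2)"
      if "w \<in> cball z (r/2)" "w \<noteq> z" "x \<in> space M" for w x
    proof -
      have "norm (f w x - f z x) \<le> g x / (r/2) * norm (w - z)"
      proof (rule field_differentiable_bound[where S = "cball z (r/2)"])
        show "((\<lambda>z. f z x) has_field_derivative deriv (\<lambda>z. f z x) v) (at v within cball z (r/2))"
          if "v \<in> cball z (r/2)" for v
        proof -
          have "cball z (r/2) \<subseteq> cball z r" using r by (simp add: cball_subset_cball_iff)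
          then have "v \<in> S" using that r by blast
          from der[OF this \<open>x \<in> space M\<close>] show ?thesis by (rule has_field_derivative_at_within)
        qed
        show "norm (deriv (\<lambda>z. f z x) v) \<le> g x / (r/2)" if "v \<in> cball z (r/2)" for v
          using dbound that \<open>x \<in> space M\<close> by blast
      qed (use that r in auto)
      then show ?thesis using that by (simp add: norm_divide divide_le_eq)
    qed
    have "((\<lambda>w. ((\<integral>x. f w x \<partial>M) - (\<integral>x. f z x \<partial>M)) / (w - z)) \<longlongrightarrow> (\<integral>x. deriv (\<lambda>z. f z x) z \<partial>M)) (at z)"
    proof (rule Lim_transform_eventually)
      show "\<forall>\<^sub>F w in at z. (\<integral>x. (f w x - f z x) / (w - z) \<partial>M) = ((\<integral>x. f w x \<partial>M) - (\<integral>x. f z x \<partial>M)) / (w - z)"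
        unfolding eventually_at using r \<open>z \<in> S\<close>
        by (intro exI[of _ r]) (auto simp: int dist_commute subset_eq)
      show "((\<lambda>w. \<integral>x. (f w x - f z x) / (w - z) \<partial>M) \<longlongrightarrow> (\<integral>x. deriv (\<lambda>z. f z x) z \<partial>M)) (at z)"
        unfolding tendsto_at_iff_sequentially comp_def
      proof (intro allI impI)
        fix w assume w: "\<forall>i. w i \<in> UNIV - {z}" "w \<longlonglongrightarrow> z"
        have "\<forall>\<^sub>F i in sequentially. w i \<in> ball z (r/2)"
          using w(2) r by (intro topological_tendstoD) auto
        then obtain i0 where i0: "\<And>i. i \<ge> i0 \<Longrightarrow> w i \<in> ball z (r/2)"
          unfolding eventually_sequentially by blast
        let ?w = "\<lambda>i. w (i + i0)"
        have inS: "?w i \<in> S" for i using i0[of "i + i0"] r by auto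
        have lim: "(\<lambda>i. (f (?w i) x - f z x) / (?w i - z)) \<longlonglongrightarrow> deriv (\<lambda>z. f z x) z" if "x \<in> space M" for x
        proof -
          have "((\<lambda>w. (f w x - f z x) / (w - z)) \<longlongrightarrow> deriv (\<lambda>z. f z x) z) (at z)"
            using der[OF \<open>z \<in> S\<close> that] by (simp add: has_field_derivative_iff)
          then have "(\<lambda>i. (f (w i) x - f z x) / (w i - z)) \<longlonglongrightarrow> deriv (\<lambda>z. f z x) z"
            unfolding tendsto_at_iff_sequentially comp_def using w by blast
          then show ?thesis by (rule LIMSEQ_ignore_initial_segment)
        qed
        have meas: "(\<lambda>x. (f (?w i) x - f z x) / (?w i - z)) \<in> borel_measurable M" for i
          using int[OF inS] int[OF \<open>z \<in> S\<close>] by (intro borel_measurable_divide borel_measurable_diff) auto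
        have "(\<lambda>i. \<integral>x. (f (?w i) x - f z x) / (?w i - z) \<partial>M) \<longlonglongrightarrow> (\<integral>x. deriv (\<lambda>z. f z x) z \<partial>M)"
        proof (rule integral_dominated_convergence[where w = "\<lambda>x. g x / (r/2)"])
          show "(\<lambda>x. deriv (\<lambda>z. f z x) z) \<in> borel_measurable M"
            by (rule borel_measurable_LIMSEQ_metric[OF meas lim])
          show "AE x in M. norm ((f (?w i) x - f z x) / (?w i - z)) \<le> g x / (r/2)" for i
            using lip[of "?w i"] i0[of "i + i0"] w(1) by (intro AE_I2) auto
        qed (use meas lim g in auto)
        then show "(\<lambda>i. \<integral>x. (f (w i) x - f z x) / (w i - z) \<partial>M) \<longlonglongrightarrow> (\<integral>x. deriv (\<lambda>z. f z x) z \<partial>M)"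
          by (rule LIMSEQ_offset)
      qed
    qed
    then show ?thesis
      by (auto simp: field_differentiable_def has_field_derivative_iff)
  qed
  then show ?thesis
    by (simp add: holomorphic_on_open \<open>open S\<close> field_differentiable_def)
qed

lemma slit_plane_eq: "slit_plane = {z. Im z \<noteq> 0 \<or> Re z < 1}"
proof -
  have "z \<in> complex_of_real ` {1..} \<longleftrightarrow> Im z = 0 \<and> Re z \<ge> 1" for z
    by (auto simp: image_iff complex_eq_iff)
  then show ?thesis by (auto simp: slit_plane_def)
qed

lemma open_slit_plane: "open slit_plane"
proof -
  have "slit_plane = {z. Im z \<noteq> 0} \<union> {z. Re z < 1}" by (auto simp: slit_plane_eq)
  moreover have "open {z. Im z \<noteq> 0}" 
    by (intro open_Collect_neq continuous_intros)
  moreover have "open {z. Re z < 1}" by (rule open_halfspace_Re_lt)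
  ultimately show ?thesis by (metis open_Un)
qed

lemma connected_slit_plane: "connected slit_plane"
proof -
  have "starlike slit_plane"
    unfolding starlike_def
  proof (intro bexI[of _ 0] ballI subsetI)
    fix z w assume z: "z \<in> slit_plane" and "w \<in> closed_segment 0 z"
    then obtain u where u: "0 \<le> u" "u \<le> 1" "w = of_real u * z"
      by (auto simp: in_segment scaleR_conv_of_real)
    have "u * Re z < 1" if "u \<noteq> 0" "Im z = 0"
    proof -
      have "Re z < 1" using z that by (auto simp: slit_plane_eq)
      then have "u * Re z < u * 1" using that u by (intro mult_strict_left_mono) auto
      then show ?thesis using u by linarith
    qed
    then show "w \<in> slit_plane" using z u by (cases "u = 0") (auto simp: slit_plane_eq)
  qed (simp add: slit_plane_eq)
  then show ?thesis by (rule starlike_imp_connected)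
qed

text \<open>Two continuations agree on the unit disc, hence on the connected open slit plane.\<close>

lemma hypergeometric_2F1_eqI:
  assumes g: "g holomorphic_on slit_plane"
    and series: "\<And>u. norm u < 1 \<Longrightarrow> g u = eval_fps (fps_hypergeo [a, b] [c] 1) u"
    and z: "z \<in> slit_plane"
  shows "hypergeometric_2F1 a b c z = g z"
  unfolding hypergeometric_2F1_def
proof (rule the_equality)
  show "\<exists>g'. g' holomorphic_on slit_plane \<and>
        (\<forall>u. norm u < 1 \<longrightarrow> g' u = eval_fps (fps_hypergeo [a, b] [c] 1) u) \<and> g z = g' z"
    using g series by blast
next
  fix w assume "\<exists>g'. g' holomorphic_on slit_plane \<and>
        (\<forall>u. norm u < 1 \<longrightarrow> g' u = eval_fps (fps_hypergeo [a, b] [c] 1) u) \<and> w = g' z"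
  then obtain g' where g': "g' holomorphic_on slit_plane"
    "\<And>u. norm u < 1 \<Longrightarrow> g' u = eval_fps (fps_hypergeo [a, b] [c] 1) u" "w = g' z" by blast
  have "g' z = g z"
  proof (rule analytic_continuation_open[of "ball 0 1" slit_plane g' g])
    show "ball 0 1 \<subseteq> slit_plane"
    proof
      fix u :: complex assume "u \<in> ball 0 1"
      then have "norm u < 1" by simp
      then have "Re u < 1" using complex_Re_le_cmod[of u] by linarith
      then show "u \<in> slit_plane" by (simp add: slit_plane_eq)
    qed
  qed (use g g' series z open_slit_plane connected_slit_plane in auto)
  then show "w = g z" using g' by simp
qed

abbreviation beta_weight :: "real \<Rightarrow> real \<Rightarrow> real \<Rightarrow> real" where
  "beta_weight p q x \<equiv> indicator {0<..<1} x * (x powr (p - 1) * (1 - x) powr (q - 1))"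

lemma nn_integral_beta_weight:
  assumes "p > 0" "q > 0"
  shows "(\<integral>\<^sup>+x. ennreal (beta_weight p q x) \<partial>lborel) = ennreal (Beta p q)"
proof -
  have "((\<lambda>x. x powr (p - 1) * (1 - x) powr (q - 1)) has_integral Beta p q) {0<..<1}"
    using has_integral_Beta_real[OF assms] by (simp add: has_integral_Icc_iff_Ioo)
  from nn_integral_has_integral_lebesgue[OF _ this] show ?thesis by simp
qed

lemma has_bochner_integral_beta_weight:
  assumes "p > 0" "q > 0"
  shows "has_bochner_integral lborel (beta_weight p q) (Beta p q)"
proof (rule has_bochner_integral_nn_integral)
  show "0 \<le> Beta p q"
    using assms Gamma_real_pos by (auto simp: Beta_def intro!: divide_nonneg_pos mult_nonneg_nonneg less_imp_le)
qed (use nn_integral_beta_weight[OF assms] in auto)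

lemma Beta_add_nat:
  fixes p q :: real
  assumes "p > 0" "q > 0"
  shows "Beta (p + real n) q = Beta p q * (pochhammer p n / pochhammer (p + q) n)"
proof -
  have nz: "p \<notin> \<int>\<^sub>\<le>\<^sub>0" "p + q \<notin> \<int>\<^sub>\<le>\<^sub>0" using assms by (auto elim!: nonpos_Ints_cases)
  have "Gamma p > 0" "Gamma (p + q) > 0" "Gamma (p + q + real n) > 0"
    using assms by (auto intro!: Gamma_real_pos)
  then show ?thesis
    by (simp add: Beta_def pochhammer_Gamma[OF nz(1)] pochhammer_Gamma[OF nz(2)] field_simps)
qed

text \<open>This is \<open>Beta b (c - b)\<close> times the hypergeometric function. Its integrand is singular at both ends of
\<open>[0, 1]\<close>, but has a majorant that is locally uniform in \<open>z\<close>.\<close>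

definition euler_integral :: "real \<Rightarrow> real \<Rightarrow> real \<Rightarrow> complex \<Rightarrow> complex" where
  "euler_integral a b c z =
     (\<integral>x. of_real (beta_weight b (c - b) x) * (1 - z * of_real x) powr (- of_real a) \<partial>lborel)"

lemma slit_plane_segment:
  assumes "z \<in> slit_plane" "0 \<le> x" "x \<le> 1"
  shows "1 - z * of_real x \<notin> \<real>\<^sub>\<le>\<^sub>0"
proof
  assume "1 - z * of_real x \<in> \<real>\<^sub>\<le>\<^sub>0"
  then have *: "Im z * x = 0" "1 \<le> Re z * x" by (auto simp: complex_nonpos_Reals_iff)
  then have "x \<noteq> 0" by auto
  with * assms have "Re z < 1" by (auto simp: slit_plane_eq)
  then have "Re z * x < 1" 
    using assms \<open>x \<noteq> 0\<close> mult_strict_right_mono[of "Re z" 1 x] by linarith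
  then show False using *(2) by linarith
qed

lemma euler_integral_holomorphic:
  assumes "0 < b" "b < c"
  shows "euler_integral a b c holomorphic_on slit_plane"
proof -
  let ?w = "beta_weight b (c - b)"
  let ?f = "\<lambda>z x. of_real (?w x) * (1 - z * of_real x) powr (- of_real a)"
  have int_w: "integrable lborel ?w"
    using has_bochner_integral_beta_weight[of b "c - b"] assms by (auto intro: has_bochner_integral_iff[THEN iffD1, THEN conjunct1])
  have bound: "\<exists>B. \<forall>w\<in>C. \<forall>x\<in>{0<..<1}. norm ((1 - w * of_real x) powr (- of_real a)) \<le> B"
    if "compact C" "C \<subseteq> slit_plane" for C
  proof -
    have "continuous_on (C \<times> {0..1}) (\<lambda>p. (1 - fst p * of_real (snd p)) powr (- complex_of_real a))"
    proof (intro continuous_intros)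
      have *: "1 - fst p * of_real (snd p) \<notin> \<real>\<^sub>\<le>\<^sub>0" if "p \<in> C \<times> {0..1::real}" for p
        using that \<open>C \<subseteq> slit_plane\<close> by (intro slit_plane_segment) auto
      then show "C \<times> {0..1} \<subseteq> {p. 0 \<le> Re (1 - fst p * of_real (snd p)) \<or> Im (1 - fst p * of_real (snd p)) \<noteq> 0}"
        by (force simp: complex_nonpos_Reals_iff)
      show "0 < Re (- complex_of_real a)" if "p \<in> C \<times> {0..1}" "1 - fst p * of_real (snd p) = 0" for p
        using *[OF that(1)] that(2) by (metis complex_nonpos_Reals_iff order_refl zero_complex.sel)
    qed
    then have "bounded ((\<lambda>p. (1 - fst p * of_real (snd p)) powr (- complex_of_real a)) ` (C \<times> {0..1}))"
      using that by (intro compact_imp_bounded compact_continuous_image compact_Times) auto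
    then obtain B where "\<forall>v\<in>(\<lambda>p. (1 - fst p * of_real (snd p)) powr (- complex_of_real a)) ` (C \<times> {0..1}). norm v \<le> B"
      unfolding bounded_iff by blast
    then have B: "norm ((1 - fst p * of_real (snd p)) powr (- complex_of_real a)) \<le> B" if "p \<in> C \<times> {0..1}" for p
      using that by blast
    show ?thesis using B[of "(w, x)" for w x] by (intro exI[of _ B]) auto
  qed
  have dom: "norm (?f w x) \<le> B * ?w x" 
    if "\<forall>w\<in>C. \<forall>x\<in>{0<..<1}. norm ((1 - w * of_real x) powr (- of_real a)) \<le> B" "w \<in> C" for C :: "complex set" and B w x
    using that by (auto simp: norm_mult indicator_def abs_mult mult.commute intro!: mult_right_mono)
  have meas: "?f z \<in> borel_measurable lborel" for z :: complex by measurable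
  have "(\<lambda>z. \<integral>x. ?f z x \<partial>lborel) holomorphic_on slit_plane"
  proof (rule holomorphic_on_integral[OF open_slit_plane])
    fix x assume "x \<in> space (lborel :: real measure)"
    show "(\<lambda>z. ?f z x) holomorphic_on slit_plane"
    proof (cases "x \<in> {0<..<1}")
      case True
      then show ?thesis using slit_plane_segment by (intro holomorphic_intros) auto
    qed simp
  next
    fix z assume z: "z \<in> slit_plane"
    have "{z} \<subseteq> slit_plane" using z by simp
    from bound[OF compact_sing this]
    obtain B where "\<forall>w\<in>{z}. \<forall>x\<in>{0<..<1}. norm ((1 - w * of_real x) powr (- of_real a)) \<le> B" ..
    from dom[OF this] have le: "norm (?f z x) \<le> B * ?w x" for x by blast
    show "integrable lborel (?f z)"
      by (rule Bochner_Integration.integrable_bound[OF integrable_mult_right[OF int_w, of B] meas])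
        (unfold real_norm_def, intro AE_I2 order_trans[OF le] abs_ge_self)
    obtain r where r: "r > 0" "cball z r \<subseteq> slit_plane"
      using open_slit_plane z open_contains_cball by blast
    from bound[OF compact_cball r(2)]
    obtain B' where "\<forall>w\<in>cball z r. \<forall>x\<in>{0<..<1}. norm ((1 - w * of_real x) powr (- of_real a)) \<le> B'" ..
    from dom[OF this] have "\<forall>w\<in>cball z r. \<forall>x\<in>space lborel. norm (?f w x) \<le> B' * ?w x" by blast
    then show "\<exists>r>0. cball z r \<subseteq> slit_plane \<and>
        (\<exists>g. integrable lborel g \<and> (\<forall>w\<in>cball z r. \<forall>x\<in>space lborel. norm (?f w x) \<le> g x))"
      using r integrable_mult_right[OF int_w, of B'] by blast
  qed
  then show ?thesis by (simp add: euler_integral_def[abs_def])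
qed

text \<open>Expand \<open>(1 - u * x) powr (- a)\<close> by the binomial series and integrate term by term; the \<open>n\<close>-th term contributes
\<open>Beta (b + n) (c - b)\<close>, which supplies the quotient of Pochhammer symbols of \<open>b\<close> and \<open>c\<close>.\<close>

lemma euler_integral_series:
  assumes "0 < b" "b < c" "norm u < 1"
  shows "euler_integral a b c u =
    of_real (Beta b (c - b)) * eval_fps (fps_hypergeo [of_real a, of_real b] [of_real c] 1) u"
proof -
  let ?w = "beta_weight b (c - b)"
  let ?t = "\<lambda>n. pochhammer (of_real a) n / fact n * u ^ n"
  let ?f = "\<lambda>n x. complex_of_real (?w x) * (?t n * of_real x ^ n)"
  have t_eq: "?t n * v ^ n = ((- of_real a) gchoose n) * (- (u * v)) ^ n" for n v
    by (simp add: gbinomial_pochhammer power_minus[of "u * v"] power_mult_distrib field_simps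
          flip: power_add mult_2)
  have wn: "?w x * x ^ n = beta_weight (b + real n) (c - b) x" for x n
    by (auto simp: indicator_def powr_add powr_realpow field_simps powr_diff)
  have hasint: "has_bochner_integral lborel (\<lambda>x. ?w x * x ^ n) (Beta (b + n) (c - b))" for n
    unfolding wn using assms by (intro has_bochner_integral_beta_weight) auto
  have f_eq: "?f n x = ?t n * of_real (?w x * x ^ n)" for n x by simp
  have hasint_f: "has_bochner_integral lborel (?f n) (?t n * of_real (Beta (b + n) (c - b)))" for n
    unfolding f_eq by (intro has_bochner_integral_mult_right has_bochner_integral_of_real hasint)
  have summ: "summable (\<lambda>n. norm (?t n))"
  proof -
    obtain r where r: "norm u < r" "r < 1" using assms dense by blast
    then have "r > 0" using norm_ge_zero[of u] by linarith
    have "summable (\<lambda>n. ((- of_real a) gchoose n) * (complex_of_real r) ^ n)"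
      using gen_binomial_complex[of "of_real r" "- of_real a"] r \<open>r > 0\<close> by (auto simp: sums_iff)
    then have "summable (\<lambda>n. norm (((- of_real a) gchoose n) * (- u) ^ n))"
      by (rule powser_insidea) (use r \<open>r > 0\<close> in auto)
    then show ?thesis using t_eq[of _ 1] by simp
  qed
  have norm_f: "norm (?f n x) \<le> norm (?t n) * ?w x" for n x
  proof (cases "x \<in> {0<..<1}")
    case True
    then have "norm (?t n * of_real x ^ n) \<le> norm (?t n)"
      unfolding norm_mult[of "?t n"] by (intro mult_left_le) (auto simp: norm_power power_le_one)
    then have "?w x * norm (?t n * of_real x ^ n) \<le> ?w x * norm (?t n)"
      using True by (intro mult_left_mono) auto
    moreover have "norm (?f n x) = ?w x * norm (?t n * of_real x ^ n)"
      using True unfolding norm_mult[of "complex_of_real (?w x)"] norm_of_real by simp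
    ultimately show ?thesis by (simp only: mult.commute[of "norm (?t n)"])
  qed simp
  have int_w: "has_bochner_integral lborel ?w (Beta b (c - b))"
    using assms by (intro has_bochner_integral_beta_weight) auto
  have sum_f: "(\<lambda>n. integral\<^sup>L lborel (?f n)) sums (\<integral>x. (\<Sum>n. ?f n x) \<partial>lborel)"
  proof (rule sums_integral)
    show "AE x in lborel. summable (\<lambda>n. norm (?f n x))"
      by (intro AE_I2 summable_comparison_test'[OF summable_mult2[OF summ]]) (use norm_f in auto)
    show "summable (\<lambda>n. \<integral>x. norm (?f n x) \<partial>lborel)"
    proof (rule summable_comparison_test'[OF summable_mult2[OF summ, of "Beta b (c - b)"]])
      fix n
      have "(\<integral>x. norm (?f n x) \<partial>lborel) \<le> (\<integral>x. norm (?t n) * ?w x \<partial>lborel)"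
        using norm_f int_w hasint_f[of n]
        by (intro integral_mono) (auto simp: has_bochner_integral_iff)
      then show "norm (\<integral>x. norm (?f n x) \<partial>lborel) \<le> norm (?t n) * Beta b (c - b)"
        using int_w by (simp add: has_bochner_integral_iff)
    qed
  qed (use hasint_f in \<open>auto simp: has_bochner_integral_iff\<close>)
  have inner: "(\<Sum>n. ?f n x) = of_real (?w x) * (1 - u * of_real x) powr (- of_real a)" for x
  proof (cases "x \<in> {0<..<1}")
    case True
    then have "norm (u * of_real x) < 1"
      using assms mult_strict_mono[of "norm u" 1 "\<bar>x\<bar>" 1] by (auto simp: norm_mult)
    then have "(\<lambda>n. ((- of_real a) gchoose n) * (- (u * of_real x)) ^ n) sums
        (1 + - (u * of_real x)) powr (- of_real a)"
      by (intro gen_binomial_complex) simp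
    then have "(\<lambda>n. ?t n * of_real x ^ n) sums (1 - u * of_real x) powr (- of_real a)"
      unfolding t_eq by simp
    then show ?thesis by (intro sums_unique[symmetric] sums_mult)
  qed simp
  have coeff: "?t n * of_real (Beta (b + n) (c - b)) =
      of_real (Beta b (c - b)) * (fps_hypergeo [of_real a, of_real b] [of_real c] 1 $ n * u ^ n)" for n
    using Beta_add_nat[of b "c - b" n] assms by (simp add: pochhammer_of_real field_simps)
  have "Beta b (c - b) > 0" using assms by (auto simp: Beta_def intro!: divide_pos_pos mult_pos_pos Gamma_real_pos)
  have "(\<lambda>n. of_real (Beta b (c - b)) * (fps_hypergeo [of_real a, of_real b] [of_real c] 1 $ n * u ^ n))
      sums euler_integral a b c u"
    using sum_f unfolding inner has_bochner_integral_integral_eq[OF hasint_f] coeff euler_integral_def .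
  then have "(\<lambda>n. fps_hypergeo [of_real a, of_real b] [of_real c] 1 $ n * u ^ n)
      sums (euler_integral a b c u / of_real (Beta b (c - b)))"
    using \<open>Beta b (c - b) > 0\<close> by (intro sums_mult_D) auto
  then show ?thesis
    using \<open>Beta b (c - b) > 0\<close> unfolding eval_fps_def by (simp add: sums_iff)
qed

lemma hypergeometric_2F1_euler:
  assumes "0 < b" "b < c" "z \<in> slit_plane"
  shows "hypergeometric_2F1 (of_real a) (of_real b) (of_real c) z =
    euler_integral a b c z / of_real (Beta b (c - b))"
proof (rule hypergeometric_2F1_eqI)
  have B: "Beta b (c - b) > 0" using assms by (auto simp: Beta_def intro!: divide_pos_pos mult_pos_pos Gamma_real_pos)
  show "(\<lambda>z. euler_integral a b c z / of_real (Beta b (c - b))) holomorphic_on slit_plane"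
    using B assms by (intro holomorphic_intros euler_integral_holomorphic) auto
  show "euler_integral a b c u / of_real (Beta b (c - b)) =
      eval_fps (fps_hypergeo [of_real a, of_real b] [of_real c] 1) u" if "norm u < 1" for u
    using B assms that by (simp add: euler_integral_series)
qed (use assms in auto)

text \<open>On the negative axis the Euler integrand is real and nonnegative. This makes the Volterra kernel nonnegative,
which is the condition of Tonelli's theorem in the computations below.\<close>

lemma hypergeometric_2F1_nonpos_real:
  fixes a b c y :: real
  assumes "0 < b" "b < c" "0 \<le> y"
  shows "ennreal (Re (hypergeometric_2F1 (of_real a) (of_real b) (of_real c) (of_real (- y)))) =
    (\<integral>\<^sup>+x. ennreal (beta_weight b (c - b) x * (1 + y * x) powr (- a)) \<partial>lborel) / ennreal (Beta b (c - b))"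
    and "0 \<le> Re (hypergeometric_2F1 (of_real a) (of_real b) (of_real c) (of_real (- y)))"
proof -
  let ?g = "\<lambda>x. beta_weight b (c - b) x * (1 + y * x) powr (- a)"
  have B: "Beta b (c - b) > 0" using assms by (auto simp: Beta_def intro!: divide_pos_pos mult_pos_pos Gamma_real_pos)
  have z: "of_real (- y) \<in> slit_plane" using assms by (simp add: slit_plane_eq)
  have "of_real (beta_weight b (c - b) x) * (1 - of_real (- y) * of_real x) powr (- of_real a) =
      complex_of_real (?g x)" for x
  proof (cases "x \<in> {0<..<1}")
    case True
    then have "0 \<le> 1 + y * x" using assms by auto
    then have "complex_of_real ((1 + y * x) powr (- a)) = of_real (1 + y * x) powr of_real (- a)"
      by (rule powr_of_real[symmetric])
    then show ?thesis by simp
  qed simp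
  then have *: "euler_integral a b c (of_real (- y)) = of_real (\<integral>x. ?g x \<partial>lborel)"
    unfolding euler_integral_def by (simp only: integral_complex_of_real)
  have int: "integrable lborel ?g"
  proof (rule Bochner_Integration.integrable_bound)
    show "integrable lborel (\<lambda>x. max 1 ((1 + y) powr (- a)) * beta_weight b (c - b) x)"
      using has_bochner_integral_beta_weight[of b "c - b"] assms
      by (intro integrable_mult_right) (auto simp: has_bochner_integral_iff)
    have "(1 + y * x) powr (- a) \<le> max 1 ((1 + y) powr (- a))" if "0 < x" "x < 1" for x
    proof (cases "a \<ge> 0")
      case True
      then have "(1 + y * x) powr (- a) \<le> 1 powr (- a)"
        using assms that by (intro powr_mono2') auto
      then show ?thesis by simp
    next
      case False
      then have "(1 + y * x) powr (- a) \<le> (1 + y) powr (- a)"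
        using assms that by (intro powr_mono2) (auto simp: mult_left_le)
      then show ?thesis by simp
    qed
    then show "AE x in lborel. norm (?g x) \<le> norm (max 1 ((1 + y) powr (- a)) * beta_weight b (c - b) x)"
      by (intro AE_I2) (auto simp: indicator_def abs_mult mult.commute intro!: mult_right_mono)
  qed measurable
  have Re: "Re (hypergeometric_2F1 (of_real a) (of_real b) (of_real c) (of_real (- y))) =
      (\<integral>x. ?g x \<partial>lborel) / Beta b (c - b)"
    using hypergeometric_2F1_euler[OF assms(1,2) z, of a] * by (simp add: Re_divide_of_real)
  have nn: "0 \<le> (\<integral>x. ?g x \<partial>lborel)" by (intro integral_nonneg_AE AE_I2) (auto simp: indicator_def)
  show "0 \<le> Re (hypergeometric_2F1 (of_real a) (of_real b) (of_real c) (of_real (- y)))"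
    unfolding Re using nn B by simp
  have "(\<integral>\<^sup>+x. ennreal (?g x) \<partial>lborel) = ennreal (\<integral>x. ?g x \<partial>lborel)"
    by (intro nn_integral_eq_integral int AE_I2) (auto simp: indicator_def)
  then show "ennreal (Re (hypergeometric_2F1 (of_real a) (of_real b) (of_real c) (of_real (- y)))) =
    (\<integral>\<^sup>+x. ennreal (?g x) \<partial>lborel) / ennreal (Beta b (c - b))"
    unfolding Re using nn B by (simp add: divide_ennreal)
qed

section \<open>Inversion of the Volterra kernel\<close>

lemma Beta_pos: "0 < p \<Longrightarrow> 0 < q \<Longrightarrow> 0 < Beta p (q::real)"
  by (auto simp: Beta_def intro!: divide_pos_pos mult_pos_pos Gamma_real_pos)

lemma nn_integral_beta_interval:
  assumes "a < b" "p > 0" "q > 0"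
  shows "(\<integral>\<^sup>+s. ennreal (indicator {a<..<b} s * ((s - a) powr (p - 1) * (b - s) powr (q - 1))) \<partial>lborel)
    = ennreal (Beta p q * (b - a) powr (p + q - 1))"
proof -
  let ?f = "\<lambda>s. indicator {a<..<b} s * ((s - a) powr (p - 1) * (b - s) powr (q - 1))"
  have *: "?f (a + (b - a) * x) = (b - a) powr (p + q - 2) * beta_weight p q x" for x
  proof (cases "x \<in> {0<..<1}")
    case True
    have "(b - a) * x < b - a" using True assms by simp
    then have "a + (b - a) * x < b" by linarith
    then have 1: "a + (b - a) * x \<in> {a<..<b}" using True assms by simp
    have 2: "b - (a + (b - a) * x) = (b - a) * (1 - x)" by (simp add: algebra_simps)
    have "(b - a) powr (p + q - 2) = (b - a) powr (p - 1) * (b - a) powr (q - 1)"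
      by (simp flip: powr_add)
    then show ?thesis using 1 True assms unfolding 2 by (simp add: powr_mult)
  next
    case False
    then have "(b - a) * x \<le> 0 \<or> b - a \<le> (b - a) * x"
      using assms by (auto simp: mult_le_0_iff not_less)
    then have "a + (b - a) * x \<notin> {a<..<b}" by auto
    then show ?thesis using False by simp
  qed
  have "(\<integral>\<^sup>+s. ennreal (?f s) \<partial>lborel) =
      ennreal \<bar>b - a\<bar> * (\<integral>\<^sup>+x. ennreal (?f (a + (b - a) * x)) \<partial>lborel)"
    using assms by (intro nn_integral_real_affine) auto
  also have "(\<integral>\<^sup>+x. ennreal (?f (a + (b - a) * x)) \<partial>lborel) =
      ennreal ((b - a) powr (p + q - 2)) * ennreal (Beta p q)"
    unfolding * by (subst nn_integral_beta_weight[OF assms(2,3), symmetric])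
      (auto simp: ennreal_mult' intro!: nn_integral_cmult)
  also have "ennreal \<bar>b - a\<bar> * \<dots> = ennreal (Beta p q * ((b - a) powr 1 * (b - a) powr (p + q - 2)))"
    using assms by (simp add: ennreal_mult'' ennreal_mult' Beta_pos less_imp_le mult_ac)
  also have "(b - a) powr 1 * (b - a) powr (p + q - 2) = (b - a) powr (p + q - 1)"
    unfolding powr_add[symmetric] by (simp add: algebra_simps)
  finally show ?thesis .
qed

text \<open>The exponents add up to \<open>- 2\<close>, so the substitution \<open>s = 1 / \<sigma>\<close> removes the factor \<open>s powr (- 2 * \<alpha>)\<close>
and leaves a beta integral over \<open>(1 / w, 1 / r)\<close>. The code substitutes \<open>s = - 1 / v\<close> to keep the map increasing.\<close>

lemma nn_integral_beta_inverse:
  assumes "0 < r" "r < w" "0 < \<alpha>"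
  shows "(\<integral>\<^sup>+s. ennreal (indicator {r<..<w} s *
      (s powr (- 2 * \<alpha>) * (s - r) powr (\<alpha> - 1) * (w - s) powr (\<alpha> - 1))) \<partial>lborel)
    = ennreal (Beta \<alpha> \<alpha> * (r * w) powr (- \<alpha>) * (w - r) powr (2 * \<alpha> - 1))"
proof -
  let ?f = "\<lambda>s. s powr (- 2 * \<alpha>) * (s - r) powr (\<alpha> - 1) * (w - s) powr (\<alpha> - 1)"
  let ?g = "\<lambda>v. - 1 / v :: real"
  let ?a = "- 1 / r" and ?b = "- 1 / w"
  have ab: "?a < ?b" using assms by (simp add: field_simps)
  have g: "?g ?a = r" "?g ?b = w" using assms by auto
  have "(\<integral>\<^sup>+s. ennreal (indicator {r<..<w} s * ?f s) \<partial>lborel) =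
      (\<integral>\<^sup>+s. ennreal (?f s * indicator {?g ?a..?g ?b} s) \<partial>lborel)"
    unfolding g by (intro nn_integral_cong) (auto simp: indicator_def not_less less_le)
  also have "\<dots> = (\<integral>\<^sup>+v. ennreal (?f (?g v) * (1 / v\<^sup>2) * indicator {?a..?b} v) \<partial>lborel)"
  proof (rule nn_integral_substitution[where g = ?g and g' = "\<lambda>v. 1 / v\<^sup>2" and a = ?a and b = ?b and f = ?f])
    show "set_borel_measurable borel {?g ?a..?g ?b} ?f"
      unfolding set_borel_measurable_def by measurable
    have neg: "v < 0" if "v \<in> {?a..?b}" for v
    proof -
      have "?b < 0" using assms by simp
      then show ?thesis using that unfolding atLeastAtMost_iff by linarith
    qed
    show "(?g has_real_derivative 1 / v\<^sup>2) (at v)" if "v \<in> {?a..?b}" for v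
      using neg[OF that] by (auto intro!: derivative_eq_intros simp: power2_eq_square)
    show "continuous_on {?a..?b} (\<lambda>v. 1 / v\<^sup>2)"
    proof (intro continuous_intros ballI)
      fix v assume "v \<in> {?a..?b}"
      from neg[OF this] show "v\<^sup>2 \<noteq> 0" by simp
    qed
    show "?a \<le> ?b" using ab by (rule less_imp_le)
  qed auto
  also have "\<dots> = (\<integral>\<^sup>+v. ennreal ((r * w) powr (\<alpha> - 1)) * ennreal (indicator {?a<..<?b} v *
      ((v - ?a) powr (\<alpha> - 1) * (?b - v) powr (\<alpha> - 1))) \<partial>lborel)"
  proof (intro nn_integral_cong)
    fix v :: real
    show "ennreal (?f (?g v) * (1 / v\<^sup>2) * indicator {?a..?b} v) =
      ennreal ((r * w) powr (\<alpha> - 1)) * ennreal (indicator {?a<..<?b} v *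
      ((v - ?a) powr (\<alpha> - 1) * (?b - v) powr (\<alpha> - 1)))"
    proof (cases "v \<in> {?a<..<?b}")
      case False
      have "v = ?a \<or> v = ?b \<or> v \<notin> {?a..?b}" using False by auto
      then show ?thesis using False g by (auto simp: indicator_def)
    next
      case True
      have "?b < 0" using assms by simp
      then have "v < 0" using True unfolding greaterThanLessThan_iff by linarith
      define s where "s = - 1 / v"
      have s: "s > 0" "v = - 1 / s" using \<open>v < 0\<close> by (auto simp: s_def field_simps)
      have e1: "s - r = (r * s) * (v - ?a)" unfolding s(2) using s(1) assms by (simp add: field_simps)
      have e2: "w - s = (w * s) * (?b - v)" unfolding s(2) using s(1) assms by (simp add: field_simps)
      have p: "v - ?a > 0" "?b - v > 0" using True by auto
      have "?f s * (1 / v\<^sup>2) = s powr (- 2 * \<alpha>) * ((r * s) * (v - ?a)) powr (\<alpha> - 1) *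
          ((w * s) * (?b - v)) powr (\<alpha> - 1) * s\<^sup>2"
        unfolding e1 e2 using s by (simp add: power2_eq_square)
      also have "\<dots> = (r * w) powr (\<alpha> - 1) * ((v - ?a) powr (\<alpha> - 1) * (?b - v) powr (\<alpha> - 1)) *
          (s powr (- 2 * \<alpha>) * s powr (\<alpha> - 1) * s powr (\<alpha> - 1) * s powr 2)"
        using s p assms by (simp add: powr_mult powr_numeral)
      also have "s powr (- 2 * \<alpha>) * s powr (\<alpha> - 1) * s powr (\<alpha> - 1) * s powr 2 = 1"
        using s unfolding powr_add[symmetric] by simp
      finally have "?f (?g v) * (1 / v\<^sup>2) =
          (r * w) powr (\<alpha> - 1) * ((v - ?a) powr (\<alpha> - 1) * (?b - v) powr (\<alpha> - 1))"
        by (simp only: s_def mult_1_right)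
      then show ?thesis using True by (simp add: ennreal_mult')
    qed
  qed
  also have "\<dots> = ennreal ((r * w) powr (\<alpha> - 1)) * ennreal (Beta \<alpha> \<alpha> * (?b - ?a) powr (\<alpha> + \<alpha> - 1))"
    by (subst nn_integral_cmult, simp, subst nn_integral_beta_interval[OF ab assms(3,3)]) simp
  also have "\<dots> = ennreal (Beta \<alpha> \<alpha> * ((r * w) powr (\<alpha> - 1) * ((w - r) / (r * w)) powr (2 * \<alpha> - 1)))"
  proof -
    have "?b - ?a = (w - r) / (r * w)" using assms by (simp add: field_simps)
    then show ?thesis by (simp add: mult_ac flip: ennreal_mult')
  qed
  also have "(r * w) powr (\<alpha> - 1) * ((w - r) / (r * w)) powr (2 * \<alpha> - 1) =
      (w - r) powr (2 * \<alpha> - 1) * ((r * w) powr (\<alpha> - 1) / (r * w) powr (2 * \<alpha> - 1))"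
    using assms by (simp add: powr_divide)
  also have "(r * w) powr (\<alpha> - 1) / (r * w) powr (2 * \<alpha> - 1) = (r * w) powr (- \<alpha>)"
    unfolding powr_diff[symmetric] by simp
  finally show ?thesis by (simp add: mult_ac)
qed

context
  fixes \<alpha> :: real
  assumes \<alpha>: "0 < \<alpha>" "\<alpha> < 1/2"
begin

lemma K_kernel_nonneg:
  assumes "0 < s" "s < t"
  shows "0 \<le> K_kernel (1/2 - \<alpha>) t s"
proof -
  have "0 \<le> Re (hypergeometric_2F1 (of_real (- \<alpha>)) (of_real \<alpha>) (of_real (1 - \<alpha>)) (of_real (- (t / s - 1))))"
    using assms \<alpha> by (intro hypergeometric_2F1_nonpos_real) auto
  then show ?thesis
    using \<alpha> Gamma_real_pos[of "1 - \<alpha>"] unfolding K_kernel_def by simp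
qed

text \<open>The Euler integral with the substitution \<open>w = s + (t - s) * x\<close>.\<close>

lemma ennreal_K_kernel:
  assumes "0 < s" "s < t"
  shows "ennreal (K_kernel (1/2 - \<alpha>) t s) = ennreal (s powr (- \<alpha>) / (Gamma \<alpha> * Gamma (1 - 2 * \<alpha>))) *
    (\<integral>\<^sup>+w. ennreal (indicator {s<..<t} w *
       ((w - s) powr (\<alpha> - 1) * (t - w) powr (- 2 * \<alpha>) * w powr \<alpha>)) \<partial>lborel)"
proof -
  let ?f = "\<lambda>w. indicator {s<..<t} w * ((w - s) powr (\<alpha> - 1) * (t - w) powr (- 2 * \<alpha>) * w powr \<alpha>)"
  let ?h = "\<lambda>x. beta_weight \<alpha> (1 - \<alpha> - \<alpha>) x * (1 + (t / s - 1) * x) powr (- (- \<alpha>))"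
  let ?B = "Beta \<alpha> (1 - \<alpha> - \<alpha>)"
  have B: "?B > 0" using \<alpha> by (intro Beta_pos) auto
  have G: "Gamma \<alpha> > 0" "Gamma (1 - \<alpha>) > 0" "Gamma (1 - 2 * \<alpha>) > 0"
    using \<alpha> by (auto intro!: Gamma_real_pos)
  have *: "?f (s + (t - s) * x) = (t - s) powr (- 1 - \<alpha>) * s powr \<alpha> * ?h x" for x
  proof (cases "x \<in> {0<..<1}")
    case True
    have "(t - s) * x < t - s" using True assms by simp
    then have "s + (t - s) * x < t" by linarith
    then have 1: "s + (t - s) * x \<in> {s<..<t}" using True assms by simp
    have 2: "t - (s + (t - s) * x) = (t - s) * (1 - x)" by (simp add: algebra_simps)
    have 3: "s + (t - s) * x = s * (1 + (t / s - 1) * x)" using assms by (simp add: field_simps)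
    have 4: "1 + (t / s - 1) * x > 0" using assms True by (intro add_pos_nonneg mult_nonneg_nonneg) auto
    have "(t - s) powr (- 1 - \<alpha>) = (t - s) powr (\<alpha> - 1) * (t - s) powr (- 2 * \<alpha>)"
      unfolding powr_add[symmetric] by (simp add: algebra_simps)
    moreover have "?f (s + (t - s) * x) = ((t - s) * x) powr (\<alpha> - 1) * ((t - s) * (1 - x)) powr (- 2 * \<alpha>) *
        (s * (1 + (t / s - 1) * x)) powr \<alpha>"
      unfolding 2 3[symmetric] using 1 by simp
    ultimately show ?thesis using True assms 4 by (simp add: powr_mult)
  next
    case False
    then have "(t - s) * x \<le> 0 \<or> t - s \<le> (t - s) * x"
      using assms by (auto simp: mult_le_0_iff not_less)
    then have "s + (t - s) * x \<notin> {s<..<t}" by auto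
    then show ?thesis using False by simp
  qed
  define I where "I = (\<integral>\<^sup>+x. ennreal (?h x) \<partial>lborel)"
  have "(\<integral>\<^sup>+w. ennreal (?f w) \<partial>lborel) =
      ennreal \<bar>t - s\<bar> * (\<integral>\<^sup>+x. ennreal (?f (s + (t - s) * x)) \<partial>lborel)"
    using assms by (intro nn_integral_real_affine) auto
  also have "(\<integral>\<^sup>+x. ennreal (?f (s + (t - s) * x)) \<partial>lborel) =
      ennreal ((t - s) powr (- 1 - \<alpha>) * s powr \<alpha>) * I"
    unfolding * I_def by (subst nn_integral_cmult[symmetric]) (auto simp: ennreal_mult')
  also have "ennreal \<bar>t - s\<bar> * \<dots> = ennreal (((t - s) powr 1 * (t - s) powr (- 1 - \<alpha>)) * s powr \<alpha>) * I"
    using assms by (simp add: ennreal_mult' mult_ac)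
  also have "(t - s) powr 1 * (t - s) powr (- 1 - \<alpha>) = (t - s) powr (- \<alpha>)"
    unfolding powr_add[symmetric] by simp
  finally have F: "(\<integral>\<^sup>+w. ennreal (?f w) \<partial>lborel) = ennreal ((t - s) powr (- \<alpha>) * s powr \<alpha>) * I" .
  have "K_kernel (1/2 - \<alpha>) t s = (inverse (Gamma (1 - \<alpha>)) * (t - s) powr (- \<alpha>)) *
      Re (hypergeometric_2F1 (of_real (- \<alpha>)) (of_real \<alpha>) (of_real (1 - \<alpha>)) (of_real (- (t / s - 1))))"
    unfolding K_kernel_def by simp
  then have "ennreal (K_kernel (1/2 - \<alpha>) t s) = ennreal (inverse (Gamma (1 - \<alpha>)) * (t - s) powr (- \<alpha>)) *
      (I / ennreal ?B)"
    using assms \<alpha> G hypergeometric_2F1_nonpos_real[of \<alpha> "1 - \<alpha>" "t / s - 1" "- \<alpha>"]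
    by (simp add: ennreal_mult' I_def)
  also have "\<dots> = ennreal (inverse (Gamma (1 - \<alpha>)) * (t - s) powr (- \<alpha>) * inverse ?B) * I"
    using B by (simp add: divide_ennreal_def ennreal_mult' mult_ac inverse_ennreal G less_imp_le)
  also have "inverse (Gamma (1 - \<alpha>)) * (t - s) powr (- \<alpha>) * inverse ?B =
      s powr (- \<alpha>) / (Gamma \<alpha> * Gamma (1 - 2 * \<alpha>)) * ((t - s) powr (- \<alpha>) * s powr \<alpha>)"
  proof -
    have "s powr (- \<alpha>) * s powr \<alpha> = 1" using assms by (simp flip: powr_add)
    moreover have "?B = Gamma \<alpha> * Gamma (1 - 2 * \<alpha>) / Gamma (1 - \<alpha>)" by (simp add: Beta_def)
    ultimately show ?thesis using G by (simp add: field_simps)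
  qed
  finally have *: "ennreal (K_kernel (1/2 - \<alpha>) t s) =
    ennreal (s powr (- \<alpha>) / (Gamma \<alpha> * Gamma (1 - 2 * \<alpha>)) * ((t - s) powr (- \<alpha>) * s powr \<alpha>)) * I" .
  have "0 \<le> s powr (- \<alpha>) / (Gamma \<alpha> * Gamma (1 - 2 * \<alpha>))" using G by simp
  from ennreal_mult'[OF this] show ?thesis unfolding F * by (simp only: mult.assoc)
qed

text \<open>Exchanging the order of integration leaves \<open>nn_integral_beta_inverse\<close> as the inner integral; what remains
is a beta integral over \<open>(r, t)\<close> whose exponents add up to \<open>- 1\<close>, so that its value does not depend on the
interval.\<close>

lemma K_kernel_inverse:
  assumes "0 < r" "r < t"
  shows "(\<integral>\<^sup>+s. ennreal (indicator {r<..<t} s * (s powr (- \<alpha>) * (s - r) powr (\<alpha> - 1))) *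
      ennreal (K_kernel (1/2 - \<alpha>) t s) \<partial>lborel) = ennreal (Gamma \<alpha> * r powr (- \<alpha>))"
proof -
  let ?c = "1 / (Gamma \<alpha> * Gamma (1 - 2 * \<alpha>))"
  have G: "Gamma \<alpha> > 0" "Gamma (2 * \<alpha>) > 0" "Gamma (1 - 2 * \<alpha>) > 0"
    using \<alpha> by (auto intro!: Gamma_real_pos)
  let ?F = "\<lambda>s w. ennreal (?c * (indicator {r<..<t} s * indicator {s<..<t} w *
      (s powr (- 2 * \<alpha>) * (s - r) powr (\<alpha> - 1) * (w - s) powr (\<alpha> - 1) *
       ((t - w) powr (- 2 * \<alpha>) * w powr \<alpha>))))"
  have meas: "(\<lambda>(s, w). ?F s w) \<in> borel_measurable (lborel \<Otimes>\<^sub>M lborel)"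
  proof -
    have *: "indicator {s<..<t} w = (if s < w \<and> w < t then 1 else 0 :: real)" for s w by (simp add: indicator_def)
    show ?thesis unfolding * by measurable
  qed
  have "(\<integral>\<^sup>+s. ennreal (indicator {r<..<t} s * (s powr (- \<alpha>) * (s - r) powr (\<alpha> - 1))) *
      ennreal (K_kernel (1/2 - \<alpha>) t s) \<partial>lborel) = (\<integral>\<^sup>+s. \<integral>\<^sup>+w. ?F s w \<partial>lborel \<partial>lborel)"
  proof (intro nn_integral_cong)
    fix s :: real
    show "ennreal (indicator {r<..<t} s * (s powr (- \<alpha>) * (s - r) powr (\<alpha> - 1))) *
      ennreal (K_kernel (1/2 - \<alpha>) t s) = (\<integral>\<^sup>+w. ?F s w \<partial>lborel)"
    proof (cases "s \<in> {r<..<t}")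
      case True
      then have s: "0 < s" "s < t" using assms by auto
      let ?k = "s powr (- \<alpha>) * (s - r) powr (\<alpha> - 1)" 
      let ?f = "\<lambda>w. indicator {s<..<t} w * ((w - s) powr (\<alpha> - 1) * (t - w) powr (- 2 * \<alpha>) * w powr \<alpha>)"
      have "ennreal ?k * ennreal (K_kernel (1/2 - \<alpha>) t s) =
          ennreal (?k * (s powr (- \<alpha>) * ?c)) * (\<integral>\<^sup>+w. ennreal (?f w) \<partial>lborel)"
      proof -
        have *: "ennreal ?k * (ennreal x * I) = ennreal (?k * x) * I" for x I
          by (simp add: ennreal_mult' mult.assoc)
        show ?thesis unfolding ennreal_K_kernel[OF s] * by simp
      qed
      also have "\<dots> = (\<integral>\<^sup>+w. ennreal (?k * (s powr (- \<alpha>) * ?c)) * ennreal (?f w) \<partial>lborel)"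
        by (subst nn_integral_cmult) auto
      also have "\<dots> = (\<integral>\<^sup>+w. ?F s w \<partial>lborel)"
      proof (intro nn_integral_cong)
        fix w
        have "s powr (- \<alpha>) * s powr (- \<alpha>) = s powr (- 2 * \<alpha>)" unfolding powr_add[symmetric] by simp
        then have "?k * (s powr (- \<alpha>) * ?c) * ?f w = ?c * (indicator {r<..<t} s * indicator {s<..<t} w *
          (s powr (- 2 * \<alpha>) * (s - r) powr (\<alpha> - 1) * (w - s) powr (\<alpha> - 1) *
          ((t - w) powr (- 2 * \<alpha>) * w powr \<alpha>)))"
          using True by (simp add: mult_ac)
        then show "ennreal (?k * (s powr (- \<alpha>) * ?c)) * ennreal (?f w) = ?F s w"
          using G by (subst ennreal_mult'[symmetric]) auto
      qed
      finally show ?thesis using True by simp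
    qed simp
  qed
  also have "\<dots> = (\<integral>\<^sup>+w. \<integral>\<^sup>+s. ?F s w \<partial>lborel \<partial>lborel)"
    by (rule lborel_pair.Fubini'[symmetric]) (use meas in \<open>simp add: case_prod_beta'\<close>)
  also have "\<dots> = (\<integral>\<^sup>+w. ennreal (?c * Beta \<alpha> \<alpha> * r powr (- \<alpha>)) * ennreal (indicator {r<..<t} w *
      ((w - r) powr (2 * \<alpha> - 1) * (t - w) powr ((1 - 2 * \<alpha>) - 1))) \<partial>lborel)"
  proof (intro nn_integral_cong)
    fix w :: real
    let ?g = "\<lambda>s. indicator {r<..<w} s * (s powr (- 2 * \<alpha>) * (s - r) powr (\<alpha> - 1) * (w - s) powr (\<alpha> - 1))"
    show "(\<integral>\<^sup>+s. ?F s w \<partial>lborel) = ennreal (?c * Beta \<alpha> \<alpha> * r powr (- \<alpha>)) * ennreal (indicator {r<..<t} w *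
      ((w - r) powr (2 * \<alpha> - 1) * (t - w) powr ((1 - 2 * \<alpha>) - 1)))"
    proof (cases "w \<in> {r<..<t}")
      case True
      let ?d = "?c * ((t - w) powr (- 2 * \<alpha>) * w powr \<alpha>)"
      have d: "0 \<le> ?d" using G by simp
      have "(\<integral>\<^sup>+s. ?F s w \<partial>lborel) = (\<integral>\<^sup>+s. ennreal ?d * ennreal (?g s) \<partial>lborel)"
        using True d by (intro nn_integral_cong, subst ennreal_mult'[symmetric])
          (auto simp: indicator_def mult_ac)
      also have "\<dots> = ennreal ?d * (\<integral>\<^sup>+s. ennreal (?g s) \<partial>lborel)" by (subst nn_integral_cmult) auto
      also have "\<dots> = ennreal (?d * (Beta \<alpha> \<alpha> * (r * w) powr (- \<alpha>) * (w - r) powr (2 * \<alpha> - 1)))"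
        using True assms \<alpha> by (simp only: nn_integral_beta_inverse[of r w \<alpha>] ennreal_mult'[OF d] greaterThanLessThan_iff)
      also have "?d * (Beta \<alpha> \<alpha> * (r * w) powr (- \<alpha>) * (w - r) powr (2 * \<alpha> - 1)) =
          (?c * Beta \<alpha> \<alpha> * r powr (- \<alpha>)) * ((w - r) powr (2 * \<alpha> - 1) * (t - w) powr ((1 - 2 * \<alpha>) - 1)) *
          (w powr \<alpha> * w powr (- \<alpha>))"
        using True assms by (simp add: powr_mult)
      also have "w powr \<alpha> * w powr (- \<alpha>) = 1" using True assms by (simp flip: powr_add)
      finally have *: "(\<integral>\<^sup>+s. ?F s w \<partial>lborel) = ennreal ((?c * Beta \<alpha> \<alpha> * r powr (- \<alpha>)) *
          ((w - r) powr (2 * \<alpha> - 1) * (t - w) powr ((1 - 2 * \<alpha>) - 1)))"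
        by (simp only: mult_1_right)
      have "0 \<le> ?c * Beta \<alpha> \<alpha> * r powr (- \<alpha>)" using G \<alpha> by (simp add: Beta_pos less_imp_le)
      from ennreal_mult'[OF this] show ?thesis unfolding * using True by simp
    next
      case False
      then have "?F s w = 0" for s by (auto simp: indicator_def)
      then show ?thesis using False by simp
    qed
  qed
  also have "\<dots> = ennreal (?c * Beta \<alpha> \<alpha> * r powr (- \<alpha>)) *
      ennreal (Beta (2 * \<alpha>) (1 - 2 * \<alpha>) * (t - r) powr (2 * \<alpha> + (1 - 2 * \<alpha>) - 1))"
    by (subst nn_integral_cmult, simp, subst nn_integral_beta_interval) (use assms \<alpha> in auto)
  also have "\<dots> = ennreal (Gamma \<alpha> * r powr (- \<alpha>))"
  proof -
    have nn: "0 \<le> ?c * Beta \<alpha> \<alpha> * r powr (- \<alpha>)" using G \<alpha> by (simp add: Beta_pos less_imp_le)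
    have "?c * Beta \<alpha> \<alpha> * r powr (- \<alpha>) * (Beta (2 * \<alpha>) (1 - 2 * \<alpha>) * (t - r) powr (2 * \<alpha> + (1 - 2 * \<alpha>) - 1)) =
        Gamma \<alpha> * r powr (- \<alpha>)"
      using G assms by (simp add: Beta_def field_simps)
    then show ?thesis unfolding ennreal_mult'[OF nn, symmetric] by (simp only:)
  qed
  finally show ?thesis .
qed

text \<open>For \<open>J\<close> a set of times this is the Wiener shift \<open>h\<close> that moves \<open>B t\<close> by the length of
\<open>J \<inter> (0, t)\<close>: the operator \<open>s powr (- \<alpha>) * I\<^sup>\<alpha> (r powr \<alpha> * u)\<close> at the indicator function \<open>u\<close> of \<open>J\<close>,
with \<open>I\<^sup>\<alpha>\<close> the Riemann-Liouville integral of order \<open>\<alpha>\<close>. Indicators suffice because the drift of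
the coupling is piecewise constant in time.\<close>

definition fractional_density :: "real set \<Rightarrow> real \<Rightarrow> real" where
  "fractional_density J s = s powr (- \<alpha>) / Gamma \<alpha> *
     (\<integral>r. indicator (J \<inter> {0<..<s}) r * (r powr \<alpha> * (s - r) powr (\<alpha> - 1)) \<partial>lborel)"

lemma fractional_weight_has_integral:
  assumes "0 < s"
  shows "has_bochner_integral lborel (\<lambda>r. indicator {0<..<s} r * (r powr \<alpha> * (s - r) powr (\<alpha> - 1)))
    (Beta (1 + \<alpha>) \<alpha> * s powr (2 * \<alpha>))"
proof (rule has_bochner_integral_nn_integral)
  show "(\<integral>\<^sup>+r. ennreal (indicator {0<..<s} r * (r powr \<alpha> * (s - r) powr (\<alpha> - 1))) \<partial>lborel) =
      ennreal (Beta (1 + \<alpha>) \<alpha> * s powr (2 * \<alpha>))"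
    using nn_integral_beta_interval[OF assms, of "1 + \<alpha>" \<alpha>] \<alpha> by simp
qed (use \<alpha> in \<open>auto simp: Beta_pos less_imp_le intro!: mult_nonneg_nonneg\<close>)

lemma fractional_weight_integrable:
  assumes "J \<in> sets borel"
  shows "integrable lborel (\<lambda>r. indicator (J \<inter> {0<..<s}) r * (r powr \<alpha> * (s - r) powr (\<alpha> - 1)))"
proof (cases "0 < s")
  case True
  have [measurable]: "J \<in> sets borel" by fact
  show ?thesis
  proof (rule Bochner_Integration.integrable_bound)
    show "integrable lborel (\<lambda>r. indicator {0<..<s} r * (r powr \<alpha> * (s - r) powr (\<alpha> - 1)))"
      using fractional_weight_has_integral[OF True] by (simp add: has_bochner_integral_iff)
  qed (measurable, auto simp: indicator_def)
qed simp

lemma fractional_density_measurable [measurable]: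
  assumes [measurable]: "J \<in> sets borel"
  shows "fractional_density J \<in> borel_measurable borel"
proof -
  have *: "indicator (J \<inter> {0<..<s}) r = (indicator J r * (if 0 < r \<and> r < s then 1 else 0) :: real)" for r s
    by (auto simp: indicator_def)
  show ?thesis unfolding fractional_density_def[abs_def] * by measurable
qed

lemma fractional_density_nonneg: "0 \<le> fractional_density J s"
  unfolding fractional_density_def using \<alpha>
  by (intro mult_nonneg_nonneg divide_nonneg_nonneg integral_nonneg_AE AE_I2)
    (auto simp: less_imp_le Gamma_real_pos)

lemma fractional_density_eq_0:
  assumes "\<And>r. r \<in> J \<Longrightarrow> s \<le> r"
  shows "fractional_density J s = 0"
proof -
  have "J \<inter> {0<..<s} = {}" using assms by fastforce
  then show ?thesis by (simp add: fractional_density_def)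
qed

text \<open>The sum is the density of the union, which is at most the density of the whole half-line. Bounding the sum
rather than each term keeps the constant free of the number of cells.\<close>

lemma sum_fractional_density_le:
  fixes J :: "nat \<Rightarrow> real set"
  assumes J: "\<And>j. j < n \<Longrightarrow> J j \<in> sets borel" and disj: "disjoint_family_on J {..<n}" and s: "0 < s"
  shows "(\<Sum>j<n. fractional_density (J j) s) \<le> Beta (1 + \<alpha>) \<alpha> / Gamma \<alpha> * s powr \<alpha>"
proof -
  let ?k = "\<lambda>r. r powr \<alpha> * (s - r) powr (\<alpha> - 1)"
  have G: "Gamma \<alpha> > 0" using \<alpha> by (auto intro: Gamma_real_pos)
  have int: "integrable lborel (\<lambda>r. indicator (J j \<inter> {0<..<s}) r * ?k r)" if "j < n" for j
    by (rule fractional_weight_integrable) (use J that in auto)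
  have "(\<Sum>j<n. \<integral>r. indicator (J j \<inter> {0<..<s}) r * ?k r \<partial>lborel) =
      (\<integral>r. (\<Sum>j<n. indicator (J j \<inter> {0<..<s}) r * ?k r) \<partial>lborel)"
    by (rule Bochner_Integration.integral_sum[symmetric]) (use int in auto)
  also have "\<dots> \<le> (\<integral>r. indicator {0<..<s} r * ?k r \<partial>lborel)"
  proof (rule integral_mono)
    show "integrable lborel (\<lambda>r. \<Sum>j<n. indicator (J j \<inter> {0<..<s}) r * ?k r)"
      by (rule Bochner_Integration.integrable_sum) (use int in auto)
    show "integrable lborel (\<lambda>r. indicator {0<..<s} r * ?k r)"
      using fractional_weight_has_integral[OF s] by (simp add: has_bochner_integral_iff)
    fix r :: real
    have "(\<Sum>j<n. indicator (J j \<inter> {0<..<s}) r :: real) = indicator (\<Union>j<n. J j \<inter> {0<..<s}) r"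
      using disj by (intro indicator_UN_disjoint[symmetric]) (auto simp: disjoint_family_on_def)
    also have "\<dots> \<le> indicator {0<..<s} r" by (auto simp: indicator_def)
    finally show "(\<Sum>j<n. indicator (J j \<inter> {0<..<s}) r * ?k r) \<le> indicator {0<..<s} r * ?k r"
      by (simp add: mult_right_mono flip: sum_distrib_right)
  qed
  also have "\<dots> = Beta (1 + \<alpha>) \<alpha> * s powr (2 * \<alpha>)"
    by (rule has_bochner_integral_integral_eq[OF fractional_weight_has_integral[OF s]])
  finally have "(\<Sum>j<n. fractional_density (J j) s) \<le> s powr (- \<alpha>) / Gamma \<alpha> * (Beta (1 + \<alpha>) \<alpha> * s powr (2 * \<alpha>))"
    unfolding fractional_density_def sum_distrib_left[symmetric] using G by (intro mult_left_mono) auto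
  also have "\<dots> = Beta (1 + \<alpha>) \<alpha> / Gamma \<alpha> * (s powr (- \<alpha>) * s powr (2 * \<alpha>))" by simp
  also have "s powr (- \<alpha>) * s powr (2 * \<alpha>) = s powr \<alpha>" unfolding powr_add[symmetric] by simp
  finally show ?thesis .
qed

lemma fractional_density_le:
  assumes J: "J \<in> sets borel" and s: "0 < s"
  shows "fractional_density J s \<le> Beta (1 + \<alpha>) \<alpha> / Gamma \<alpha> * s powr \<alpha>"
  using sum_fractional_density_le[of 1 "\<lambda>_. J" s] assms by (simp add: disjoint_family_on_def)

text \<open>Tonelli's theorem turns the left-hand side into an integral over \<open>r \<in> J\<close> of \<open>K_kernel_inverse\<close>.\<close>

lemma nn_integral_K_kernel_fractional_density:
  assumes K: "set_borel_measurable lborel {0<..<t} (K_kernel (1/2 - \<alpha>) t)" and J[measurable]: "J \<in> sets borel"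
  shows "(\<integral>\<^sup>+s. ennreal (indicator {0<..<t} s * K_kernel (1/2 - \<alpha>) t s * fractional_density J s) \<partial>lborel) =
    emeasure lborel (J \<inter> {0<..<t})"
proof -
  let ?K = "K_kernel (1/2 - \<alpha>) t"
  let ?K0 = "\<lambda>s. indicator {0<..<t} s * ?K s"
  have G: "Gamma \<alpha> > 0" using \<alpha> by (auto intro: Gamma_real_pos)
  have [measurable]: "?K0 \<in> borel_measurable borel"
    using K by (simp add: set_borel_measurable_def)
  let ?i = "\<lambda>r s. if 0 < r \<and> r < s then 1 else 0 :: real"
  let ?F = "\<lambda>s r. ennreal (?K0 s) * ennreal (s powr (- \<alpha>) / Gamma \<alpha> *
      (indicator J r * ?i r s * (r powr \<alpha> * (s - r) powr (\<alpha> - 1))))"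
  have meas: "(\<lambda>(s, r). ?F s r) \<in> borel_measurable (lborel \<Otimes>\<^sub>M lborel)" by measurable
  have ind: "indicator (J \<inter> {0<..<s}) r = indicator J r * ?i r s" for r s
    by (auto simp: indicator_def)
  have "(\<integral>\<^sup>+s. ennreal (?K0 s * fractional_density J s) \<partial>lborel) = (\<integral>\<^sup>+s. \<integral>\<^sup>+r. ?F s r \<partial>lborel \<partial>lborel)"
  proof (intro nn_integral_cong)
    fix s :: real
    show "ennreal (?K0 s * fractional_density J s) = (\<integral>\<^sup>+r. ?F s r \<partial>lborel)"
    proof (cases "s \<in> {0<..<t}")
      case True
      have eq: "fractional_density J s = (\<integral>r. s powr (- \<alpha>) / Gamma \<alpha> *
          (indicator (J \<inter> {0<..<s}) r * (r powr \<alpha> * (s - r) powr (\<alpha> - 1))) \<partial>lborel)"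
        unfolding fractional_density_def by (rule integral_mult_right_zero[symmetric])
      have density: "ennreal (fractional_density J s) = (\<integral>\<^sup>+r. ennreal (s powr (- \<alpha>) / Gamma \<alpha> *
          (indicator (J \<inter> {0<..<s}) r * (r powr \<alpha> * (s - r) powr (\<alpha> - 1)))) \<partial>lborel)"
        unfolding eq using G fractional_weight_integrable[OF J, of s]
        by (intro nn_integral_eq_integral[symmetric] integrable_mult_right AE_I2) auto
      have "0 \<le> ?K0 s" using K_kernel_nonneg True by simp
      then have "ennreal (?K0 s * fractional_density J s) = ennreal (?K0 s) * ennreal (fractional_density J s)"
        by (rule ennreal_mult')
      also have "\<dots> = (\<integral>\<^sup>+r. ?F s r \<partial>lborel)"
        unfolding density ind by (rule nn_integral_cmult[symmetric]) measurable
      finally show ?thesis .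
    qed simp
  qed
  also have "\<dots> = (\<integral>\<^sup>+r. \<integral>\<^sup>+s. ?F s r \<partial>lborel \<partial>lborel)"
    by (rule lborel_pair.Fubini'[symmetric]) (use meas in \<open>simp add: case_prod_beta'\<close>)
  also have "\<dots> = (\<integral>\<^sup>+r. indicator (J \<inter> {0<..<t}) r \<partial>lborel)"
  proof (intro nn_integral_cong)
    fix r :: real
    show "(\<integral>\<^sup>+s. ?F s r \<partial>lborel) = indicator (J \<inter> {0<..<t}) r"
    proof (cases "r \<in> J \<inter> {0<..<t}")
      case False
      have zero: "?F s r = 0" for s using False by (auto simp: indicator_def)
      show ?thesis unfolding zero using False by simp
    next
      case True
      then have r: "0 < r" "r < t" by auto
      let ?c = "r powr \<alpha> / Gamma \<alpha>"
      have c: "0 \<le> ?c" using G by simp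
      have "(\<integral>\<^sup>+s. ?F s r \<partial>lborel) = (\<integral>\<^sup>+s. ennreal ?c *
          (ennreal (indicator {r<..<t} s * (s powr (- \<alpha>) * (s - r) powr (\<alpha> - 1))) * ennreal (?K0 s)) \<partial>lborel)"
      proof (intro nn_integral_cong)
        fix s
        have "s powr (- \<alpha>) / Gamma \<alpha> * (indicator J r * ?i r s * (r powr \<alpha> * (s - r) powr (\<alpha> - 1))) =
            ?c * (indicator {r<..<t} s * (s powr (- \<alpha>) * (s - r) powr (\<alpha> - 1)))" if "s < t"
          using True that by (auto simp: indicator_def)
        note eq = this
        show "?F s r = ennreal ?c *
          (ennreal (indicator {r<..<t} s * (s powr (- \<alpha>) * (s - r) powr (\<alpha> - 1))) * ennreal (?K0 s))"
        proof (cases "s < t")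
          case True
          show ?thesis unfolding eq[OF True] ennreal_mult'[OF c] by (simp only: mult_ac)
        qed simp
      qed
      also have "\<dots> = ennreal ?c * (\<integral>\<^sup>+s. ennreal (indicator {r<..<t} s * (s powr (- \<alpha>) * (s - r) powr (\<alpha> - 1))) *
          ennreal (?K0 s) \<partial>lborel)"
        by (rule nn_integral_cmult) measurable
      also have "\<dots> = ennreal ?c * ennreal (Gamma \<alpha> * r powr (- \<alpha>))"
      proof -
        have "(\<integral>\<^sup>+s. ennreal (indicator {r<..<t} s * (s powr (- \<alpha>) * (s - r) powr (\<alpha> - 1))) * ennreal (?K0 s) \<partial>lborel) =
            (\<integral>\<^sup>+s. ennreal (indicator {r<..<t} s * (s powr (- \<alpha>) * (s - r) powr (\<alpha> - 1))) *
              ennreal (K_kernel (1/2 - \<alpha>) t s) \<partial>lborel)"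
          using r by (intro nn_integral_cong) (auto simp: indicator_def)
        also have "\<dots> = ennreal (Gamma \<alpha> * r powr (- \<alpha>))" by (rule K_kernel_inverse[OF r])
        finally show ?thesis by (rule arg_cong)
      qed
      also have "\<dots> = ennreal (r powr \<alpha> * r powr (- \<alpha>))"
        unfolding ennreal_mult'[OF c, symmetric] using G by simp
      also have "\<dots> = 1"
      proof -
        have "r powr \<alpha> * r powr (- \<alpha>) = 1" using r unfolding powr_add[symmetric] by simp
        then show ?thesis by (simp only: ennreal_1)
      qed
      finally show ?thesis using True by simp
    qed
  qed
  also have "\<dots> = emeasure lborel (J \<inter> {0<..<t})" by simp
  finally show ?thesis .
qed

end

section \<open>Shifts of Gaussian vectors\<close>

text \<open>Hoelder's inequality with upper bounds in place of the norms. Young's inequality is applied to \<open>f\<close> and \<open>g\<close>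
scaled by these bounds, which therefore have to be positive.\<close>

lemma Hoelder_constants:
  fixes f g :: "'a \<Rightarrow> real" and p q A B :: real
  assumes p: "1 < p" "1 < q" "1 / p + 1 / q = 1"
    and f: "f \<in> borel_measurable M" "\<And>x. 0 \<le> f x" and g: "g \<in> borel_measurable M" "\<And>x. 0 \<le> g x"
    and fp: "(\<integral>\<^sup>+x. ennreal (f x powr p) \<partial>M) \<le> ennreal A" "0 < A"
    and gq: "(\<integral>\<^sup>+x. ennreal (g x powr q) \<partial>M) \<le> ennreal B" "0 < B"
  shows "(\<integral>\<^sup>+x. ennreal (f x * g x) \<partial>M) \<le> ennreal (A powr (1 / p) * B powr (1 / q))"
proof -
  have [measurable]: "f \<in> borel_measurable M" "g \<in> borel_measurable M" by fact+
  let ?a = "A powr (1 / p)" and ?b = "B powr (1 / q)"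
  have ab: "0 < ?a" "0 < ?b" using fp gq by auto
  have pw: "?a powr p = A" "?b powr q = B" using fp gq p by (auto simp: powr_powr)
  have le: "f x * g x \<le> ?a * ?b * (1 / (A * p) * f x powr p + 1 / (B * q) * g x powr q)" for x
  proof -
    have "f x / ?a * (g x / ?b) \<le> (f x / ?a) powr p / p + (g x / ?b) powr q / q"
      using p f g ab by (intro Youngs_inequality) auto
    also have "\<dots> = 1 / (A * p) * f x powr p + 1 / (B * q) * g x powr q"
      using f g ab pw by (simp add: powr_divide)
    finally show ?thesis using ab by (simp add: field_simps)
  qed
  have "(\<integral>\<^sup>+x. ennreal (f x * g x) \<partial>M) \<le>
      (\<integral>\<^sup>+x. ennreal (?a * ?b) * (ennreal (1 / (A * p)) * ennreal (f x powr p) +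
        ennreal (1 / (B * q)) * ennreal (g x powr q)) \<partial>M)"
  proof (intro nn_integral_mono)
    fix x
    have "ennreal (?a * ?b) * (ennreal (1 / (A * p)) * ennreal (f x powr p) +
        ennreal (1 / (B * q)) * ennreal (g x powr q)) =
        ennreal (?a * ?b * (1 / (A * p) * f x powr p + 1 / (B * q) * g x powr q))"
      using fp(2) gq(2) p
      by (subst (1 2) ennreal_mult'[symmetric], simp, simp, subst ennreal_plus[symmetric])
        (auto simp: ennreal_mult'[symmetric] simp del: ennreal_plus)
    then show "ennreal (f x * g x) \<le> ennreal (?a * ?b) * (ennreal (1 / (A * p)) * ennreal (f x powr p) +
        ennreal (1 / (B * q)) * ennreal (g x powr q))"
      using le[of x] by (simp only: ennreal_leI)
  qed
  also have "\<dots> = ennreal (?a * ?b) * (ennreal (1 / (A * p)) * (\<integral>\<^sup>+x. ennreal (f x powr p) \<partial>M) +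
        ennreal (1 / (B * q)) * (\<integral>\<^sup>+x. ennreal (g x powr q) \<partial>M))"
    by (simp add: nn_integral_cmult nn_integral_add)
  also have "\<dots> \<le> ennreal (?a * ?b) * (ennreal (1 / (A * p)) * ennreal A + ennreal (1 / (B * q)) * ennreal B)"
    by (intro mult_left_mono add_mono fp gq) auto
  also have "ennreal (1 / (A * p)) * ennreal A + ennreal (1 / (B * q)) * ennreal B = ennreal (1 / p) + ennreal (1 / q)"
    using fp(2) gq(2) p by (subst (1 2) ennreal_mult'[symmetric]) auto
  also have "\<dots> = ennreal (1 / p + 1 / q)" using p by (intro ennreal_plus[symmetric]) auto
  also have "\<dots> = 1" by (simp only: p(3) ennreal_1)
  finally show ?thesis by simp
qed

abbreviation centered_normal :: "real \<Rightarrow> real measure" where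
  "centered_normal \<sigma> \<equiv> density lborel (\<lambda>x. ennreal (normal_density 0 \<sigma> x))"

definition gaussian_vector :: "(nat \<Rightarrow> real) \<Rightarrow> nat \<Rightarrow> (nat \<Rightarrow> real) measure" where
  "gaussian_vector \<sigma> N = PiM {..<N} (\<lambda>i. centered_normal (\<sigma> i))"

lemma sets_gaussian_vector [measurable_cong, simp]:
  "sets (gaussian_vector \<sigma> N) = sets (PiM {..<N} (\<lambda>_. borel))"
  unfolding gaussian_vector_def by (intro sets_PiM_cong) auto

lemma space_gaussian_vector [simp]: "space (gaussian_vector \<sigma> N) = ({..<N} \<rightarrow>\<^sub>E UNIV)"
  by (simp add: gaussian_vector_def space_PiM)

lemma prob_space_gaussian_vector:
  assumes "\<And>i. 0 < \<sigma> i"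
  shows "prob_space (gaussian_vector \<sigma> N)"
  unfolding gaussian_vector_def by (intro prob_space_PiM prob_space_normal_density assms)

lemma nn_integral_gaussian_vector_Suc:
  assumes \<sigma>: "\<And>i. 0 < \<sigma> i" and "G \<in> borel_measurable (PiM {..<Suc N} (\<lambda>_. borel))"
  shows "(\<integral>\<^sup>+w. G w \<partial>gaussian_vector \<sigma> (Suc N)) =
    (\<integral>\<^sup>+w. (\<integral>\<^sup>+v. G (w(N := v)) \<partial>centered_normal (\<sigma> N)) \<partial>gaussian_vector \<sigma> N)"
proof -
  interpret product_prob_space "\<lambda>i. centered_normal (\<sigma> i)"
    by (simp add: product_prob_space_def product_prob_space_axioms_def product_sigma_finite_def
        prob_space_normal_density \<sigma> prob_space_imp_sigma_finite)
  have "G \<in> borel_measurable (gaussian_vector \<sigma> (Suc N))"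
    using assms(2) by (simp add: measurable_cong_sets[OF sets_gaussian_vector refl])
  then show ?thesis
    unfolding gaussian_vector_def lessThan_Suc
    by (intro product_nn_integral_insert) auto
qed

text \<open>The exponential is the quotient of the normal densities at \<open>v + h\<close> and \<open>v\<close>, so the claim is translation
invariance of Lebesgue measure.\<close>

lemma nn_integral_centered_normal_shift:
  assumes \<sigma>: "0 < \<sigma>" and [measurable]: "G \<in> borel_measurable borel"
  shows "(\<integral>\<^sup>+v. G (v + h) * ennreal (exp (- ((h * v + h\<^sup>2 / 2) / \<sigma>\<^sup>2))) \<partial>centered_normal \<sigma>) =
    (\<integral>\<^sup>+v. G v \<partial>centered_normal \<sigma>)"
proof -
  have exp_eq: "normal_density 0 \<sigma> v * exp (- ((h * v + h\<^sup>2 / 2) / \<sigma>\<^sup>2)) = normal_density 0 \<sigma> (v + h)" for v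
  proof -
    have "- (v\<^sup>2) / (2 * \<sigma>\<^sup>2) + - ((h * v + h\<^sup>2 / 2) / \<sigma>\<^sup>2) = - (v + h)\<^sup>2 / (2 * \<sigma>\<^sup>2)"
      using \<sigma> by (simp add: field_simps power2_eq_square)
    then have "exp (- (v\<^sup>2) / (2 * \<sigma>\<^sup>2)) * exp (- ((h * v + h\<^sup>2 / 2) / \<sigma>\<^sup>2)) = exp (- (v + h)\<^sup>2 / (2 * \<sigma>\<^sup>2))"
      by (simp only: exp_add[symmetric])
    then show ?thesis by (simp add: normal_density_def)
  qed
  have "(\<integral>\<^sup>+v. G (v + h) * ennreal (exp (- ((h * v + h\<^sup>2 / 2) / \<sigma>\<^sup>2))) \<partial>centered_normal \<sigma>) =
      (\<integral>\<^sup>+v. ennreal (normal_density 0 \<sigma> v) * (G (v + h) * ennreal (exp (- ((h * v + h\<^sup>2 / 2) / \<sigma>\<^sup>2)))) \<partial>lborel)"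
    by (rule nn_integral_density) auto
  also have "\<dots> = (\<integral>\<^sup>+v. ennreal (normal_density 0 \<sigma> (h + 1 * v)) * G (h + 1 * v) \<partial>lborel)"
  proof (intro nn_integral_cong)
    fix v
    have "ennreal (normal_density 0 \<sigma> v) * ennreal (exp (- ((h * v + h\<^sup>2 / 2) / \<sigma>\<^sup>2))) =
        ennreal (normal_density 0 \<sigma> (h + 1 * v))"
      using exp_eq[of v] by (simp add: ennreal_mult'[symmetric] add.commute)
    then show "ennreal (normal_density 0 \<sigma> v) * (G (v + h) * ennreal (exp (- ((h * v + h\<^sup>2 / 2) / \<sigma>\<^sup>2)))) =
        ennreal (normal_density 0 \<sigma> (h + 1 * v)) * G (h + 1 * v)"
      by (simp add: mult_ac add.commute)
  qed
  also have "\<dots> = (\<integral>\<^sup>+v. ennreal (normal_density 0 \<sigma> v) * G v \<partial>lborel)"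
    by (subst nn_integral_real_affine[where c = 1 and t = h]) auto
  also have "\<dots> = (\<integral>\<^sup>+v. G v \<partial>centered_normal \<sigma>)"
    by (rule nn_integral_density[symmetric]) auto
  finally show ?thesis .
qed

definition shift_vector :: "(nat \<Rightarrow> (nat \<Rightarrow> real) \<Rightarrow> real) \<Rightarrow> nat \<Rightarrow> (nat \<Rightarrow> real) \<Rightarrow> nat \<Rightarrow> real" where
  "shift_vector h N w = (\<lambda>i\<in>{..<N}. w i + h i w)"

definition girsanov_density ::
  "(nat \<Rightarrow> real) \<Rightarrow> (nat \<Rightarrow> (nat \<Rightarrow> real) \<Rightarrow> real) \<Rightarrow> nat \<Rightarrow> (nat \<Rightarrow> real) \<Rightarrow> real" where
  "girsanov_density \<sigma> h N w = exp (- (\<Sum>i<N. (h i w * w i + (h i w)\<^sup>2 / 2) / (\<sigma> i)\<^sup>2))"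

lemma girsanov_density_nonneg [simp]: "0 \<le> girsanov_density \<sigma> h N w"
  by (simp add: girsanov_density_def)

text \<open>The coordinates are revealed in order, and \<open>h i\<close> may use only those below \<open>i\<close>. Both conditions are stated for
every \<open>n \<ge> i\<close> so that they can be used at each stage of an induction on the dimension.\<close>

definition predictable :: "(nat \<Rightarrow> (nat \<Rightarrow> real) \<Rightarrow> real) \<Rightarrow> bool" where
  "predictable h \<longleftrightarrow> (\<forall>i n. i \<le> n \<longrightarrow> h i \<in> borel_measurable (PiM {..<n} (\<lambda>_. borel)) \<and>
     (\<forall>w v. h i (w(n := v)) = h i w))"

lemma predictable_measurable: "predictable h \<Longrightarrow> i \<le> n \<Longrightarrow> h i \<in> borel_measurable (PiM {..<n} (\<lambda>_. borel))"
  by (simp add: predictable_def)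

lemma predictable_upd: "predictable h \<Longrightarrow> i \<le> n \<Longrightarrow> h i (w(n := v)) = h i w"
  by (simp add: predictable_def)

lemma shift_vector_measurable:
  assumes "predictable h"
  shows "shift_vector h N \<in> measurable (PiM {..<N} (\<lambda>_. borel)) (PiM {..<N} (\<lambda>_. borel))"
  unfolding shift_vector_def[abs_def]
proof (rule measurable_restrict)
  fix i assume i: "i \<in> {..<N}"
  have [measurable]: "h i \<in> borel_measurable (PiM {..<N} (\<lambda>_. borel))"
    using predictable_measurable[OF assms] i by simp
  show "(\<lambda>w. w i + h i w) \<in> borel_measurable (PiM {..<N} (\<lambda>_. borel))"
    using i by measurable
qed

lemma girsanov_density_measurable:
  assumes "predictable h"
  shows "girsanov_density \<sigma> h N \<in> borel_measurable (PiM {..<N} (\<lambda>_. borel))"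
proof -
  have "(\<lambda>w. \<Sum>i<N. (h i w * w i + (h i w)\<^sup>2 / 2) / (\<sigma> i)\<^sup>2) \<in> borel_measurable (PiM {..<N} (\<lambda>_. borel))"
  proof (rule borel_measurable_sum)
    fix i assume i: "i \<in> {..<N}"
    have [measurable]: "h i \<in> borel_measurable (PiM {..<N} (\<lambda>_. borel))"
      using predictable_measurable[OF assms] i by simp
    show "(\<lambda>w. (h i w * w i + (h i w)\<^sup>2 / 2) / (\<sigma> i)\<^sup>2) \<in> borel_measurable (PiM {..<N} (\<lambda>_. borel))"
      using i by measurable
  qed
  then show ?thesis unfolding girsanov_density_def[abs_def] by measurable
qed

text \<open>Induction on the dimension. Given the other coordinates the last shift \<open>h N\<close> is a constant, so that
\<open>nn_integral_centered_normal_shift\<close> removes it; the earlier coordinates do not see the last one.\<close>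

lemma nn_integral_girsanov:
  assumes h: "predictable h" and \<sigma>: "\<And>i. 0 < \<sigma> i"
    and "G \<in> borel_measurable (PiM {..<N} (\<lambda>_. borel))"
  shows "(\<integral>\<^sup>+w. G (shift_vector h N w) * ennreal (girsanov_density \<sigma> h N w) \<partial>gaussian_vector \<sigma> N) =
    (\<integral>\<^sup>+w. G w \<partial>gaussian_vector \<sigma> N)"
  using assms(3)
proof (induction N arbitrary: G)
  case 0
  have "(\<integral>\<^sup>+w. G (shift_vector h 0 w) * ennreal (girsanov_density \<sigma> h 0 w) \<partial>gaussian_vector \<sigma> 0) =
      (\<integral>\<^sup>+w. G w \<partial>gaussian_vector \<sigma> 0)"
    by (intro nn_integral_cong) (auto simp: shift_vector_def girsanov_density_def restrict_def)
  then show ?case .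
next
  case (Suc N)
  note [measurable] = Suc.prems
  have upd [measurable]: "(\<lambda>(w, v). w(N := v)) \<in> measurable (PiM {..<N} (\<lambda>_. borel) \<Otimes>\<^sub>M borel) (PiM {..<Suc N} (\<lambda>_. borel))"
    using measurable_add_dim[of N "{..<N}" "\<lambda>_. borel"] by (simp add: lessThan_Suc)
  have upd2 [measurable]: "(\<lambda>v. w(N := v)) \<in> measurable borel (PiM {..<Suc N} (\<lambda>_. borel))"
    if "w \<in> space (gaussian_vector \<sigma> N)" for w
    using measurable_compose[OF measurable_Pair1' upd, of w] that by (simp add: space_PiM)
  let ?G = "\<lambda>x. \<integral>\<^sup>+v. G (x(N := v)) \<partial>centered_normal (\<sigma> N)"
  interpret N: prob_space "centered_normal (\<sigma> N)" by (rule prob_space_normal_density[OF \<sigma>])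
  have G_meas: "?G \<in> borel_measurable (PiM {..<N} (\<lambda>_. borel))"
  proof (rule N.borel_measurable_nn_integral)
    have "(\<lambda>p. G ((\<lambda>(w, v). w(N := v)) p)) \<in> borel_measurable (PiM {..<N} (\<lambda>_. borel) \<Otimes>\<^sub>M borel)"
      by measurable
    then show "(\<lambda>(x, y). G (x(N := y))) \<in> borel_measurable (PiM {..<N} (\<lambda>_. borel) \<Otimes>\<^sub>M centered_normal (\<sigma> N))"
      by (simp add: case_prod_beta' cong: measurable_cong_sets)
  qed
  have meas: "(\<lambda>w. G (shift_vector h (Suc N) w) * ennreal (girsanov_density \<sigma> h (Suc N) w))
      \<in> borel_measurable (PiM {..<Suc N} (\<lambda>_. borel))"
    using measurable_compose[OF shift_vector_measurable[OF h] Suc.prems]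
    by (intro borel_measurable_times_ennreal measurable_compose[OF girsanov_density_measurable[OF h] measurable_ennreal])
  have shift: "shift_vector h (Suc N) (w(N := v)) = (shift_vector h N w)(N := v + h N w)" for w v
    using predictable_upd[OF h] by (auto simp: shift_vector_def fun_eq_iff less_Suc_eq)
  have dens: "girsanov_density \<sigma> h (Suc N) (w(N := v)) =
      girsanov_density \<sigma> h N w * exp (- ((h N w * v + (h N w)\<^sup>2 / 2) / (\<sigma> N)\<^sup>2))" for w v
    using predictable_upd[OF h] by (simp add: girsanov_density_def exp_add[symmetric])
  have "(\<integral>\<^sup>+w. G (shift_vector h (Suc N) w) * ennreal (girsanov_density \<sigma> h (Suc N) w) \<partial>gaussian_vector \<sigma> (Suc N)) =
      (\<integral>\<^sup>+w. (\<integral>\<^sup>+v. G ((shift_vector h N w)(N := v + h N w)) *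
        (ennreal (girsanov_density \<sigma> h N w) * ennreal (exp (- ((h N w * v + (h N w)\<^sup>2 / 2) / (\<sigma> N)\<^sup>2))))
        \<partial>centered_normal (\<sigma> N)) \<partial>gaussian_vector \<sigma> N)"
    by (subst nn_integral_gaussian_vector_Suc[OF \<sigma> meas]) (simp add: shift dens ennreal_mult')
  also have "\<dots> = (\<integral>\<^sup>+w. ?G (shift_vector h N w) * ennreal (girsanov_density \<sigma> h N w) \<partial>gaussian_vector \<sigma> N)"
  proof (intro nn_integral_cong)
    fix w assume w: "w \<in> space (gaussian_vector \<sigma> N)"
    have sp: "shift_vector h N w \<in> space (gaussian_vector \<sigma> N)" by (auto simp: shift_vector_def)
    have [measurable]: "(\<lambda>v. G ((shift_vector h N w)(N := v))) \<in> borel_measurable borel"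
      using measurable_compose[OF upd2[OF sp] Suc.prems] .
    have "(\<integral>\<^sup>+v. G ((shift_vector h N w)(N := v + h N w)) *
        (ennreal (girsanov_density \<sigma> h N w) * ennreal (exp (- ((h N w * v + (h N w)\<^sup>2 / 2) / (\<sigma> N)\<^sup>2))))
        \<partial>centered_normal (\<sigma> N)) =
      (\<integral>\<^sup>+v. ennreal (girsanov_density \<sigma> h N w) * (G ((shift_vector h N w)(N := v + h N w)) *
         ennreal (exp (- ((h N w * v + (h N w)\<^sup>2 / 2) / (\<sigma> N)\<^sup>2)))) \<partial>centered_normal (\<sigma> N))"
      by (simp only: mult_ac)
    also have "\<dots> = ennreal (girsanov_density \<sigma> h N w) * (\<integral>\<^sup>+v. G ((shift_vector h N w)(N := v + h N w)) *
         ennreal (exp (- ((h N w * v + (h N w)\<^sup>2 / 2) / (\<sigma> N)\<^sup>2))) \<partial>centered_normal (\<sigma> N))"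
      by (rule nn_integral_cmult) measurable
    also have "(\<integral>\<^sup>+v. G ((shift_vector h N w)(N := v + h N w)) *
         ennreal (exp (- ((h N w * v + (h N w)\<^sup>2 / 2) / (\<sigma> N)\<^sup>2))) \<partial>centered_normal (\<sigma> N)) =
         ?G (shift_vector h N w)"
      by (rule nn_integral_centered_normal_shift[OF \<sigma>, where G = "\<lambda>v. G ((shift_vector h N w)(N := v))"]) measurable
    finally show "(\<integral>\<^sup>+v. G ((shift_vector h N w)(N := v + h N w)) *
        (ennreal (girsanov_density \<sigma> h N w) * ennreal (exp (- ((h N w * v + (h N w)\<^sup>2 / 2) / (\<sigma> N)\<^sup>2))))
        \<partial>centered_normal (\<sigma> N)) = ?G (shift_vector h N w) * ennreal (girsanov_density \<sigma> h N w)"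
      by (simp only: mult.commute)
  qed
  also have "\<dots> = (\<integral>\<^sup>+w. ?G w \<partial>gaussian_vector \<sigma> N)" by (rule Suc.IH[OF G_meas])
  also have "\<dots> = (\<integral>\<^sup>+w. G w \<partial>gaussian_vector \<sigma> (Suc N))"
    by (rule nn_integral_gaussian_vector_Suc[OF \<sigma>, symmetric]) measurable
  finally show ?case .
qed

lemma predictable_cmult: "predictable h \<Longrightarrow> predictable (\<lambda>i w. c * h i w)"
  by (auto simp: predictable_def intro!: borel_measurable_times)

text \<open>The \<open>q\<close>-th power of the density for \<open>h\<close> is the density for \<open>q * h\<close> times the exponential of
\<open>q * (q - 1) / 2\<close> times the energy; the latter is at most \<open>D\<close> and the former has integral \<open>1\<close>.\<close>

lemma girsanov_density_moment:
  assumes h: "predictable h" and \<sigma>: "\<And>i. 0 < \<sigma> i"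
    and D: "\<And>w. (\<Sum>i<N. (h i w)\<^sup>2 / (\<sigma> i)\<^sup>2) \<le> D" and q: "1 \<le> q"
  shows "(\<integral>\<^sup>+w. ennreal (girsanov_density \<sigma> h N w powr q) \<partial>gaussian_vector \<sigma> N) \<le>
    ennreal (exp (q * (q - 1) * D / 2))"
proof -
  let ?h = "\<lambda>i w. q * h i w"
  interpret prob_space "gaussian_vector \<sigma> N" by (rule prob_space_gaussian_vector[OF \<sigma>])
  have le: "girsanov_density \<sigma> h N w powr q \<le> exp (q * (q - 1) * D / 2) * girsanov_density \<sigma> ?h N w" for w
  proof -
    have "- q * (\<Sum>i<N. (h i w * w i + (h i w)\<^sup>2 / 2) / (\<sigma> i)\<^sup>2) =
        q * (q - 1) / 2 * (\<Sum>i<N. (h i w)\<^sup>2 / (\<sigma> i)\<^sup>2) -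
        (\<Sum>i<N. (?h i w * w i + (?h i w)\<^sup>2 / 2) / (\<sigma> i)\<^sup>2)"
      unfolding sum_distrib_left sum_subtractf[symmetric]
      using \<sigma> by (intro sum.cong refl) (simp add: field_simps power2_eq_square less_imp_neq[THEN not_sym])
    also have "\<dots> \<le> q * (q - 1) / 2 * D - (\<Sum>i<N. (?h i w * w i + (?h i w)\<^sup>2 / 2) / (\<sigma> i)\<^sup>2)"
      using q D by (intro diff_right_mono mult_left_mono) auto
    finally have "exp (- q * (\<Sum>i<N. (h i w * w i + (h i w)\<^sup>2 / 2) / (\<sigma> i)\<^sup>2)) \<le>
        exp (q * (q - 1) * D / 2 + - (\<Sum>i<N. (?h i w * w i + (?h i w)\<^sup>2 / 2) / (\<sigma> i)\<^sup>2))"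
      by simp
    then show ?thesis unfolding girsanov_density_def exp_add[symmetric] by (simp add: exp_powr_real mult_ac)
  qed
  have [measurable]: "girsanov_density \<sigma> ?h N \<in> borel_measurable (PiM {..<N} (\<lambda>_. borel))"
    by (intro girsanov_density_measurable predictable_cmult h)
  have "(\<integral>\<^sup>+w. ennreal (girsanov_density \<sigma> h N w powr q) \<partial>gaussian_vector \<sigma> N) \<le>
      (\<integral>\<^sup>+w. ennreal (exp (q * (q - 1) * D / 2)) * ennreal (girsanov_density \<sigma> ?h N w) \<partial>gaussian_vector \<sigma> N)"
    by (intro nn_integral_mono, subst ennreal_mult'[symmetric]) (use le in \<open>auto intro: ennreal_leI\<close>)
  also have "\<dots> = ennreal (exp (q * (q - 1) * D / 2)) * (\<integral>\<^sup>+w. 1 * ennreal (girsanov_density \<sigma> ?h N w) \<partial>gaussian_vector \<sigma> N)"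
    by (simp add: nn_integral_cmult)
  also have "(\<integral>\<^sup>+w. 1 * ennreal (girsanov_density \<sigma> ?h N w) \<partial>gaussian_vector \<sigma> N) = (\<integral>\<^sup>+w. 1 \<partial>gaussian_vector \<sigma> N)"
    by (rule nn_integral_girsanov[OF predictable_cmult[OF h] \<sigma>, where G = "\<lambda>_. 1"]) simp
  also have "\<dots> = 1" using emeasure_space_1 by simp
  finally show ?thesis by simp
qed

text \<open>The power inequality in finite dimension: change of measure, Hoelder's inequality and the moment bound. The
error \<open>e\<close> allows the shifted path to miss the target slightly, which happens because step functions only
approximate the kernel.\<close>

lemma gaussian_harnack:
  fixes \<phi> \<psi> :: "(nat \<Rightarrow> real) \<Rightarrow> real"
  assumes h: "predictable h" and \<sigma>: "\<And>i. 0 < \<sigma> i"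
    and D: "\<And>w. (\<Sum>i<N. (h i w)\<^sup>2 / (\<sigma> i)\<^sup>2) \<le> D" and p: "1 < p"
    and \<phi>: "\<phi> \<in> borel_measurable (PiM {..<N} (\<lambda>_. borel))" "\<And>w. 0 \<le> \<phi> w" "\<And>w. \<phi> w \<le> C"
    and \<psi>: "\<psi> \<in> borel_measurable (PiM {..<N} (\<lambda>_. borel))" "\<And>w. 0 \<le> \<psi> w" "\<And>w. \<psi> w \<le> C"
    and shift: "\<And>w. w \<in> {..<N} \<rightarrow>\<^sub>E UNIV \<Longrightarrow> \<psi> (shift_vector h N w) \<le> \<phi> w + e" and e: "0 \<le> e"
  shows "(\<integral>w. \<psi> w \<partial>gaussian_vector \<sigma> N) \<le>
    (\<integral>w. \<phi> w powr p \<partial>gaussian_vector \<sigma> N) powr (1 / p) * exp (D / (2 * (p - 1))) + e"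
proof -
  let ?P = "gaussian_vector \<sigma> N" and ?R = "girsanov_density \<sigma> h N"
  define q where "q = p / (p - 1)"
  have q: "1 < q" "1 / q + 1 / p = 1" using p by (auto simp: q_def field_simps)
  have "q - 1 = 1 / (p - 1)" using p by (simp add: q_def field_simps)
  then have ep: "q * (q - 1) * D / 2 * (1 / q) = D / (2 * (p - 1))" using q by simp
  interpret prob_space ?P by (rule prob_space_gaussian_vector[OF \<sigma>])
  have [measurable]: "?R \<in> borel_measurable (PiM {..<N} (\<lambda>_. borel))"
    "\<phi> \<in> borel_measurable (PiM {..<N} (\<lambda>_. borel))" "\<psi> \<in> borel_measurable (PiM {..<N} (\<lambda>_. borel))"
    by (intro girsanov_density_measurable h) fact+
  have R: "0 \<le> ?R w" for w by (simp add: girsanov_density_def)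
  have [simp]: "integrable ?P \<psi>" "integrable ?P (\<lambda>w. \<phi> w powr p)"
    by (rule integrable_const_bound[where B = C], use \<psi> in auto)
      (rule integrable_const_bound[where B = "C powr p"], use \<phi> p in \<open>auto intro!: powr_mono2\<close>)
  define a where "a = (\<integral>w. \<phi> w powr p \<partial>?P)"
  have a: "0 \<le> a" unfolding a_def by (intro integral_nonneg_AE AE_I2) auto
  \<comment> \<open>The moment of \<open>\<phi>\<close> may vanish, so Hoelder's inequality is applied with every constant \<open>A > a\<close>, and then \<open>A\<close> tends to \<open>a\<close>.\<close>
  have bound: "(\<integral>w. \<psi> w \<partial>?P) \<le> A powr (1 / p) * exp (D / (2 * (p - 1))) + e" if "a < A" for A
  proof -
    have A: "0 < A" using a that by simp
    have "ennreal (\<integral>w. \<psi> w \<partial>?P) = (\<integral>\<^sup>+w. ennreal (\<psi> w) \<partial>?P)"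
      using \<psi> by (intro nn_integral_eq_integral[symmetric] AE_I2) auto
    also have "\<dots> = (\<integral>\<^sup>+w. ennreal (\<psi> (shift_vector h N w)) * ennreal (?R w) \<partial>?P)"
      by (rule nn_integral_girsanov[OF h \<sigma>, symmetric, where G = "\<lambda>w. ennreal (\<psi> w)"]) measurable
    also have "\<dots> \<le> (\<integral>\<^sup>+w. ennreal (?R w * \<phi> w) + ennreal e * (1 * ennreal (?R w)) \<partial>?P)"
    proof (intro nn_integral_mono)
      fix w assume "w \<in> space ?P"
      then have "\<psi> (shift_vector h N w) * ?R w \<le> (\<phi> w + e) * ?R w"
        using R by (intro mult_right_mono shift) auto
      then have "ennreal (\<psi> (shift_vector h N w) * ?R w) \<le> ennreal (?R w * \<phi> w + e * ?R w)"
        by (intro ennreal_leI) (simp add: algebra_simps)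
      then show "ennreal (\<psi> (shift_vector h N w)) * ennreal (?R w) \<le> ennreal (?R w * \<phi> w) + ennreal e * (1 * ennreal (?R w))"
        using R \<phi> \<psi> e by (simp add: ennreal_mult'[symmetric] ennreal_plus[symmetric] del: ennreal_plus)
    qed
    also have "\<dots> = (\<integral>\<^sup>+w. ennreal (?R w * \<phi> w) \<partial>?P) + ennreal e * (\<integral>\<^sup>+w. 1 * ennreal (?R w) \<partial>?P)"
      by (simp add: nn_integral_add nn_integral_cmult)
    also have "(\<integral>\<^sup>+w. 1 * ennreal (?R w) \<partial>?P) = (\<integral>\<^sup>+w. 1 \<partial>?P)"
      by (rule nn_integral_girsanov[OF h \<sigma>, where G = "\<lambda>_. 1"]) simp
    also have "\<dots> = 1" using emeasure_space_1 by simp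
    also have "(\<integral>\<^sup>+w. ennreal (?R w * \<phi> w) \<partial>?P) \<le> ennreal (exp (q * (q - 1) * D / 2) powr (1 / q) * A powr (1 / p))"
    proof (rule Hoelder_constants)
      show "(\<integral>\<^sup>+w. ennreal (?R w powr q) \<partial>?P) \<le> ennreal (exp (q * (q - 1) * D / 2))"
        using q by (intro girsanov_density_moment h \<sigma> D) auto
      have "(\<integral>\<^sup>+w. ennreal (\<phi> w powr p) \<partial>?P) = ennreal a"
        unfolding a_def by (intro nn_integral_eq_integral AE_I2) auto
      then show "(\<integral>\<^sup>+w. ennreal (\<phi> w powr p) \<partial>?P) \<le> ennreal A" using that by (simp add: ennreal_leI)
    qed (use q p R \<phi> A in auto)
    finally have "ennreal (\<integral>w. \<psi> w \<partial>?P) \<le> ennreal (exp (q * (q - 1) * D / 2) powr (1 / q) * A powr (1 / p)) + ennreal e"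
      by (simp add: add_right_mono)
    also have "exp (q * (q - 1) * D / 2) powr (1 / q) = exp (D / (2 * (p - 1)))"
      unfolding exp_powr_real ep ..
    finally show ?thesis using e by (simp add: ennreal_plus[symmetric] mult.commute del: ennreal_plus)
  qed
  have "((\<lambda>A. A powr (1 / p) * exp (D / (2 * (p - 1))) + e) \<longlongrightarrow>
      a powr (1 / p) * exp (D / (2 * (p - 1))) + e) (at_right a)"
    using p a by (intro tendsto_intros tendsto_powr') (auto simp: eventually_at_right_field intro!: exI[of _ "a + 1"])
  then have "(\<integral>w. \<psi> w \<partial>?P) \<le> a powr (1 / p) * exp (D / (2 * (p - 1))) + e"
    by (rule tendsto_lowerbound) (use bound in \<open>auto simp: eventually_at_right_field intro!: exI[of _ "a + 1"]\<close>)
  then show ?thesis by (simp add: a_def)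
qed

section \<open>The Euler scheme and its coupling\<close>

primrec euler_path :: "(nat \<Rightarrow> real \<Rightarrow> real) \<Rightarrow> real \<Rightarrow> (nat \<Rightarrow> real) \<Rightarrow> nat \<Rightarrow> real" where
  "euler_path \<beta> z B 0 = z + B 0"
| "euler_path \<beta> z B (Suc k) = euler_path \<beta> z B k + \<beta> k (euler_path \<beta> z B k) + (B (Suc k) - B k)"

lemma euler_path_eq_sum: "euler_path \<beta> z B k = z + (\<Sum>j<k. \<beta> j (euler_path \<beta> z B j)) + B k"
  by (induction k) auto

lemma discrete_gronwall:
  fixes d :: "nat \<Rightarrow> real"
  assumes "\<And>k. k \<le> n \<Longrightarrow> d k \<le> e + \<kappa> * (\<Sum>j<k. d j)" "0 \<le> \<kappa>" "k \<le> n"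
  shows "d k \<le> e * (1 + \<kappa>) ^ k"
proof -
  have "e + \<kappa> * (\<Sum>j<k. d j) \<le> e * (1 + \<kappa>) ^ k"
    using \<open>k \<le> n\<close>
  proof (induction k)
    case (Suc k)
    have "\<kappa> * d k \<le> \<kappa> * (e + \<kappa> * (\<Sum>j<k. d j))"
      using assms(1)[of k] Suc.prems assms(2) by (intro mult_left_mono) auto
    then have "e + \<kappa> * (\<Sum>j<Suc k. d j) \<le> (1 + \<kappa>) * (e + \<kappa> * (\<Sum>j<k. d j))"
      by (simp add: algebra_simps)
    also have "\<dots> \<le> (1 + \<kappa>) * (e * (1 + \<kappa>) ^ k)"
      using Suc assms(2) by (intro mult_left_mono) auto
    finally show ?case by (simp add: mult_ac)
  qed simp
  then show ?thesis using assms(1)[OF \<open>k \<le> n\<close>] by linarith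
qed

text \<open>By the discrete Gronwall inequality; the scheme is thus a Lipschitz function of the noise in the supremum norm.\<close>

lemma euler_path_stable:
  assumes lip: "\<And>j u v. j < n \<Longrightarrow> \<bar>\<beta> j u - \<beta> j v\<bar> \<le> \<kappa> * \<bar>u - v\<bar>" and "0 \<le> \<kappa>"
    and B: "\<And>k. k \<le> n \<Longrightarrow> \<bar>B k - B' k\<bar> \<le> e" and "k \<le> n"
  shows "\<bar>euler_path \<beta> z B k - euler_path \<beta> z B' k\<bar> \<le> e * (1 + \<kappa>) ^ k"
proof (rule discrete_gronwall[where n = n and d = "\<lambda>k. \<bar>euler_path \<beta> z B k - euler_path \<beta> z B' k\<bar>"])
  fix k assume k: "k \<le> n"
  let ?X = "euler_path \<beta> z B" and ?Y = "euler_path \<beta> z B'"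
  have "?X k - ?Y k = (\<Sum>j<k. \<beta> j (?X j) - \<beta> j (?Y j)) + (B k - B' k)"
    by (simp add: euler_path_eq_sum[of _ _ _ k] sum_subtractf)
  then have "\<bar>?X k - ?Y k\<bar> \<le> (\<Sum>j<k. \<bar>\<beta> j (?X j) - \<beta> j (?Y j)\<bar>) + \<bar>B k - B' k\<bar>"
    using sum_abs[of "\<lambda>j. \<beta> j (?X j) - \<beta> j (?Y j)" "{..<k}"] by linarith
  also have "\<dots> \<le> (\<Sum>j<k. \<kappa> * \<bar>?X j - ?Y j\<bar>) + e"
    using k by (intro add_mono sum_mono lip B) auto
  finally show "\<bar>?X k - ?Y k\<bar> \<le> e + \<kappa> * (\<Sum>j<k. \<bar>?X j - ?Y j\<bar>)"
    by (simp add: sum_distrib_left)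
qed (use assms in auto)

lemma euler_path_cong: "(\<And>j. j \<le> k \<Longrightarrow> B j = B' j) \<Longrightarrow> euler_path \<beta> z B k = euler_path \<beta> z B' k"
  by (induction k) auto

lemma Lipschitz_borel_measurable:
  fixes f :: "real \<Rightarrow> real"
  assumes "\<And>u v. \<bar>f u - f v\<bar> \<le> L * \<bar>u - v\<bar>"
  shows "f \<in> borel_measurable borel"
proof -
  have "L' -lipschitz_on UNIV f" if "L' = max L 0" for L'
  proof (rule lipschitz_onI)
    fix u v
    have "L * \<bar>u - v\<bar> \<le> L' * \<bar>u - v\<bar>" using that by (intro mult_right_mono) auto
    then show "dist (f u) (f v) \<le> L' * dist u v" using assms[of u v] by (simp add: dist_real_def)
  qed (use that in auto)
  then have "continuous_on UNIV f" using lipschitz_on_continuous_on by blast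
  then show ?thesis by (rule borel_measurable_continuous_onI)
qed

lemma euler_path_measurable:
  assumes "\<And>j. j < k \<Longrightarrow> \<beta> j \<in> borel_measurable borel"
    and "\<And>j. j \<le> k \<Longrightarrow> (\<lambda>\<omega>. B \<omega> j) \<in> borel_measurable M"
  shows "(\<lambda>\<omega>. euler_path \<beta> z (B \<omega>) k) \<in> borel_measurable M"
  using assms
proof (induction k)
  case 0
  then show ?case by simp
next
  case (Suc k)
  have [measurable]: "(\<lambda>\<omega>. euler_path \<beta> z (B \<omega>) k) \<in> borel_measurable M" "\<beta> k \<in> borel_measurable borel"
    "(\<lambda>\<omega>. B \<omega> k) \<in> borel_measurable M" "(\<lambda>\<omega>. B \<omega> (Suc k)) \<in> borel_measurable M"
    using Suc by auto
  show ?case by simp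
qed

text \<open>The increment over one step of \<open>\<integral>u\<close>, where \<open>u\<close> is the drift that must be added to the noise for the path
from \<open>y\<close> to stay at distance \<open>(y - x) * (1 - j / n)\<close> from the path started at \<open>x\<close>.\<close>

definition coupling_drift ::
  "(nat \<Rightarrow> real \<Rightarrow> real) \<Rightarrow> nat \<Rightarrow> real \<Rightarrow> real \<Rightarrow> (nat \<Rightarrow> real) \<Rightarrow> nat \<Rightarrow> real" where
  "coupling_drift \<beta> n x y B j =
     \<beta> j (euler_path \<beta> x B j) - \<beta> j (euler_path \<beta> x B j + (y - x) * (1 - real j / real n)) - (y - x) / real n"

lemma coupled_euler_path:
  assumes "0 < n"
  shows "euler_path \<beta> y (\<lambda>k. B k + (\<Sum>j<k. coupling_drift \<beta> n x y B j)) k =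
    euler_path \<beta> x B k + (y - x) * (1 - real k / real n)"
proof (induction k)
  case (Suc k)
  have shift: "(y - x) * (1 - real (Suc k) / real n) = (y - x) * (1 - real k / real n) - (y - x) / real n"
    using assms by (simp add: field_simps)
  have "euler_path \<beta> y (\<lambda>k. B k + (\<Sum>j<k. coupling_drift \<beta> n x y B j)) (Suc k) =
      euler_path \<beta> y (\<lambda>k. B k + (\<Sum>j<k. coupling_drift \<beta> n x y B j)) k +
      \<beta> k (euler_path \<beta> y (\<lambda>k. B k + (\<Sum>j<k. coupling_drift \<beta> n x y B j)) k) +
      (B (Suc k) - B k + coupling_drift \<beta> n x y B k)"
    by simp
  note step = this
  show ?case unfolding step Suc.IH using shift by (simp add: coupling_drift_def)
qed simp

lemma coupling_drift_bound:
  assumes lip: "\<And>u v. \<bar>\<beta> j u - \<beta> j v\<bar> \<le> \<kappa> * \<bar>u - v\<bar>" and "0 \<le> \<kappa>" "j < n"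
  shows "\<bar>coupling_drift \<beta> n x y B j\<bar> \<le> \<bar>y - x\<bar> * (\<kappa> + 1 / real n)"
proof -
  let ?g = "1 - real j / real n" and ?X = "euler_path \<beta> x B j"
  have g: "0 \<le> ?g" "?g \<le> 1" using assms by auto
  have "\<bar>\<beta> j ?X - \<beta> j (?X + (y - x) * ?g)\<bar> \<le> \<kappa> * \<bar>?X - (?X + (y - x) * ?g)\<bar>" by (rule lip)
  also have "\<bar>?X - (?X + (y - x) * ?g)\<bar> = \<bar>y - x\<bar> * ?g" using g by (simp add: abs_mult)
  also have "\<kappa> * (\<bar>y - x\<bar> * ?g) \<le> \<kappa> * (\<bar>y - x\<bar> * 1)" using g assms by (intro mult_left_mono) auto
  finally have "\<bar>coupling_drift \<beta> n x y B j\<bar> \<le> \<kappa> * \<bar>y - x\<bar> + \<bar>(y - x) / real n\<bar>"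
    unfolding coupling_drift_def by linarith
  then show ?thesis by (simp add: algebra_simps)
qed

text \<open>The truncation at \<open>\<nu> k\<close> expresses causality: the noise at the \<open>k\<close>-th time point uses only
increments before that time.\<close>

definition linear_noise :: "(nat \<Rightarrow> nat \<Rightarrow> real) \<Rightarrow> (nat \<Rightarrow> nat) \<Rightarrow> (nat \<Rightarrow> real) \<Rightarrow> nat \<Rightarrow> real" where
  "linear_noise a \<nu> w k = (\<Sum>l<\<nu> k. a k l * w l)"

lemma linear_noise_upd: "\<nu> k \<le> m \<Longrightarrow> linear_noise a \<nu> (w(m := v)) k = linear_noise a \<nu> w k"
  by (simp add: linear_noise_def)

lemma linear_noise_measurable:
  assumes "\<nu> k \<le> m"
  shows "(\<lambda>w. linear_noise a \<nu> w k) \<in> borel_measurable (PiM {..<m} (\<lambda>_. borel))"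
  unfolding linear_noise_def
  by (intro borel_measurable_sum borel_measurable_times borel_measurable_const measurable_component_singleton)
    (use assms in auto)

text \<open>Here \<open>u j\<close> stands for the drift rate on the \<open>j\<close>-th cell, of length \<open>\<Delta>\<close>, and \<open>q i j\<close> for the shift of the
\<open>i\<close>-th coordinate caused by a unit rate on that cell. The premise \<open>D\<close> bounds the energy of such a shift;
the premise \<open>e\<close> says that it moves the noise by almost the integral of \<open>u\<close>. A cell influences only later
coordinates (premise \<open>q\<close>), and its rate depends only on the noise up to its left end, so the shift is
predictable.\<close>

lemma euler_harnack:
  assumes n: "0 < n" and \<kappa>: "0 \<le> \<kappa>" and lip: "\<And>j u v. j < n \<Longrightarrow> \<bar>\<beta> j u - \<beta> j v\<bar> \<le> \<kappa> * \<bar>u - v\<bar>"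
    and \<nu>: "\<And>j k. j \<le> k \<Longrightarrow> k \<le> n \<Longrightarrow> \<nu> j \<le> \<nu> k" "\<And>k. k \<le> n \<Longrightarrow> \<nu> k \<le> N"
    and \<sigma>: "\<And>i. 0 < \<sigma> i"
    and q: "\<And>i j. j < n \<Longrightarrow> i < \<nu> j \<Longrightarrow> q i j = 0"
    and \<Delta>: "0 < \<Delta>" and c: "c = \<bar>y - x\<bar> * (\<kappa> + 1 / real n) / \<Delta>"
    and D: "\<And>u. (\<And>j. j < n \<Longrightarrow> \<bar>u j\<bar> \<le> c) \<Longrightarrow> (\<Sum>i<N. (\<Sum>j<n. u j * q i j)\<^sup>2 / (\<sigma> i)\<^sup>2) \<le> D"
    and e: "\<And>u k. (\<And>j. j < n \<Longrightarrow> \<bar>u j\<bar> \<le> c) \<Longrightarrow> k \<le> n \<Longrightarrow>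
        \<bar>(\<Sum>l<\<nu> k. a k l * (\<Sum>j<n. u j * q l j)) - (\<Sum>j<k. u j * \<Delta>)\<bar> \<le> e"
    and f: "\<And>u. 0 \<le> f u" "\<And>u. f u \<le> C" "\<And>u v. \<bar>f u - f v\<bar> \<le> L * \<bar>u - v\<bar>" "0 \<le> L" and p: "1 < p"
  shows "(\<integral>w. f (euler_path \<beta> y (linear_noise a \<nu> w) n) \<partial>gaussian_vector \<sigma> N) \<le>
    (\<integral>w. f (euler_path \<beta> x (linear_noise a \<nu> w) n) powr p \<partial>gaussian_vector \<sigma> N) powr (1 / p) *
      exp (D / (2 * (p - 1))) + L * (e * (1 + \<kappa>) ^ n)"
proof -
  let ?B = "linear_noise a \<nu>"
  define u where "u w j = coupling_drift \<beta> n x y (?B w) j / \<Delta>" for w j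
  \<comment> \<open>The omitted terms vanish; leaving them out makes the measurability of \<open>h i\<close> in the first \<open>i\<close> coordinates visible.\<close>
  define h where "h i w = (\<Sum>j | j < n \<and> \<nu> j \<le> i. u w j * q i j)" for i w
  have u_bound: "\<bar>u w j\<bar> \<le> c" if "j < n" for w j
  proof -
    have "\<bar>coupling_drift \<beta> n x y (?B w) j\<bar> \<le> \<bar>y - x\<bar> * (\<kappa> + 1 / real n)"
      by (rule coupling_drift_bound[OF _ \<kappa> that]) (rule lip[OF that])
    then show ?thesis using \<Delta> by (simp add: u_def c divide_right_mono)
  qed
  have h_eq: "h i w = (\<Sum>j<n. u w j * q i j)" for i w
    unfolding h_def using q by (intro sum.mono_neutral_left) (auto simp: not_le)
  have \<beta>: "\<beta> j \<in> borel_measurable borel" if "j < n" for j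
    using lip[OF that] by (rule Lipschitz_borel_measurable)
  have X_meas: "(\<lambda>w. euler_path \<beta> z (?B w) k) \<in> borel_measurable (PiM {..<m} (\<lambda>_. borel))"
    if "k \<le> n" "\<nu> k \<le> m" for z k m
    using that \<nu>(1) by (intro euler_path_measurable \<beta> linear_noise_measurable) (auto intro: order_trans)
  have u_meas: "(\<lambda>w. u w j) \<in> borel_measurable (PiM {..<m} (\<lambda>_. borel))" if "j < n" "\<nu> j \<le> m" for j m
  proof -
    have [measurable]: "(\<lambda>w. euler_path \<beta> x (?B w) j) \<in> borel_measurable (PiM {..<m} (\<lambda>_. borel))"
      "\<beta> j \<in> borel_measurable borel" using X_meas \<beta> that by auto
    show ?thesis unfolding u_def coupling_drift_def by measurable
  qed
  have u_upd: "u (w(m := v)) j = u w j" if "j < n" "\<nu> j \<le> m" for w m v j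
  proof -
    have "euler_path \<beta> x (?B (w(m := v))) j = euler_path \<beta> x (?B w) j"
      using that \<nu>(1)[of _ j] by (intro euler_path_cong linear_noise_upd) (auto intro: order_trans)
    then show ?thesis by (simp add: u_def coupling_drift_def)
  qed
  have pred: "predictable h"
    unfolding predictable_def h_def
    by (intro allI impI conjI borel_measurable_sum borel_measurable_times u_meas sum.cong refl arg_cong2[where f = times] u_upd)
      auto
  have f_meas: "f \<in> borel_measurable borel" by (rule Lipschitz_borel_measurable[OF f(3)])
  have e_nonneg: "0 \<le> e" using e[of "\<lambda>_. 0" 0] n \<Delta> c \<kappa> by auto
  show ?thesis
  proof (rule gaussian_harnack[OF pred \<sigma> _ p])
    show "(\<Sum>i<N. (h i w)\<^sup>2 / (\<sigma> i)\<^sup>2) \<le> D" for w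
      unfolding h_eq by (rule D[OF u_bound])
    show "(\<lambda>w. f (euler_path \<beta> z (?B w) n)) \<in> borel_measurable (PiM {..<N} (\<lambda>_. borel))" for z
      by (rule measurable_compose[OF X_meas f_meas]) (use \<nu> in auto)
    then show "(\<lambda>w. f (euler_path \<beta> y (?B w) n)) \<in> borel_measurable (PiM {..<N} (\<lambda>_. borel))" .
    show "0 \<le> L * (e * (1 + \<kappa>) ^ n)" using f(4) e_nonneg \<kappa> by simp
    fix w :: "nat \<Rightarrow> real" assume "w \<in> {..<N} \<rightarrow>\<^sub>E UNIV"
    let ?U = "\<lambda>k. ?B w k + (\<Sum>j<k. coupling_drift \<beta> n x y (?B w) j)"
    have "\<bar>?B (shift_vector h N w) k - ?U k\<bar> \<le> e" if "k \<le> n" for k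
    proof -
      have "?B (shift_vector h N w) k = (\<Sum>l<\<nu> k. a k l * (w l + h l w))"
        unfolding linear_noise_def using \<nu>(2)[OF that] by (intro sum.cong) (auto simp: shift_vector_def)
      also have "\<dots> = ?B w k + (\<Sum>l<\<nu> k. a k l * (\<Sum>j<n. u w j * q l j))"
        by (simp add: linear_noise_def h_eq distrib_left sum.distrib)
      finally have "?B (shift_vector h N w) k - ?U k =
          (\<Sum>l<\<nu> k. a k l * (\<Sum>j<n. u w j * q l j)) - (\<Sum>j<k. u w j * \<Delta>)"
        using \<Delta> by (simp add: u_def)
      then show ?thesis using e[OF u_bound that] by simp
    qed
    then have "\<bar>euler_path \<beta> y (?B (shift_vector h N w)) n - euler_path \<beta> y ?U n\<bar> \<le> e * (1 + \<kappa>) ^ n"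
      by (intro euler_path_stable[OF lip \<kappa>]) auto
    moreover have "euler_path \<beta> y ?U n = euler_path \<beta> x (?B w) n"
      using coupled_euler_path[OF n, of \<beta> y "?B w" x n] n by simp
    ultimately have "L * \<bar>euler_path \<beta> y (?B (shift_vector h N w)) n - euler_path \<beta> x (?B w) n\<bar> \<le> L * (e * (1 + \<kappa>) ^ n)"
      using f(4) by (intro mult_left_mono) auto
    then show "f (euler_path \<beta> y (?B (shift_vector h N w)) n) \<le> f (euler_path \<beta> x (?B w) n) + L * (e * (1 + \<kappa>) ^ n)"
      using f(3)[of "euler_path \<beta> y (?B (shift_vector h N w)) n" "euler_path \<beta> x (?B w) n"] by linarith
  qed (use f in auto)
qed

section \<open>Increments of the Wiener process on a grid\<close>

lemma obtain_increasing_enumeration: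
  fixes E :: "real set"
  assumes "finite E" "E \<noteq> {}"
  obtains N :: nat and s where "strict_mono_on {..N} s" "s ` {..N} = E"
proof -
  let ?xs = "sorted_list_of_set E" and ?N = "card E - 1"
  have len: "length ?xs = Suc ?N" using assms by (simp add: card_gt_0_iff)
  have "strict_mono_on {..?N} (\<lambda>i. ?xs ! i)"
    using len by (intro strict_mono_onI sorted_wrt_nth_less[OF strict_sorted_list_of_set]) auto
  moreover have "(\<lambda>i. ?xs ! i) ` {..<length ?xs} = set ?xs" by (auto simp: set_conv_nth)
  then have "(\<lambda>i. ?xs ! i) ` {..?N} = E" using assms len by (metis lessThan_Suc_atMost set_sorted_list_of_set)
  ultimately show thesis by (rule that)
qed

lemma grid_increment:
  fixes s \<Phi> :: "_ \<Rightarrow> real"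
  assumes s: "strict_mono_on {..N} s" and ab: "a \<le> b" "b \<le> N"
  shows "\<Phi> (s b) - \<Phi> (s a) = (\<Sum>i<N. indicator {s a<..s b} (s (Suc i)) * (\<Phi> (s (Suc i)) - \<Phi> (s i)))"
proof -
  have less: "s i < s j \<longleftrightarrow> i < j" "s i \<le> s j \<longleftrightarrow> i \<le> j" if "i \<le> N" "j \<le> N" for i j
    using strict_mono_on_less[OF s, of i j] strict_mono_on_less_eq[OF s, of i j] that by auto
  have "(\<Sum>i<N. indicator {s a<..s b} (s (Suc i)) * (\<Phi> (s (Suc i)) - \<Phi> (s i))) =
      (\<Sum>i<N. if i \<in> {a..<b} then \<Phi> (s (Suc i)) - \<Phi> (s i) else 0)"
    using ab by (intro sum.cong refl) (auto simp: indicator_def less)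
  also have "\<dots> = (\<Sum>i\<in>{a..<b}. \<Phi> (s (Suc i)) - \<Phi> (s i))"
    using ab by (subst sum.inter_restrict[symmetric]) (auto intro!: sum.cong)
  also have "\<dots> = \<Phi> (s b) - \<Phi> (s a)" using ab by (intro sum_Suc_diff') 
  finally show ?thesis by simp
qed

text \<open>On a grid containing all break points, the step function is constant on every cell \<open>(s i, s (i + 1)]\<close> and its
value there can be read off at the right end. The lemma serves both for the Wiener process and for the
deterministic integrators \<open>fractional_cumulative\<close>.\<close>

lemma step_integral_grid:
  fixes s :: "nat \<Rightarrow> real"
  assumes s: "strict_mono_on {..N} s"
    and es: "\<And>c u v. (c, u, v) \<in> set es \<Longrightarrow> u \<in> s ` {..N} \<and> v \<in> s ` {..N} \<and> u \<le> v"
  shows "step_integral W es \<omega> = (\<Sum>i<N. step_fun es (s (Suc i)) * (W (s (Suc i)) \<omega> - W (s i) \<omega>))"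
  using es
proof (induction es)
  case Nil
  then show ?case by (simp add: step_integral_def step_fun_def)
next
  case (Cons x es)
  obtain c u v where x: "x = (c, u, v)" by (cases x)
  from Cons.prems[of c u v] x obtain a b where ab: "a \<le> N" "b \<le> N" "u = s a" "v = s b" "u \<le> v" by auto
  then have "a \<le> b" using strict_mono_on_less_eq[OF s, of a b] by auto
  have "W v \<omega> - W u \<omega> = (\<Sum>i<N. indicator {u<..v} (s (Suc i)) * (W (s (Suc i)) \<omega> - W (s i) \<omega>))"
    unfolding ab(3,4) by (rule grid_increment[OF s \<open>a \<le> b\<close> ab(2)])
  moreover have "step_integral W es \<omega> = (\<Sum>i<N. step_fun es (s (Suc i)) * (W (s (Suc i)) \<omega> - W (s i) \<omega>))"
    using Cons by auto
  moreover have "step_integral W (x # es) \<omega> = c * (W v \<omega> - W u \<omega>) + step_integral W es \<omega>"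
    and "step_fun (x # es) r = c * indicator {u<..v} r + step_fun es r" for r
    by (simp_all add: x step_integral_def step_fun_def)
  ultimately show ?case
    by (simp only: distrib_right sum.distrib sum_distrib_left mult.assoc)
qed

lemma step_fun_eq_0: "(\<And>c u v. (c, u, v) \<in> set es \<Longrightarrow> v < r) \<Longrightarrow> step_fun es r = 0"
  by (induction es) (fastforce simp: step_fun_def)+

lemma (in prob_space) distr_pair_indep:
  assumes [measurable]: "X \<in> measurable M S" "Y \<in> measurable M R"
    and indep: "\<And>A B. A \<in> sets S \<Longrightarrow> B \<in> sets R \<Longrightarrow>
      prob ((X -` A \<inter> space M) \<inter> (Y -` B \<inter> space M)) = prob (X -` A \<inter> space M) * prob (Y -` B \<inter> space M)"
  shows "distr M (S \<Otimes>\<^sub>M R) (\<lambda>\<omega>. (X \<omega>, Y \<omega>)) = distr M S X \<Otimes>\<^sub>M distr M R Y"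
proof (rule pair_measure_eqI[symmetric])
  show "sigma_finite_measure (distr M S X)" "sigma_finite_measure (distr M R Y)"
    by (intro prob_space_imp_sigma_finite prob_space_distr assms)+
  fix A B assume AB: "A \<in> sets (distr M S X)" "B \<in> sets (distr M R Y)"
  have "(\<lambda>\<omega>. (X \<omega>, Y \<omega>)) -` (A \<times> B) \<inter> space M = (X -` A \<inter> space M) \<inter> (Y -` B \<inter> space M)" by auto
  then show "emeasure (distr M S X) A * emeasure (distr M R Y) B = emeasure (distr M (S \<Otimes>\<^sub>M R) (\<lambda>\<omega>. (X \<omega>, Y \<omega>))) (A \<times> B)"
    using AB indep[of A B] by (simp add: emeasure_distr emeasure_eq_measure ennreal_mult')
qed simp

context wiener_process
begin

lemma W_measurable: "t \<in> {0..T} \<Longrightarrow> W t \<in> borel_measurable M"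
  using W_adapted subalgebra_F measurable_from_subalg by blast

text \<open>Induction on the number of increments: the last one is independent of the \<open>\<sigma>\<close>-algebra at its left end, with
respect to which all previous increments are measurable.\<close>

lemma nn_integral_increments:
  assumes s: "strict_mono_on {..N} s" "0 \<le> s 0" "s N \<le> T"
    and \<sigma>: "\<And>i. 0 < \<sigma> i" "\<And>i. i < N \<Longrightarrow> \<sigma> i = sqrt (s (Suc i) - s i)"
    and G: "G \<in> borel_measurable (PiM {..<N} (\<lambda>_. borel))"
  shows "(\<integral>\<^sup>+\<omega>. G (\<lambda>i\<in>{..<N}. W (s (Suc i)) \<omega> - W (s i) \<omega>) \<partial>M) = (\<integral>\<^sup>+w. G w \<partial>gaussian_vector \<sigma> N)"
  using s(1,3) \<sigma>(2) G
proof (induction N arbitrary: G)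
  case 0
  interpret P: prob_space "gaussian_vector \<sigma> 0" by (rule prob_space_gaussian_vector[OF \<sigma>(1)])
  have "(\<integral>\<^sup>+w. G w \<partial>gaussian_vector \<sigma> 0) = (\<integral>\<^sup>+w. G (\<lambda>i. undefined) \<partial>gaussian_vector \<sigma> 0)"
    by (intro nn_integral_cong) auto
  then show ?case by (simp add: emeasure_space_1 P.emeasure_space_1[simplified] restrict_def)
next
  case (Suc N)
  let ?Z = "\<lambda>\<omega>. \<lambda>i\<in>{..<N}. W (s (Suc i)) \<omega> - W (s i) \<omega>"
  let ?\<xi> = "\<lambda>\<omega>. W (s (Suc N)) \<omega> - W (s N) \<omega>"
  let ?P = "PiM {..<N} (\<lambda>_. borel) :: (nat \<Rightarrow> real) measure"
  have mono: "s i \<le> s j" if "i \<le> j" "j \<le> Suc N" for i j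
    using strict_mono_on_less_eq[OF Suc.prems(1), of i j] that by auto
  have s0: "0 \<le> s i" if "i \<le> Suc N" for i using mono[of 0 i] that s(2) by simp
  have sT: "s i \<le> T" if "i \<le> Suc N" for i using mono[of i "Suc N"] that Suc.prems(2) by simp
  have lt: "s N < s (Suc N)" using Suc.prems(1) by (auto simp: strict_mono_on_def)
  have W_meas: "W (s i) \<in> borel_measurable (F (s N))" if "i \<le> N" for i
  proof -
    have "subalgebra (F (s N)) (F (s i))" using sets_F_mono[OF mono[of i N]] that space_F by (simp add: subalgebra_def)
    moreover have "W (s i) \<in> borel_measurable (F (s i))" using that s0 sT by (intro W_adapted) auto
    ultimately show ?thesis by (rule measurable_from_subalg)
  qed
  have Z: "?Z \<in> measurable (F (s N)) ?P"
    by (rule measurable_restrict) (use W_meas in \<open>auto intro!: borel_measurable_diff\<close>)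
  have ZM: "?Z \<in> measurable M ?P" using Z subalgebra_F measurable_from_subalg by blast
  have \<xi>: "?\<xi> \<in> borel_measurable M"
    using W_measurable s0 sT by (intro borel_measurable_diff) auto
  have ind: "distr M (?P \<Otimes>\<^sub>M borel) (\<lambda>\<omega>. (?Z \<omega>, ?\<xi> \<omega>)) = distr M ?P ?Z \<Otimes>\<^sub>M distr M borel ?\<xi>"
  proof (rule distr_pair_indep[OF ZM \<xi>])
    fix A B assume A: "A \<in> sets ?P" and B: "B \<in> sets (borel :: real measure)"
    have indep: "indep_set (sets (vimage_algebra (space M) ?\<xi> borel)) (sets (F (s N)))"
      using W_indep[OF s0 lt] sT by simp
    have "?Z -` A \<inter> space M \<in> sets (F (s N))" using measurable_sets[OF Z A] space_F by simp
    moreover have "?\<xi> -` B \<inter> space M \<in> sets (vimage_algebra (space M) ?\<xi> borel)"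
      by (rule in_vimage_algebra[OF B])
    ultimately show "prob ((?Z -` A \<inter> space M) \<inter> (?\<xi> -` B \<inter> space M)) = prob (?Z -` A \<inter> space M) * prob (?\<xi> -` B \<inter> space M)"
      using indep_setD[OF indep] by (simp only: Int_commute mult.commute)
  qed
  have distr_\<xi>: "distr M borel ?\<xi> = centered_normal (\<sigma> N)"
  proof -
    have "distr M lborel ?\<xi> = centered_normal (sqrt (s (Suc N) - s N))"
      using W_increments[OF s0 lt] sT by (simp add: distributed_distr_eq_density)
    moreover have "distr M borel ?\<xi> = distr M lborel ?\<xi>" by (rule distr_cong) auto
    ultimately show ?thesis using Suc.prems(3)[of N] by simp
  qed
  have upd: "(\<lambda>(w, v). w(N := v)) \<in> measurable (?P \<Otimes>\<^sub>M borel) (PiM {..<Suc N} (\<lambda>_. borel))"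
    using measurable_add_dim[of N "{..<N}" "\<lambda>_. borel"] by (simp add: lessThan_Suc)
  have Gupd: "(\<lambda>p. G ((\<lambda>(w, v). w(N := v)) p)) \<in> borel_measurable (?P \<Otimes>\<^sub>M borel)"
    by (rule measurable_compose[OF upd Suc.prems(4)])
  interpret N: prob_space "centered_normal (\<sigma> N)" by (rule prob_space_normal_density[OF \<sigma>(1)])
  let ?G = "\<lambda>x. \<integral>\<^sup>+v. G (x(N := v)) \<partial>centered_normal (\<sigma> N)"
  have G_meas: "?G \<in> borel_measurable ?P"
    by (rule N.borel_measurable_nn_integral) (use Gupd in \<open>simp add: case_prod_beta' cong: measurable_cong_sets\<close>)
  have sm: "strict_mono_on {..N} s" using Suc.prems(1) by (auto simp: strict_mono_on_def)
  have "(\<integral>\<^sup>+\<omega>. G (\<lambda>i\<in>{..<Suc N}. W (s (Suc i)) \<omega> - W (s i) \<omega>) \<partial>M) = (\<integral>\<^sup>+\<omega>. G ((\<lambda>(w, v). w(N := v)) (?Z \<omega>, ?\<xi> \<omega>)) \<partial>M)"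
    by (intro nn_integral_cong arg_cong[where f = G]) (auto simp: fun_eq_iff less_Suc_eq)
  also have "\<dots> = (\<integral>\<^sup>+p. G ((\<lambda>(w, v). w(N := v)) p) \<partial>distr M (?P \<Otimes>\<^sub>M borel) (\<lambda>\<omega>. (?Z \<omega>, ?\<xi> \<omega>)))"
    by (rule nn_integral_distr[symmetric]) (use ZM \<xi> Gupd in auto)
  also have "distr M (?P \<Otimes>\<^sub>M borel) (\<lambda>\<omega>. (?Z \<omega>, ?\<xi> \<omega>)) = distr M ?P ?Z \<Otimes>\<^sub>M centered_normal (\<sigma> N)"
    unfolding ind distr_\<xi> ..
  also have "(\<integral>\<^sup>+p. G ((\<lambda>(w, v). w(N := v)) p) \<partial>(distr M ?P ?Z \<Otimes>\<^sub>M centered_normal (\<sigma> N))) = (\<integral>\<^sup>+w. ?G w \<partial>distr M ?P ?Z)"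
    by (subst N.nn_integral_fst[symmetric]) (use Gupd in \<open>auto simp: case_prod_beta' cong: measurable_cong_sets\<close>)
  also have "\<dots> = (\<integral>\<^sup>+\<omega>. ?G (?Z \<omega>) \<partial>M)"
    by (rule nn_integral_distr[OF ZM]) (use G_meas in simp)
  also have "\<dots> = (\<integral>\<^sup>+w. ?G w \<partial>gaussian_vector \<sigma> N)"
    using Suc.prems(3) sT by (intro Suc.IH sm G_meas) auto
  also have "\<dots> = (\<integral>\<^sup>+w. G w \<partial>gaussian_vector \<sigma> (Suc N))"
    by (rule nn_integral_gaussian_vector_Suc[OF \<sigma>(1) Suc.prems(4), symmetric])
  finally show ?case .
qed

lemma distr_increments:
  assumes s: "strict_mono_on {..N} s" "0 \<le> s 0" "s N \<le> T"
    and \<sigma>: "\<And>i. 0 < \<sigma> i" "\<And>i. i < N \<Longrightarrow> \<sigma> i = sqrt (s (Suc i) - s i)"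
  shows "(\<lambda>\<omega>. \<lambda>i\<in>{..<N}. W (s (Suc i)) \<omega> - W (s i) \<omega>) \<in> measurable M (gaussian_vector \<sigma> N)"
    and "distr M (gaussian_vector \<sigma> N) (\<lambda>\<omega>. \<lambda>i\<in>{..<N}. W (s (Suc i)) \<omega> - W (s i) \<omega>) = gaussian_vector \<sigma> N"
proof -
  let ?Z = "\<lambda>\<omega>. \<lambda>i\<in>{..<N}. W (s (Suc i)) \<omega> - W (s i) \<omega>"
  have mono: "s i \<le> s j" if "i \<le> j" "j \<le> N" for i j
    using strict_mono_on_less_eq[OF s(1), of i j] that by auto
  have "s i \<in> {0..T}" if "i \<le> N" for i using mono[of 0 i] mono[of i N] that s by auto
  then have "?Z \<in> measurable M (PiM {..<N} (\<lambda>_. borel))"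
    by (intro measurable_restrict borel_measurable_diff W_measurable) auto
  then show Z: "?Z \<in> measurable M (gaussian_vector \<sigma> N)"
    by (simp add: measurable_cong_sets[OF refl sets_gaussian_vector])
  show "distr M (gaussian_vector \<sigma> N) ?Z = gaussian_vector \<sigma> N"
  proof (rule measure_eqI)
    fix A assume "A \<in> sets (distr M (gaussian_vector \<sigma> N) ?Z)"
    then have A: "A \<in> sets (gaussian_vector \<sigma> N)" by simp
    then have ind: "indicator A \<in> borel_measurable (PiM {..<N} (\<lambda>_. borel) :: (nat \<Rightarrow> real) measure)" by simp
    have "emeasure (distr M (gaussian_vector \<sigma> N) ?Z) A = (\<integral>\<^sup>+w. indicator A w \<partial>distr M (gaussian_vector \<sigma> N) ?Z)"
      using A by simp
    also have "\<dots> = (\<integral>\<^sup>+\<omega>. indicator A (?Z \<omega>) \<partial>M)" using A by (intro nn_integral_distr Z) auto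
    also have "\<dots> = (\<integral>\<^sup>+w. indicator A w \<partial>gaussian_vector \<sigma> N)"
      by (rule nn_integral_increments[OF s \<sigma> ind])
    finally show "emeasure (distr M (gaussian_vector \<sigma> N) ?Z) A = emeasure (gaussian_vector \<sigma> N) A"
      using A by simp
  qed simp
qed

end

section \<open>Noise built from finitely many increments\<close>

lemma has_bochner_integral_powr:
  fixes a b :: real
  assumes "-1 < a" "0 \<le> b"
  shows "has_bochner_integral lborel (\<lambda>x. indicator {0<..b} x * x powr a) (b powr (a + 1) / (a + 1))"
proof (rule has_bochner_integral_nn_integral)
  have "((\<lambda>x. x powr a) has_integral (b powr (a + 1) / (a + 1))) {0<..b}"
    using has_integral_powr_from_0[OF assms]
    by (rule has_integral_spike_set_eq[THEN iffD1, rotated -1])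
      (auto intro: negligible_subset[of "{0}"])
  from nn_integral_has_integral_lebesgue[OF _ this]
  show "(\<integral>\<^sup>+x. ennreal (indicator {0<..b} x * x powr a) \<partial>lborel) = ennreal (b powr (a + 1) / (a + 1))" by simp
qed (use assms in auto)

lemma sum_indicator_grid:
  fixes s :: "nat \<Rightarrow> real"
  assumes "strict_mono_on {..N} s"
  shows "(\<Sum>i<N. indicator {s i<..s (Suc i)} x) = (indicator {s 0<..s N} x :: real)"
  using assms
proof (induction N)
  case (Suc N)
  have "strict_mono_on {..N} s" using Suc.prems by (auto simp: strict_mono_on_def)
  note IH = Suc.IH[OF this]
  have "s 0 \<le> s N" "s N < s (Suc N)"
    using strict_mono_on_less_eq[OF Suc.prems, of 0 N] strict_mono_on_less[OF Suc.prems, of N "Suc N"] by auto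
  then show ?case using IH by (auto simp: indicator_def)
qed simp

text \<open>The Cauchy-Schwarz inequality on each cell, summed over the cells.\<close>

lemma grid_energy:
  fixes s :: "nat \<Rightarrow> real"
  assumes s: "strict_mono_on {..N} s" "0 \<le> s 0" "s N \<le> T" and \<alpha>: "0 < \<alpha>"
  shows "(\<Sum>i<N. (\<integral>x. indicator {s i<..s (Suc i)} x * x powr \<alpha> \<partial>lborel)\<^sup>2 / (s (Suc i) - s i)) \<le>
    T powr (2 * \<alpha> + 1) / (2 * \<alpha> + 1)"
proof -
  let ?I = "\<lambda>i x. indicator {s i<..s (Suc i)} x :: real"
  have less: "s i < s (Suc i)" "s (Suc i) \<le> T" "0 \<le> s i" if "i < N" for i
    using strict_mono_on_less[OF s(1), of i "Suc i"] strict_mono_on_less_eq[OF s(1), of "Suc i" N]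
      strict_mono_on_less_eq[OF s(1), of 0 i] that s(2,3) by auto
  have "0 \<le> T" using strict_mono_on_less_eq[OF s(1), of 0 N] s by auto
  have int: "integrable lborel (\<lambda>x. ?I i x * x powr a)" if "i < N" "0 < a" for i a
  proof (rule Bochner_Integration.integrable_bound)
    show "integrable lborel (\<lambda>x. indicator {0<..T} x * x powr a)"
      using has_bochner_integral_powr[of a T] that \<open>0 \<le> T\<close> by (simp add: has_bochner_integral_iff)
    show "AE x in lborel. norm (?I i x * x powr a) \<le> norm (indicator {0<..T} x * x powr a)"
      using less[OF that(1)] by (intro AE_I2) (auto simp: indicator_def)
  qed measurable
  have CS: "(\<integral>x. ?I i x * x powr \<alpha> \<partial>lborel)\<^sup>2 / (s (Suc i) - s i) \<le> (\<integral>x. ?I i x * x powr (2 * \<alpha>) \<partial>lborel)"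
    if i: "i < N" for i
  proof -
    let ?A = "\<integral>x. ?I i x * x powr \<alpha> \<partial>lborel" and ?V = "\<integral>x. ?I i x * x powr (2 * \<alpha>) \<partial>lborel"
    let ?d = "s (Suc i) - s i"
    \<comment> \<open>Integrating the square of the deviation from the mean \<open>m\<close> over the cell gives the Cauchy-Schwarz inequality.\<close>
    define m where "m = ?A / ?d"
    have d: "0 < ?d" using less[OF i] by simp
    have "0 \<le> (\<integral>x. ?I i x * (x powr \<alpha> - m)\<^sup>2 \<partial>lborel)" by (intro integral_nonneg_AE AE_I2) auto
    also have "\<dots> = (\<integral>x. ?I i x * x powr (2 * \<alpha>) - 2 * m * (?I i x * x powr \<alpha>) + m\<^sup>2 * ?I i x \<partial>lborel)"
    proof (intro Bochner_Integration.integral_cong refl)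
      fix x :: real
      show "?I i x * (x powr \<alpha> - m)\<^sup>2 = ?I i x * x powr (2 * \<alpha>) - 2 * m * (?I i x * x powr \<alpha>) + m\<^sup>2 * ?I i x"
      proof -
        have "x powr (2 * \<alpha>) = x powr \<alpha> * x powr \<alpha>" by (simp flip: powr_add)
        then show ?thesis by (simp add: power2_eq_square algebra_simps)
      qed
    qed
    also have "\<dots> = ?V - 2 * m * ?A + m\<^sup>2 * ?d"
      using int[OF i, of "2 * \<alpha>"] int[OF i \<alpha>] \<alpha> less[OF i] by (simp add: less_imp_le)
    also have "\<dots> = ?V - ?A\<^sup>2 / ?d"
    proof -
      have "V - 2 * (A / r) * A + (A / r)\<^sup>2 * r = V - A\<^sup>2 / r" if "0 < r" for V A r :: real
        using that by (simp add: power2_eq_square field_simps)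
      from this[OF d] show ?thesis by (simp only: m_def)
    qed
    finally show ?thesis by simp
  qed
  have "(\<Sum>i<N. (\<integral>x. ?I i x * x powr \<alpha> \<partial>lborel)\<^sup>2 / (s (Suc i) - s i)) \<le> (\<Sum>i<N. \<integral>x. ?I i x * x powr (2 * \<alpha>) \<partial>lborel)"
    by (intro sum_mono CS) auto
  also have "\<dots> = (\<integral>x. (\<Sum>i<N. ?I i x * x powr (2 * \<alpha>)) \<partial>lborel)"
    using int \<alpha> by (intro Bochner_Integration.integral_sum[symmetric]) auto
  also have "\<dots> \<le> (\<integral>x. indicator {0<..T} x * x powr (2 * \<alpha>) \<partial>lborel)"
  proof (rule integral_mono)
    show "integrable lborel (\<lambda>x. \<Sum>i<N. ?I i x * x powr (2 * \<alpha>))"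
      using int \<alpha> by (intro Bochner_Integration.integrable_sum) auto
    show "integrable lborel (\<lambda>x. indicator {0<..T} x * x powr (2 * \<alpha>))"
      using has_bochner_integral_powr[of "2 * \<alpha>" T] \<alpha> \<open>0 \<le> T\<close> by (simp add: has_bochner_integral_iff)
    fix x :: real
    have "(indicator {s 0<..s N} x :: real) \<le> indicator {0<..T} x" using s by (auto simp: indicator_def)
    then show "(\<Sum>i<N. ?I i x * x powr (2 * \<alpha>)) \<le> indicator {0<..T} x * x powr (2 * \<alpha>)"
      unfolding sum_distrib_right[symmetric] sum_indicator_grid[OF s(1)] by (intro mult_right_mono) auto
  qed
  also have "\<dots> = T powr (2 * \<alpha> + 1) / (2 * \<alpha> + 1)"
    using has_bochner_integral_powr[of "2 * \<alpha>" T] \<alpha> \<open>0 \<le> T\<close> by (simp add: has_bochner_integral_iff)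
  finally show ?thesis .
qed

lemma fractional_density_integrable:
  assumes \<alpha>: "0 < \<alpha>" "\<alpha> < 1/2" and J[measurable]: "J \<in> sets borel" and A[measurable]: "A \<in> sets borel" "A \<subseteq> {0<..b}"
  shows "integrable lborel (\<lambda>x. indicator A x * fractional_density \<alpha> J x)"
proof (rule Bochner_Integration.integrable_bound)
  let ?\<beta> = "Beta (1 + \<alpha>) \<alpha> / Gamma \<alpha>"
  have \<beta>: "0 \<le> ?\<beta>" using \<alpha> by (auto intro!: divide_nonneg_pos Gamma_real_pos less_imp_le[OF Beta_pos])
  show "integrable lborel (\<lambda>x. ?\<beta> * b powr \<alpha> * indicator {0<..b} x)"
    by (cases "0 \<le> b") auto
  show "(\<lambda>x. indicator A x * fractional_density \<alpha> J x) \<in> borel_measurable lborel"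
    using fractional_density_measurable[OF \<alpha> J] by measurable
  have "fractional_density \<alpha> J x \<le> ?\<beta> * b powr \<alpha>" if "0 < x" "x \<le> b" for x
  proof -
    have "fractional_density \<alpha> J x \<le> ?\<beta> * x powr \<alpha>" using \<alpha> J that by (intro fractional_density_le)
    also have "\<dots> \<le> ?\<beta> * b powr \<alpha>" using that \<alpha> \<beta> by (intro mult_left_mono powr_mono2) auto
    finally show ?thesis .
  qed
  note * = this
  have le: "indicator A x * fractional_density \<alpha> J x \<le> ?\<beta> * b powr \<alpha> * indicator {0<..b} x" for x
  proof -
    have "0 \<le> ?\<beta> * b powr \<alpha>" using \<beta> by (intro mult_nonneg_nonneg) auto
    moreover have "indicator A x * g \<le> d * indicator {0<..b} x"
      if "0 \<le> d" "x \<in> A \<Longrightarrow> 0 < x \<and> x \<le> b" "0 < x \<Longrightarrow> x \<le> b \<Longrightarrow> g \<le> d" for d g :: real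
      using that by (auto simp: indicator_def)
    ultimately show ?thesis using A(2) * by (simp only: subset_eq greaterThanAtMost_iff)
  qed
  have "0 \<le> indicator A x * fractional_density \<alpha> J x" for x
    using fractional_density_nonneg[OF \<alpha>] by simp
  then show "AE x in lborel. norm (indicator A x * fractional_density \<alpha> J x) \<le> norm (?\<beta> * b powr \<alpha> * indicator {0<..b} x)"
    using le by (intro AE_I2) (metis abs_of_nonneg order_trans real_norm_def)
qed

text \<open>The cumulative Wiener shift. Its increment over a grid cell is the shift of the corresponding Wiener
increment.\<close>

definition fractional_cumulative :: "real \<Rightarrow> real set \<Rightarrow> real \<Rightarrow> real" where
  "fractional_cumulative \<alpha> J r = (\<integral>x. indicator {0<..r} x * fractional_density \<alpha> J x \<partial>lborel)"

lemma fractional_cumulative_diff: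
  assumes \<alpha>: "0 < \<alpha>" "\<alpha> < 1/2" and J: "J \<in> sets borel" and ab: "0 \<le> a" "a \<le> b"
  shows "fractional_cumulative \<alpha> J b - fractional_cumulative \<alpha> J a =
    (\<integral>x. indicator {a<..b} x * fractional_density \<alpha> J x \<partial>lborel)"
proof -
  have "(\<integral>x. indicator {0<..b} x * fractional_density \<alpha> J x \<partial>lborel) - (\<integral>x. indicator {0<..a} x * fractional_density \<alpha> J x \<partial>lborel)
      = (\<integral>x. indicator {0<..b} x * fractional_density \<alpha> J x - indicator {0<..a} x * fractional_density \<alpha> J x \<partial>lborel)"
    using ab by (intro Bochner_Integration.integral_diff[symmetric] fractional_density_integrable[OF \<alpha> J, where b = b]) auto
  also have "\<dots> = (\<integral>x. indicator {a<..b} x * fractional_density \<alpha> J x \<partial>lborel)"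
    using ab by (intro Bochner_Integration.integral_cong) (auto simp: indicator_def)
  finally show ?thesis by (simp add: fractional_cumulative_def)
qed

text \<open>The values \<open>B (k * T / n)\<close> are replaced by integrals of the step functions \<open>es k\<close>. On a common refinement of all
break points and time points these integrals are linear in independent Gaussian increments, and
\<open>euler_harnack\<close> applies with the shifts \<open>q i j\<close> of the \<open>i\<close>-th increment given by \<open>fractional_cumulative\<close>. The
quantity \<open>e\<close> measures how far the step functions are from reproducing the integrated drift.\<close>

lemma (in wiener_process) step_harnack:
  fixes \<alpha> \<kappa> L C c p x y :: real and n :: nat and es :: "nat \<Rightarrow> (real \<times> real \<times> real) list"
  defines "t \<equiv> \<lambda>k. real k * T / real n"
  assumes \<alpha>: "0 < \<alpha>" "\<alpha> < 1/2" and T: "0 < T" and n: "0 < n"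
    and \<kappa>: "0 \<le> \<kappa>" and lip: "\<And>j u v. j < n \<Longrightarrow> \<bar>\<beta> j u - \<beta> j v\<bar> \<le> \<kappa> * \<bar>u - v\<bar>"
    and es: "\<And>k c u v. k \<le> n \<Longrightarrow> (c, u, v) \<in> set (es k) \<Longrightarrow> 0 \<le> u \<and> u \<le> v \<and> v \<le> t k"
    and c: "c = \<bar>y - x\<bar> * (\<kappa> + 1 / real n) / (T / real n)"
    and e: "e = (\<Sum>k\<le>n. \<Sum>j<n. \<bar>step_integral (\<lambda>r _. fractional_cumulative \<alpha> {t j<..t (Suc j)} r) (es k) () -
        (if j < k then T / real n else 0)\<bar>)"
    and f: "\<And>u. 0 \<le> f u" "\<And>u. f u \<le> C" "\<And>u v. \<bar>f u - f v\<bar> \<le> L * \<bar>u - v\<bar>" "0 \<le> L" and p: "1 < p"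
  shows "(\<integral>\<omega>. f (euler_path \<beta> y (\<lambda>k. step_integral W (es k) \<omega>) n) \<partial>M) \<le>
    (\<integral>\<omega>. f (euler_path \<beta> x (\<lambda>k. step_integral W (es k) \<omega>) n) powr p \<partial>M) powr (1 / p) *
      exp ((c * (Beta (1 + \<alpha>) \<alpha> / Gamma \<alpha>))\<^sup>2 * (T powr (2 * \<alpha> + 1) / (2 * \<alpha> + 1)) / (2 * (p - 1))) +
    L * (c * e * (1 + \<kappa>) ^ n)"
proof -
  let ?\<beta> = "Beta (1 + \<alpha>) \<alpha> / Gamma \<alpha>"
  let ?J = "\<lambda>j. {t j<..t (Suc j)}"
  let ?k = "\<lambda>j. fractional_density \<alpha> (?J j)" and ?\<Phi> = "\<lambda>j. fractional_cumulative \<alpha> (?J j)"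
  have \<beta>: "0 \<le> ?\<beta>" using \<alpha> by (auto intro!: divide_nonneg_pos Gamma_real_pos less_imp_le[OF Beta_pos])
  have c_nonneg: "0 \<le> c" using c \<kappa> T n by simp
  have t_mono: "t j \<le> t k" if "j \<le> k" for j k
    unfolding t_def using that T n by (intro divide_right_mono mult_right_mono) auto
  have t0: "t 0 = 0" and tn: "t n = T" using n by (auto simp: t_def)
  \<comment> \<open>The time points are included so that each \<open>t k\<close> is a grid point \<open>s (\<nu> k)\<close>.\<close>
  define E where "E = t ` {..n} \<union> (\<Union>k\<in>{..n}. \<Union>(c, u, v)\<in>set (es k). {u, v})"
  have E: "finite E" "E \<noteq> {}" by (auto simp: E_def)
  have E_sub: "E \<subseteq> {0..T}"
  proof -
    have "t k \<in> {0..T}" if "k \<le> n" for k using t_mono[of 0 k] t_mono[OF that] t0 tn by auto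
    moreover have "u \<in> {0..T} \<and> v \<in> {0..T}" if "k \<le> n" "(c, u, v) \<in> set (es k)" for k c u v
      using es[OF that] t_mono[OF that(1)] tn by auto
    ultimately show ?thesis unfolding E_def by blast
  qed
  have E_t: "t k \<in> E" if "k \<le> n" for k using that by (auto simp: E_def)
  have E_es: "u \<in> E \<and> v \<in> E" if "k \<le> n" "(c, u, v) \<in> set (es k)" for k c u v
    using that unfolding E_def by blast
  obtain N :: nat and s where s: "strict_mono_on {..N} s" and sE: "s ` {..N} = E"
    using obtain_increasing_enumeration[OF E] by blast
  have s_less: "s i < s j \<longleftrightarrow> i < j" "s i \<le> s j \<longleftrightarrow> i \<le> j" if "i \<le> N" "j \<le> N" for i j
    using strict_mono_on_less[OF s, of i j] strict_mono_on_less_eq[OF s, of i j] that by auto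
  have s_bnd: "0 \<le> s i" "s i \<le> T" if "i \<le> N" for i using sE E_sub that by auto
  have "\<forall>k\<in>{..n}. \<exists>i\<le>N. s i = t k" using E_t sE by (metis atMost_iff imageE)
  then obtain \<nu> where \<nu>: "\<And>k. k \<le> n \<Longrightarrow> \<nu> k \<le> N" "\<And>k. k \<le> n \<Longrightarrow> s (\<nu> k) = t k" by (metis atMost_iff)
  have \<nu>_mono: "\<nu> j \<le> \<nu> k" if "j \<le> k" "k \<le> n" for j k
    using s_less(2)[of "\<nu> j" "\<nu> k"] \<nu> t_mono[OF that(1)] that by auto
  \<comment> \<open>The value \<open>1\<close> beyond \<open>N\<close> only makes all variances positive.\<close>
  define \<sigma> where "\<sigma> i = (if i < N then sqrt (s (Suc i) - s i) else 1)" for i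
  have \<sigma>: "0 < \<sigma> i" "i < N \<Longrightarrow> \<sigma> i = sqrt (s (Suc i) - s i)" for i
    using s_less[of i "Suc i"] by (auto simp: \<sigma>_def)
  have \<sigma>2: "(\<sigma> i)\<^sup>2 = s (Suc i) - s i" if "i < N" for i
    using s_less[of i "Suc i"] that by (simp add: \<sigma>_def)
  define a where "a k l = step_fun (es k) (s (Suc l))" for k l
  define q where "q i j = ?\<Phi> j (s (Suc i)) - ?\<Phi> j (s i)" for i j
  have a_0: "a k l = 0" if "k \<le> n" "\<nu> k \<le> l" "l < N" for k l
    unfolding a_def
  proof (rule step_fun_eq_0)
    fix c u v assume "(c, u, v) \<in> set (es k)"
    then have "v \<le> s (\<nu> k)" using es[OF that(1)] \<nu>(2)[OF that(1)] by auto
    also have "s (\<nu> k) < s (Suc l)" using s_less(1)[of "\<nu> k" "Suc l"] \<nu>(1)[OF that(1)] that by auto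
    finally show "v < s (Suc l)" .
  qed
  have grid: "step_integral V (es k) \<omega> = (\<Sum>l<\<nu> k. a k l * (V (s (Suc l)) \<omega> - V (s l) \<omega>))"
    if k: "k \<le> n" for k \<omega> and V :: "real \<Rightarrow> 'c \<Rightarrow> real"
  proof -
    have "step_integral V (es k) \<omega> = (\<Sum>l<N. a k l * (V (s (Suc l)) \<omega> - V (s l) \<omega>))"
      unfolding a_def using es[OF k] E_es[OF k] sE by (intro step_integral_grid[OF s]) auto
    also have "\<dots> = (\<Sum>l<\<nu> k. a k l * (V (s (Suc l)) \<omega> - V (s l) \<omega>))"
      using a_0[OF k] \<nu>(1)[OF k] by (intro sum.mono_neutral_right) auto
    finally show ?thesis .
  qed
  have q_eq: "q i j = (\<integral>r. indicator {s i<..s (Suc i)} r * ?k j r \<partial>lborel)" if "i < N" for i j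
    unfolding q_def using that s_bnd s_less[of i "Suc i"] by (intro fractional_cumulative_diff \<alpha>) auto
  have q_0: "q i j = 0" if "j < n" "i < \<nu> j" for i j
  proof -
    have i: "i < N" using that \<nu>(1)[of j] by simp
    have "s (Suc i) \<le> t j" using s_less(2)[of "Suc i" "\<nu> j"] that i \<nu>[of j] by auto
    then have *: "indicator {s i<..s (Suc i)} r * ?k j r = 0" for r
      using fractional_density_eq_0[OF \<alpha>, of "?J j" r] by (auto simp: indicator_def)
    show ?thesis unfolding q_eq[OF i] * by simp
  qed
  have D: "(\<Sum>i<N. (\<Sum>j<n. u j * q i j)\<^sup>2 / (\<sigma> i)\<^sup>2) \<le> (c * ?\<beta>)\<^sup>2 * (T powr (2 * \<alpha> + 1) / (2 * \<alpha> + 1))"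
    if u: "\<And>j. j < n \<Longrightarrow> \<bar>u j\<bar> \<le> c" for u
  proof -
    let ?A = "\<lambda>i. \<integral>r. indicator {s i<..s (Suc i)} r * r powr \<alpha> \<partial>lborel"
    have int: "integrable lborel (\<lambda>r. indicator {s i<..s (Suc i)} r * ?k j r)" if "i < N" for i j
      using s_bnd[of i] that by (intro fractional_density_integrable[OF \<alpha>, where b = "s (Suc i)"]) auto
    have A_int: "integrable lborel (\<lambda>r. indicator {s i<..s (Suc i)} r * r powr \<alpha>)" if "i < N" for i
    proof (rule Bochner_Integration.integrable_bound)
      show "integrable lborel (\<lambda>x. indicator {0<..T} x * x powr \<alpha>)"
        using has_bochner_integral_powr[of \<alpha> T] \<alpha> T by (simp add: has_bochner_integral_iff)
      show "AE x in lborel. norm (indicator {s i<..s (Suc i)} x * x powr \<alpha>) \<le> norm (indicator {0<..T} x * x powr \<alpha>)"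
        using s_bnd[of i] s_bnd[of "Suc i"] that by (intro AE_I2) (auto simp: indicator_def)
    qed measurable
    \<comment> \<open>The densities are nonnegative, so the rates may be replaced by their bound before the densities are summed.\<close>
    have le: "\<bar>\<Sum>j<n. u j * q i j\<bar> \<le> c * ?\<beta> * ?A i" if i: "i < N" for i
    proof -
      have "\<bar>\<Sum>j<n. u j * q i j\<bar> \<le> (\<Sum>j<n. \<bar>u j * q i j\<bar>)" by (rule sum_abs)
      also have "\<dots> \<le> (\<Sum>j<n. c * q i j)"
      proof (rule sum_mono)
        fix j assume "j \<in> {..<n}"
        moreover have "0 \<le> q i j" unfolding q_eq[OF i]
          using fractional_density_nonneg[OF \<alpha>] by (intro integral_nonneg_AE AE_I2) auto
        ultimately show "\<bar>u j * q i j\<bar> \<le> c * q i j" using u[of j] by (simp add: abs_mult mult_right_mono)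
      qed
      also have "\<dots> = c * (\<Sum>j<n. q i j)" by (simp only: sum_distrib_left)
      also have "(\<Sum>j<n. q i j) = (\<integral>r. (\<Sum>j<n. indicator {s i<..s (Suc i)} r * ?k j r) \<partial>lborel)"
        unfolding q_eq[OF i] by (intro Bochner_Integration.integral_sum[symmetric] int[OF i])
      also have "c * \<dots> \<le> c * (\<integral>r. ?\<beta> * (indicator {s i<..s (Suc i)} r * r powr \<alpha>) \<partial>lborel)"
      proof (intro mult_left_mono integral_mono c_nonneg)
        show "integrable lborel (\<lambda>r. \<Sum>j<n. indicator {s i<..s (Suc i)} r * ?k j r)"
          using int[OF i] by (intro Bochner_Integration.integrable_sum)
        show "integrable lborel (\<lambda>r. ?\<beta> * (indicator {s i<..s (Suc i)} r * r powr \<alpha>))"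
          using A_int[OF i] by (intro integrable_mult_right)
        fix r :: real
        show "(\<Sum>j<n. indicator {s i<..s (Suc i)} r * ?k j r) \<le> ?\<beta> * (indicator {s i<..s (Suc i)} r * r powr \<alpha>)"
        proof (cases "r \<in> {s i<..s (Suc i)}")
          case True
          have "disjoint_family_on ?J {..<n}"
          proof (unfold disjoint_family_on_def, intro ballI impI)
            fix j k :: nat assume "j \<noteq> k"
            then have "Suc j \<le> k \<or> Suc k \<le> j" by linarith
            then show "?J j \<inter> ?J k = {}" using t_mono[of "Suc j" k] t_mono[of "Suc k" j] by fastforce
          qed
          moreover have "0 < r" using True s_bnd[of i] i by auto
          ultimately have "(\<Sum>j<n. ?k j r) \<le> ?\<beta> * r powr \<alpha>"
            by (intro sum_fractional_density_le \<alpha>) auto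
          then show ?thesis using True by simp
        qed simp
      qed
      finally show ?thesis by simp
    qed
    have "(\<Sum>i<N. (\<Sum>j<n. u j * q i j)\<^sup>2 / (\<sigma> i)\<^sup>2) \<le> (\<Sum>i<N. (c * ?\<beta>)\<^sup>2 * ((?A i)\<^sup>2 / (s (Suc i) - s i)))"
    proof (rule sum_mono)
      fix i assume "i \<in> {..<N}"
      then have i: "i < N" by simp
      have "(\<Sum>j<n. u j * q i j)\<^sup>2 \<le> (c * ?\<beta> * ?A i)\<^sup>2"
        using power_mono[OF le[OF i] abs_ge_zero, of 2] by simp
      then have "(\<Sum>j<n. u j * q i j)\<^sup>2 / (\<sigma> i)\<^sup>2 \<le> (c * ?\<beta> * ?A i)\<^sup>2 / (\<sigma> i)\<^sup>2"
        by (intro divide_right_mono) auto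
      then show "(\<Sum>j<n. u j * q i j)\<^sup>2 / (\<sigma> i)\<^sup>2 \<le> (c * ?\<beta>)\<^sup>2 * ((?A i)\<^sup>2 / (s (Suc i) - s i))"
        unfolding \<sigma>2[OF i] by (simp only: power_mult_distrib times_divide_eq_right)
    qed
    also have "\<dots> \<le> (c * ?\<beta>)\<^sup>2 * (T powr (2 * \<alpha> + 1) / (2 * \<alpha> + 1))"
      unfolding sum_distrib_left[symmetric]
      using s_bnd by (intro mult_left_mono grid_energy s \<alpha>) auto
    finally show ?thesis .
  qed
  have err: "\<bar>(\<Sum>l<\<nu> k. a k l * (\<Sum>j<n. u j * q l j)) - (\<Sum>j<k. u j * (T / real n))\<bar> \<le> c * e"
    if u: "\<And>j. j < n \<Longrightarrow> \<bar>u j\<bar> \<le> c" and k: "k \<le> n" for u k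
  proof -
    let ?S = "\<lambda>k j. step_integral (\<lambda>r _. ?\<Phi> j r) (es k) ()"
    let ?\<delta> = "\<lambda>k j. if j < k then T / real n else 0"
    have "(\<Sum>l<\<nu> k. a k l * (\<Sum>j<n. u j * q l j)) = (\<Sum>l<\<nu> k. \<Sum>j<n. u j * (a k l * q l j))"
      unfolding sum_distrib_left by (simp only: mult.left_commute)
    also have "\<dots> = (\<Sum>j<n. u j * ?S k j)"
      unfolding grid[OF k] q_def by (subst sum.swap) (simp only: sum_distrib_left)
    finally have 1: "(\<Sum>l<\<nu> k. a k l * (\<Sum>j<n. u j * q l j)) = (\<Sum>j<n. u j * ?S k j)" .
    have 2: "(\<Sum>j<k. u j * (T / real n)) = (\<Sum>j<n. u j * ?\<delta> k j)"
      using k by (intro sum.mono_neutral_cong_left) auto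
    have "\<bar>\<Sum>j<n. u j * (?S k j - ?\<delta> k j)\<bar> \<le> (\<Sum>j<n. \<bar>u j * (?S k j - ?\<delta> k j)\<bar>)" by (rule sum_abs)
    also have "\<dots> \<le> (\<Sum>j<n. c * \<bar>?S k j - ?\<delta> k j\<bar>)"
      unfolding abs_mult using u by (intro sum_mono mult_right_mono) auto
    also have "\<dots> = c * (\<Sum>j<n. \<bar>?S k j - ?\<delta> k j\<bar>)" by (simp only: sum_distrib_left)
    also have "\<dots> \<le> c * e"
      unfolding e using k c_nonneg
      by (intro mult_left_mono member_le_sum[where f = "\<lambda>k. \<Sum>j<n. \<bar>?S k j - ?\<delta> k j\<bar>"]) (auto intro!: sum_nonneg)
    finally show ?thesis unfolding 1 2 sum_subtractf[symmetric] right_diff_distrib[symmetric] .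
  qed
  let ?Z = "\<lambda>\<omega>. \<lambda>i\<in>{..<N}. W (s (Suc i)) \<omega> - W (s i) \<omega>"
  have \<beta>_meas: "\<beta> j \<in> borel_measurable borel" if "j < n" for j
    using lip[OF that] by (rule Lipschitz_borel_measurable)
  have f_meas: "f \<in> borel_measurable borel" by (rule Lipschitz_borel_measurable[OF f(3)])
  have transfer: "(\<integral>\<omega>. g (euler_path \<beta> z (\<lambda>k. step_integral W (es k) \<omega>) n) \<partial>M) =
      (\<integral>w. g (euler_path \<beta> z (linear_noise a \<nu> w) n) \<partial>gaussian_vector \<sigma> N)"
    if g: "g \<in> borel_measurable borel" for g :: "real \<Rightarrow> real" and z
  proof -
    have "linear_noise a \<nu> (?Z \<omega>) k = step_integral W (es k) \<omega>" if "k \<le> n" for k \<omega>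
      unfolding grid[OF that] linear_noise_def using \<nu>(1)[OF that] by (intro sum.cong) auto
    then have "(\<integral>\<omega>. g (euler_path \<beta> z (\<lambda>k. step_integral W (es k) \<omega>) n) \<partial>M) =
        (\<integral>\<omega>. g (euler_path \<beta> z (linear_noise a \<nu> (?Z \<omega>)) n) \<partial>M)"
      by (intro Bochner_Integration.integral_cong refl arg_cong[where f = g] euler_path_cong) auto
    also have "\<dots> = (\<integral>w. g (euler_path \<beta> z (linear_noise a \<nu> w) n) \<partial>distr M (gaussian_vector \<sigma> N) ?Z)"
    proof (rule integral_distr[symmetric])
      show "?Z \<in> measurable M (gaussian_vector \<sigma> N)"
        using s_bnd \<sigma> by (intro distr_increments s) auto
      have "(\<lambda>w. euler_path \<beta> z (linear_noise a \<nu> w) n) \<in> borel_measurable (PiM {..<N} (\<lambda>_. borel))"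
        using \<nu>(1) by (intro euler_path_measurable \<beta>_meas linear_noise_measurable) auto
      from measurable_compose[OF this g]
      show "(\<lambda>w. g (euler_path \<beta> z (linear_noise a \<nu> w) n)) \<in> borel_measurable (gaussian_vector \<sigma> N)"
        by (simp add: measurable_cong_sets[OF sets_gaussian_vector refl])
    qed
    also have "distr M (gaussian_vector \<sigma> N) ?Z = gaussian_vector \<sigma> N"
      using s_bnd \<sigma> by (intro distr_increments s) auto
    finally show ?thesis .
  qed
  have fp_meas: "(\<lambda>u. f u powr p) \<in> borel_measurable borel" using f_meas by measurable
  show ?thesis
    unfolding transfer[OF f_meas] transfer[OF fp_meas]
    by (rule euler_harnack[OF n \<kappa> lip \<nu>_mono \<nu>(1) \<sigma>(1) q_0 _ c D err f p]) (use T n in auto)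
qed

section \<open>From step functions to fractional Brownian motion\<close>

lemma tendsto_0_of_square_ennreal:
  fixes y :: "nat \<Rightarrow> ennreal"
  assumes "(\<lambda>m. (y m)\<^sup>2) \<longlonglongrightarrow> 0"
  shows "y \<longlonglongrightarrow> 0"
proof (rule order_tendstoI)
  fix a :: ennreal assume "0 < a"
  then have "0 < a\<^sup>2" by (simp add: power2_eq_square ennreal_zero_less_mult_iff)
  then have "\<forall>\<^sub>F m in sequentially. (y m)\<^sup>2 < a\<^sup>2" by (rule order_tendstoD(2)[OF assms])
  then show "\<forall>\<^sub>F m in sequentially. y m < a"
  proof eventually_elim
    case (elim m)
    show ?case
    proof (rule ccontr)
      assume "\<not> y m < a"
      then have "a * a \<le> y m * y m" by (intro mult_mono) auto
      then show False using elim by (simp add: power2_eq_square not_less[symmetric])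
    qed
  qed
qed simp

lemma nn_integral_product_tendsto_0:
  fixes X :: "nat \<Rightarrow> 'a \<Rightarrow> real" and g :: "'a \<Rightarrow> real"
  assumes [measurable]: "\<And>m. X m \<in> borel_measurable M" "g \<in> borel_measurable M"
    and X: "(\<lambda>m. \<integral>\<^sup>+\<omega>. ennreal ((X m \<omega>)\<^sup>2) \<partial>M) \<longlonglongrightarrow> 0"
    and g: "(\<integral>\<^sup>+\<omega>. ennreal ((g \<omega>)\<^sup>2) \<partial>M) < \<infinity>"
  shows "(\<lambda>m. \<integral>\<^sup>+\<omega>. ennreal \<bar>X m \<omega> * g \<omega>\<bar> \<partial>M) \<longlonglongrightarrow> 0"
proof (rule tendsto_0_of_square_ennreal)
  let ?G = "\<integral>\<^sup>+\<omega>. ennreal ((g \<omega>)\<^sup>2) \<partial>M"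
  have sq: "ennreal ((h \<omega>)\<^sup>2) = (ennreal \<bar>h \<omega>\<bar>)\<^sup>2" for h :: "'a \<Rightarrow> real" and \<omega>
    by (simp add: ennreal_power)
  have le: "(\<integral>\<^sup>+\<omega>. ennreal \<bar>X m \<omega> * g \<omega>\<bar> \<partial>M)\<^sup>2 \<le> (\<integral>\<^sup>+\<omega>. ennreal ((X m \<omega>)\<^sup>2) \<partial>M) * ?G" for m
  proof -
    have "(\<integral>\<^sup>+\<omega>. ennreal \<bar>X m \<omega> * g \<omega>\<bar> \<partial>M) = (\<integral>\<^sup>+\<omega>. ennreal \<bar>X m \<omega>\<bar> * ennreal \<bar>g \<omega>\<bar> \<partial>M)"
      by (simp add: abs_mult ennreal_mult')
    then show ?thesis unfolding sq by (simp only: Cauchy_Schwarz_nn_integral assms borel_measurable_abs measurable_compose[OF _ measurable_ennreal])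
  qed
  have "(\<lambda>m. ?G * (\<integral>\<^sup>+\<omega>. ennreal ((X m \<omega>)\<^sup>2) \<partial>M)) \<longlonglongrightarrow> ?G * 0"
    using g by (intro ennreal_tendsto_cmult X) auto
  then have "(\<lambda>m. (\<integral>\<^sup>+\<omega>. ennreal ((X m \<omega>)\<^sup>2) \<partial>M) * ?G) \<longlonglongrightarrow> 0" by (simp add: mult.commute)
  then show "(\<lambda>m. (\<integral>\<^sup>+\<omega>. ennreal \<bar>X m \<omega> * g \<omega>\<bar> \<partial>M)\<^sup>2) \<longlonglongrightarrow> 0"
    by (rule tendsto_sandwich[OF _ _ tendsto_const, rotated -1]) (use le in auto)
qed

lemma tendsto_of_ennreal_dist_le:
  fixes u :: "nat \<Rightarrow> real" and y :: "nat \<Rightarrow> ennreal"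
  assumes "\<And>m. ennreal \<bar>u m - v\<bar> \<le> y m" "y \<longlonglongrightarrow> 0"
  shows "u \<longlonglongrightarrow> v"
proof -
  have "(\<lambda>m. ennreal \<bar>u m - v\<bar>) \<longlonglongrightarrow> 0"
    by (rule tendsto_sandwich[OF _ _ tendsto_const assms(2)]) (use assms(1) in auto)
  then have "(\<lambda>m. ennreal \<bar>u m - v\<bar>) \<longlonglongrightarrow> ennreal 0" by simp
  then have "(\<lambda>m. \<bar>u m - v\<bar>) \<longlonglongrightarrow> 0" by (rule tendsto_ennrealD) auto
  then show ?thesis by (simp add: tendsto_rabs_zero_iff LIM_zero_iff)
qed

lemma abs_powr_diff_le:
  fixes a b C p :: real
  assumes "1 < p" "0 \<le> a" "a \<le> C" "0 \<le> b" "b \<le> C"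
  shows "\<bar>a powr p - b powr p\<bar> \<le> p * C powr (p - 1) * \<bar>a - b\<bar>"
proof -
  have *: "b powr p - a powr p \<le> p * C powr (p - 1) * (b - a)" if ab: "0 \<le> a" "a < b" "b \<le> C" for a b
  proof -
    have "\<exists>l z. a < z \<and> z < b \<and> DERIV (\<lambda>x. x powr p) z :> l \<and> b powr p - a powr p = (b - a) * l"
    proof (rule MVT[OF ab(2)])
      show "continuous_on {a..b} (\<lambda>x. x powr p)"
        using ab assms by (intro continuous_on_powr') (auto intro!: continuous_intros)
      show "(\<lambda>x. x powr p) differentiable (at x)" if "a < x" "x < b" for x
        using has_real_derivative_powr[of x p] that ab real_differentiable_def by auto
    qed
    then obtain l z where z: "a < z" "z < b" "DERIV (\<lambda>x. x powr p) z :> l" "b powr p - a powr p = (b - a) * l" by blast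
    have "l = p * z powr (p - 1)"
      using DERIV_unique[OF z(3) has_real_derivative_powr[of z p]] z(1) ab by simp
    also have "\<dots> \<le> p * C powr (p - 1)" using z ab assms by (intro mult_left_mono powr_mono2) auto
    finally show ?thesis using z(4) ab by (simp add: mult.commute mult_right_mono)
  qed
  have mono: "u powr p \<le> v powr p" if "0 \<le> u" "u \<le> v" for u v using that assms by (intro powr_mono2) auto
  show ?thesis
  proof (cases a b rule: linorder_cases)
    case less
    then show ?thesis using *[of a b] mono[of a b] assms by simp
  next
    case greater
    then show ?thesis using *[of b a] mono[of b a] assms by simp
  qed simp
qed

lemma step_integral_cumulative:
  assumes \<alpha>: "0 < \<alpha>" "\<alpha> < 1/2" and J: "J \<in> sets borel"
    and es: "\<And>c u v. (c, u, v) \<in> set es \<Longrightarrow> 0 \<le> u \<and> u \<le> v \<and> v \<le> b"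
  shows "has_bochner_integral lborel (\<lambda>x. step_fun es x * fractional_density \<alpha> J x)
    (step_integral (\<lambda>r _. fractional_cumulative \<alpha> J r) es \<omega>)"
  using es
proof (induction es)
  case Nil
  then show ?case by (simp add: step_fun_def step_integral_def has_bochner_integral_zero)
next
  case (Cons a es)
  obtain c u v where a: "a = (c, u, v)" by (cases a)
  from Cons.prems[of c u v] a have uv: "0 \<le> u" "u \<le> v" "v \<le> b" by auto
  have "has_bochner_integral lborel (\<lambda>x. indicator {u<..v} x * fractional_density \<alpha> J x)
      (fractional_cumulative \<alpha> J v - fractional_cumulative \<alpha> J u)"
    unfolding fractional_cumulative_diff[OF \<alpha> J uv(1,2)] has_bochner_integral_iff
    using uv by (intro conjI refl fractional_density_integrable[OF \<alpha> J, where b = v]) auto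
  then have first: "has_bochner_integral lborel (\<lambda>x. c * (indicator {u<..v} x * fractional_density \<alpha> J x))
      (c * (fractional_cumulative \<alpha> J v - fractional_cumulative \<alpha> J u))"
    by (intro has_bochner_integral_mult_right)
  have "has_bochner_integral lborel (\<lambda>x. step_fun es x * fractional_density \<alpha> J x)
      (step_integral (\<lambda>r _. fractional_cumulative \<alpha> J r) es \<omega>)"
    by (rule Cons.IH) (use Cons.prems in auto)
  from has_bochner_integral_add[OF first this]
  show ?case by (simp add: a step_fun_def step_integral_def algebra_simps)
qed

lemma step_fun_measurable [measurable]: "step_fun es \<in> borel_measurable borel"
proof (induction es)
  case (Cons a es)
  then show ?case by (cases a) (auto simp: step_fun_def[abs_def] intro!: borel_measurable_add)
qed (simp add: step_fun_def[abs_def])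

lemma step_integral_measurable:
  assumes "\<And>c u v. (c, u, v) \<in> set es \<Longrightarrow> W u \<in> borel_measurable M \<and> W v \<in> borel_measurable M"
  shows "step_integral W es \<in> borel_measurable M"
  using assms
proof (induction es)
  case (Cons a es)
  obtain c u v where a: "a = (c, u, v)" by (cases a)
  have "step_integral W es \<in> borel_measurable M" using Cons by auto
  moreover have "W u \<in> borel_measurable M" "W v \<in> borel_measurable M" using Cons.prems[of c u v] a by auto
  moreover have "step_integral W (a # es) = (\<lambda>\<omega>. c * (W v \<omega> - W u \<omega>) + step_integral W es \<omega>)"
    by (simp add: a step_integral_def fun_eq_iff)
  ultimately show ?case by simp
qed (simp add: step_integral_def[abs_def])

text \<open>The step functions converge to the kernel in \<open>L\<^sup>2\<close> and the density is square integrable, so the integrals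
against it converge to the value computed in \<open>nn_integral_K_kernel_fractional_density\<close>.\<close>

lemma step_integral_tendsto_measure:
  fixes es :: "nat \<Rightarrow> (real \<times> real \<times> real) list"
  assumes \<alpha>: "0 < \<alpha>" "\<alpha> < 1/2" and J[measurable]: "J \<in> sets borel" and t: "0 \<le> t"
    and K: "set_borel_measurable lborel {0<..<t} (K_kernel (1/2 - \<alpha>) t)"
    and es: "\<And>m c u v. (c, u, v) \<in> set (es m) \<Longrightarrow> 0 \<le> u \<and> u \<le> v \<and> v \<le> t"
    and lim: "(\<lambda>m. \<integral>\<^sup>+s \<in> {0<..<t}. ennreal ((step_fun (es m) s - K_kernel (1/2 - \<alpha>) t s)\<^sup>2) \<partial>lborel) \<longlonglongrightarrow> 0"
  shows "(\<lambda>m. step_integral (\<lambda>r _. fractional_cumulative \<alpha> J r) (es m) \<omega>) \<longlonglongrightarrow> measure lborel (J \<inter> {0<..<t})"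
proof -
  let ?K = "K_kernel (1/2 - \<alpha>) t" and ?k = "fractional_density \<alpha> J"
  let ?I = "indicator {0<..<t} :: real \<Rightarrow> real"
  \<comment> \<open>The difference of the two integrals is the integral of \<open>?X m * ?g\<close>, to which the Cauchy-Schwarz inequality applies.\<close>
  let ?X = "\<lambda>m x. ?I x * (step_fun (es m) x - ?K x)" and ?g = "\<lambda>x. ?I x * ?k x"
  let ?\<beta> = "Beta (1 + \<alpha>) \<alpha> / Gamma \<alpha>"
  have \<beta>: "0 \<le> ?\<beta>" using \<alpha> by (auto intro!: divide_nonneg_pos Gamma_real_pos less_imp_le[OF Beta_pos])
  have [measurable]: "(\<lambda>x. ?I x * ?K x) \<in> borel_measurable borel"
    using K by (simp add: set_borel_measurable_def)
  have [measurable]: "?k \<in> borel_measurable borel" by (rule fractional_density_measurable[OF \<alpha> J])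
  have X_meas: "?X m \<in> borel_measurable lborel" for m
    unfolding right_diff_distrib by measurable
  have fin: "emeasure lborel (J \<inter> {0<..<t}) < \<infinity>"
    by (rule order_le_less_trans[OF emeasure_mono[of _ "{0<..<t}"]]) (use t in auto)
  have K_int: "has_bochner_integral lborel (\<lambda>x. ?I x * ?K x * ?k x) (measure lborel (J \<inter> {0<..<t}))"
  proof (rule has_bochner_integral_nn_integral)
    show "(\<integral>\<^sup>+x. ennreal (?I x * ?K x * ?k x) \<partial>lborel) = ennreal (measure lborel (J \<inter> {0<..<t}))"
      unfolding nn_integral_K_kernel_fractional_density[OF \<alpha> K J]
      using fin by (intro emeasure_eq_ennreal_measure) auto
    show "AE x in lborel. 0 \<le> ?I x * ?K x * ?k x"
      using K_kernel_nonneg[OF \<alpha>] fractional_density_nonneg[OF \<alpha>] by (intro AE_I2) (auto simp: indicator_def)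
  qed auto
  have S_int: "has_bochner_integral lborel (\<lambda>x. step_fun (es m) x * ?k x)
      (step_integral (\<lambda>r _. fractional_cumulative \<alpha> J r) (es m) \<omega>)" for m
    using es[of _ _ _ m] by (rule step_integral_cumulative[OF \<alpha> J])
  have diff: "has_bochner_integral lborel (\<lambda>x. step_fun (es m) x * ?k x - ?I x * ?K x * ?k x)
      (step_integral (\<lambda>r _. fractional_cumulative \<alpha> J r) (es m) \<omega> - measure lborel (J \<inter> {0<..<t}))" for m
    by (intro has_bochner_integral_diff S_int K_int)
  have "(\<lambda>m. \<integral>\<^sup>+x. ennreal \<bar>?X m x * ?g x\<bar> \<partial>lborel) \<longlonglongrightarrow> 0"
  proof (rule nn_integral_product_tendsto_0[OF X_meas])
    have "(\<integral>\<^sup>+x. ennreal ((?X m x)\<^sup>2) \<partial>lborel) = (\<integral>\<^sup>+s \<in> {0<..<t}. ennreal ((step_fun (es m) s - ?K s)\<^sup>2) \<partial>lborel)" for m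
      by (intro nn_integral_cong) (auto simp: indicator_def)
    then show "(\<lambda>m. \<integral>\<^sup>+x. ennreal ((?X m x)\<^sup>2) \<partial>lborel) \<longlonglongrightarrow> 0" using lim by simp
    have "(\<integral>\<^sup>+x. ennreal ((?g x)\<^sup>2) \<partial>lborel) \<le> (\<integral>\<^sup>+x. ennreal ((?\<beta> * t powr \<alpha>)\<^sup>2) * indicator {0<..<t} x \<partial>lborel)"
    proof (intro nn_integral_mono)
      fix x :: real
      show "ennreal ((?g x)\<^sup>2) \<le> ennreal ((?\<beta> * t powr \<alpha>)\<^sup>2) * indicator {0<..<t} x"
      proof (cases "x \<in> {0<..<t}")
        case True
        have "?k x \<le> ?\<beta> * x powr \<alpha>" using True by (intro fractional_density_le \<alpha> J) auto
        also have "\<dots> \<le> ?\<beta> * t powr \<alpha>" using True \<alpha> \<beta> by (intro mult_left_mono powr_mono2) auto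
        finally have "(?k x)\<^sup>2 \<le> (?\<beta> * t powr \<alpha>)\<^sup>2"
          using fractional_density_nonneg[OF \<alpha>] by (intro power_mono)
        then show ?thesis using True by (simp add: ennreal_leI)
      qed simp
    qed
    also have "\<dots> < \<infinity>" using t by (simp add: nn_integral_cmult ennreal_mult_less_top)
    finally show "(\<integral>\<^sup>+x. ennreal ((?g x)\<^sup>2) \<partial>lborel) < \<infinity>" .
  qed measurable
  moreover have "ennreal \<bar>step_integral (\<lambda>r _. fractional_cumulative \<alpha> J r) (es m) \<omega> - measure lborel (J \<inter> {0<..<t})\<bar> \<le>
      (\<integral>\<^sup>+x. ennreal \<bar>?X m x * ?g x\<bar> \<partial>lborel)" for m
  proof -
    have "ennreal \<bar>step_integral (\<lambda>r _. fractional_cumulative \<alpha> J r) (es m) \<omega> - measure lborel (J \<inter> {0<..<t})\<bar> \<le>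
        (\<integral>\<^sup>+x. ennreal \<bar>step_fun (es m) x * ?k x - ?I x * ?K x * ?k x\<bar> \<partial>lborel)"
      using integral_norm_bound_ennreal[OF integrable.intros[OF diff[of m]]]
      unfolding has_bochner_integral_integral_eq[OF diff] by simp
    also have "\<dots> = (\<integral>\<^sup>+x. ennreal \<bar>?X m x * ?g x\<bar> \<partial>lborel)"
    proof (rule nn_integral_cong_AE)
      \<comment> \<open>The step functions may be nonzero at the end point \<open>t\<close>, which the open interval leaves out.\<close>
      have "AE x in lborel. x \<noteq> t" by (rule AE_lborel_singleton)
      then show "AE x in lborel. ennreal \<bar>step_fun (es m) x * ?k x - ?I x * ?K x * ?k x\<bar> = ennreal \<bar>?X m x * ?g x\<bar>"
      proof eventually_elim
        case (elim x)
        show ?case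
        proof (cases "x \<in> {0<..<t}")
          case True
          then show ?thesis by (simp add: left_diff_distrib)
        next
          case False
          have "step_fun (es m) x * ?k x = 0"
          proof (cases "x \<le> 0")
            case True
            then have "{0<..<x} = {}" by simp
            then show ?thesis by (simp add: fractional_density_def[OF \<alpha>])
          next
            assume "\<not> x \<le> 0"
            then have "t < x" using False elim by auto
            then have "step_fun (es m) x = 0" using es by (intro step_fun_eq_0) fastforce
            then show ?thesis by simp
          qed
          then show ?thesis using False by simp
        qed
      qed
    qed
    finally show ?thesis .
  qed
  ultimately show ?thesis by (rule tendsto_of_ennreal_dist_le[rotated])
qed

text \<open>Mean-square convergence of the noise at the finitely many time points suffices, because the scheme is Lipschitz
in the noise.\<close>

lemma (in prob_space) expectation_euler_path_tendsto:
  fixes S :: "nat \<Rightarrow> nat \<Rightarrow> 'a \<Rightarrow> real" and B :: "nat \<Rightarrow> 'a \<Rightarrow> real"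
  assumes \<kappa>: "0 \<le> \<kappa>" and lip: "\<And>j u v. j < n \<Longrightarrow> \<bar>\<beta> j u - \<beta> j v\<bar> \<le> \<kappa> * \<bar>u - v\<bar>"
    and S[measurable]: "\<And>m k. k \<le> n \<Longrightarrow> S m k \<in> borel_measurable M" and B[measurable]: "\<And>k. k \<le> n \<Longrightarrow> B k \<in> borel_measurable M"
    and lim: "\<And>k. k \<le> n \<Longrightarrow> (\<lambda>m. \<integral>\<^sup>+\<omega>. ennreal ((S m k \<omega> - B k \<omega>)\<^sup>2) \<partial>M) \<longlonglongrightarrow> 0"
    and g: "\<And>u v. \<bar>g u - g v\<bar> \<le> L * \<bar>u - v\<bar>" "0 \<le> L" "\<And>u. \<bar>g u\<bar> \<le> C"
  shows "(\<lambda>m. expectation (\<lambda>\<omega>. g (euler_path \<beta> z (\<lambda>k. S m k \<omega>) n))) \<longlonglongrightarrow>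
    expectation (\<lambda>\<omega>. g (euler_path \<beta> z (\<lambda>k. B k \<omega>) n))"
proof -
  let ?X = "\<lambda>m \<omega>. g (euler_path \<beta> z (\<lambda>k. S m k \<omega>) n)" and ?Y = "\<lambda>\<omega>. g (euler_path \<beta> z (\<lambda>k. B k \<omega>) n)"
  let ?c = "L * (1 + \<kappa>) ^ n"
  have c: "0 \<le> ?c" using \<kappa> g by simp
  have \<beta>_meas: "\<beta> j \<in> borel_measurable borel" if "j < n" for j
    using lip[OF that] by (rule Lipschitz_borel_measurable)
  have g_meas: "g \<in> borel_measurable borel" by (rule Lipschitz_borel_measurable[OF g(1)])
  have meas: "?X m \<in> borel_measurable M" "?Y \<in> borel_measurable M" for m
    by (auto intro!: measurable_compose[OF _ g_meas] euler_path_measurable \<beta>_meas S B)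
  have int: "integrable M (?X m)" "integrable M ?Y" for m
    using meas g(3) by (auto intro!: integrable_const_bound[where B = C])
  have le: "\<bar>?X m \<omega> - ?Y \<omega>\<bar> \<le> ?c * (\<Sum>k\<le>n. \<bar>S m k \<omega> - B k \<omega>\<bar>)" for m \<omega>
  proof -
    have "\<bar>euler_path \<beta> z (\<lambda>k. S m k \<omega>) n - euler_path \<beta> z (\<lambda>k. B k \<omega>) n\<bar> \<le> (\<Sum>k\<le>n. \<bar>S m k \<omega> - B k \<omega>\<bar>) * (1 + \<kappa>) ^ n"
      by (rule euler_path_stable[OF lip \<kappa>]) (auto intro: member_le_sum)
    then have "L * \<bar>euler_path \<beta> z (\<lambda>k. S m k \<omega>) n - euler_path \<beta> z (\<lambda>k. B k \<omega>) n\<bar> \<le>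
        L * ((\<Sum>k\<le>n. \<bar>S m k \<omega> - B k \<omega>\<bar>) * (1 + \<kappa>) ^ n)"
      using g(2) by (rule mult_left_mono)
    then show ?thesis
      using g(1)[of "euler_path \<beta> z (\<lambda>k. S m k \<omega>) n" "euler_path \<beta> z (\<lambda>k. B k \<omega>) n"] by (simp add: mult_ac)
  qed
  have "ennreal \<bar>expectation (?X m) - expectation ?Y\<bar> \<le> ennreal ?c * (\<Sum>k\<le>n. \<integral>\<^sup>+\<omega>. ennreal \<bar>(S m k \<omega> - B k \<omega>) * 1\<bar> \<partial>M)" for m
  proof -
    have "ennreal \<bar>expectation (?X m) - expectation ?Y\<bar> \<le> (\<integral>\<^sup>+\<omega>. ennreal \<bar>?X m \<omega> - ?Y \<omega>\<bar> \<partial>M)"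
      using integral_norm_bound_ennreal[OF Bochner_Integration.integrable_diff[OF int]] int by simp
    also have "\<dots> \<le> (\<integral>\<^sup>+\<omega>. ennreal ?c * (\<Sum>k\<le>n. ennreal \<bar>(S m k \<omega> - B k \<omega>) * 1\<bar>) \<partial>M)"
      using le c by (intro nn_integral_mono) (simp add: sum_ennreal ennreal_mult'[symmetric] ennreal_leI)
    also have "\<dots> = ennreal ?c * (\<Sum>k\<le>n. \<integral>\<^sup>+\<omega>. ennreal \<bar>(S m k \<omega> - B k \<omega>) * 1\<bar> \<partial>M)"
    proof -
      have m: "(\<lambda>\<omega>. ennreal \<bar>(S m k \<omega> - B k \<omega>) * 1\<bar>) \<in> borel_measurable M" if "k \<in> {..n}" for k
        using S[of k m] B[of k] that by auto
      have "(\<integral>\<^sup>+\<omega>. (\<Sum>k\<le>n. ennreal \<bar>(S m k \<omega> - B k \<omega>) * 1\<bar>) \<partial>M) = (\<Sum>k\<le>n. \<integral>\<^sup>+\<omega>. ennreal \<bar>(S m k \<omega> - B k \<omega>) * 1\<bar> \<partial>M)"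
        by (rule nn_integral_sum[OF m])
      then show ?thesis
        by (simp only: nn_integral_cmult[OF borel_measurable_sum[OF m]])
    qed
    finally show ?thesis .
  qed
  moreover have "(\<lambda>m. ennreal ?c * (\<Sum>k\<le>n. \<integral>\<^sup>+\<omega>. ennreal \<bar>(S m k \<omega> - B k \<omega>) * 1\<bar> \<partial>M)) \<longlonglongrightarrow> 0"
  proof -
    have "(\<lambda>m. ennreal ?c * (\<Sum>k\<le>n. \<integral>\<^sup>+\<omega>. ennreal \<bar>(S m k \<omega> - B k \<omega>) * 1\<bar> \<partial>M)) \<longlonglongrightarrow> ennreal ?c * (\<Sum>k\<le>n. 0)"
      using S B lim
      by (intro ennreal_tendsto_cmult tendsto_sum nn_integral_product_tendsto_0) (auto simp: emeasure_space_1)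
    then show ?thesis by simp
  qed
  ultimately show ?thesis by (rule tendsto_of_ennreal_dist_le)
qed

lemma measure_cell_Int:
  assumes T: "0 < T" and n: "0 < n" and k: "k \<le> n"
  shows "measure lborel ({real j * T / real n<..real (Suc j) * T / real n} \<inter> {0<..<real k * T / real n}) =
    (if j < k then T / real n else 0)"
proof -
  let ?t = "\<lambda>k. real k * T / real n"
  have mono: "?t i \<le> ?t j" if "i \<le> j" for i j
    using that T n by (intro divide_right_mono mult_right_mono) auto
  have step: "?t (Suc j) - ?t j = T / real n" using n by (simp add: field_simps)
  show ?thesis
  proof (cases "j < k")
    case False
    then have "{?t j<..?t (Suc j)} \<inter> {0<..<?t k} = {}" using mono[of k j] by fastforce
    then show ?thesis using False by simp
  next
    case True
    have pos: "?t j < ?t (Suc j)" 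
    proof -
      have "0 < T / real n" using T n by simp
      then show ?thesis using step by linarith
    qed
    have j0: "0 \<le> ?t j" using T by simp
    have jk: "?t (Suc j) \<le> ?t k" using mono[of "Suc j" k] True by simp
    show ?thesis
    proof (cases "Suc j = k")
      case True
      then have "{?t j<..?t (Suc j)} \<inter> {0<..<?t k} = {?t j<..<?t (Suc j)}" using j0 by auto
      then show ?thesis using \<open>j < k\<close> pos step by simp
    next
      case False
      then have "Suc (Suc j) \<le> k" using True by simp
      then have "?t (Suc (Suc j)) \<le> ?t k" by (rule mono)
      moreover have "?t (Suc j) < ?t (Suc (Suc j))" using T n by (intro divide_strict_right_mono mult_strict_right_mono) auto
      ultimately have "{?t j<..?t (Suc j)} \<inter> {0<..<?t k} = {?t j<..?t (Suc j)}" using j0 by auto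
      then show ?thesis using \<open>j < k\<close> pos step by simp
    qed
  qed
qed

text \<open>Approximate the kernel at each of the \<open>n + 1\<close> time points by step functions and pass to the limit in
\<open>step_harnack\<close>: the exponent is the same for all approximations and the error \<open>e\<close> vanishes.\<close>

lemma (in fractional_brownian_motion) euler_harnack_fbm:
  fixes \<kappa> L C c p x y \<alpha> :: real and n :: nat
  defines "\<alpha> \<equiv> 1/2 - H"
  assumes H: "0 < H" "H < 1/2" and T: "0 < T" and n: "0 < n"
    and \<kappa>: "0 \<le> \<kappa>" and lip: "\<And>j u v. j < n \<Longrightarrow> \<bar>\<beta> j u - \<beta> j v\<bar> \<le> \<kappa> * \<bar>u - v\<bar>"
    and c: "c = \<bar>y - x\<bar> * (\<kappa> + 1 / real n) / (T / real n)"
    and f: "\<And>u. 0 \<le> f u" "\<And>u. f u \<le> C" "\<And>u v. \<bar>f u - f v\<bar> \<le> L * \<bar>u - v\<bar>" "0 \<le> L" and p: "1 < p"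
  shows "(\<integral>\<omega>. f (euler_path \<beta> y (\<lambda>k. B (real k * T / real n) \<omega>) n) \<partial>M) \<le>
    (\<integral>\<omega>. f (euler_path \<beta> x (\<lambda>k. B (real k * T / real n) \<omega>) n) powr p \<partial>M) powr (1 / p) *
      exp ((c * (Beta (1 + \<alpha>) \<alpha> / Gamma \<alpha>))\<^sup>2 * (T powr (2 * \<alpha> + 1) / (2 * \<alpha> + 1)) / (2 * (p - 1)))"
proof -
  let ?t = "\<lambda>k. real k * T / real n"
  have \<alpha>: "0 < \<alpha>" "\<alpha> < 1/2" and H_eq: "H = 1/2 - \<alpha>" using H by (auto simp: \<alpha>_def)
  have t: "?t k \<in> {0..T}" if "k \<le> n" for k
  proof -
    have "?t k \<le> real n * T / real n" using that T by (intro divide_right_mono mult_right_mono) auto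
    then show ?thesis using T n by simp
  qed
  have rep: "is_wiener_integral M W (?t k) (K_kernel (1/2 - \<alpha>) (?t k)) (B (?t k))" if "k \<le> n" for k
    using B_representation[OF t[OF that]] unfolding H_eq .
  let ?approx = "\<lambda>k es. (\<forall>m. \<forall>(c, u, v) \<in> set (es m). 0 \<le> u \<and> u \<le> v \<and> v \<le> ?t k) \<and>
        (\<lambda>m. \<integral>\<^sup>+ s \<in> {0<..<?t k}. ennreal ((step_fun (es m) s - K_kernel (1/2 - \<alpha>) (?t k) s)\<^sup>2) \<partial>lborel) \<longlonglongrightarrow> 0 \<and>
        (\<lambda>m. \<integral>\<^sup>+ \<omega>. ennreal ((step_integral W (es m) \<omega> - B (?t k) \<omega>)\<^sup>2) \<partial>M) \<longlonglongrightarrow> 0"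
  have "\<exists>es :: nat \<Rightarrow> (real \<times> real \<times> real) list. ?approx k es" if "k \<in> {..n}" for k
  proof -
    have "is_wiener_integral M W (?t k) (K_kernel (1/2 - \<alpha>) (?t k)) (B (?t k))" using rep that by simp
    then show ?thesis unfolding is_wiener_integral_def by (elim conjE)
  qed
  then obtain es :: "nat \<Rightarrow> nat \<Rightarrow> (real \<times> real \<times> real) list" where es0: "\<forall>k\<in>{..n}. ?approx k (es k)"
    by (rule bchoice[OF ballI, THEN exE])
  have es: "0 \<le> u \<and> u \<le> v \<and> v \<le> ?t k" if "k \<le> n" "(c, u, v) \<in> set (es k m)" for k m c u v
  proof -
    have "k \<in> {..n}" using that(1) by simp
    note bspec[OF es0 this, THEN conjunct1, rule_format, OF that(2)]
    then show ?thesis by (simp only: prod.case)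
  qed
  have lim_K: "(\<lambda>m. \<integral>\<^sup>+ s \<in> {0<..<?t k}. ennreal ((step_fun (es k m) s - K_kernel (1/2 - \<alpha>) (?t k) s)\<^sup>2) \<partial>lborel) \<longlonglongrightarrow> 0"
    and lim_B: "(\<lambda>m. \<integral>\<^sup>+ \<omega>. ennreal ((step_integral W (es k m) \<omega> - B (?t k) \<omega>)\<^sup>2) \<partial>M) \<longlonglongrightarrow> 0" if "k \<le> n" for k
  proof -
    have "k \<in> {..n}" using that by simp
    note * = bspec[OF es0 this, THEN conjunct2]
    show "(\<lambda>m. \<integral>\<^sup>+ s \<in> {0<..<?t k}. ennreal ((step_fun (es k m) s - K_kernel (1/2 - \<alpha>) (?t k) s)\<^sup>2) \<partial>lborel) \<longlonglongrightarrow> 0"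
      by (rule *[THEN conjunct1])
    show "(\<lambda>m. \<integral>\<^sup>+ \<omega>. ennreal ((step_integral W (es k m) \<omega> - B (?t k) \<omega>)\<^sup>2) \<partial>M) \<longlonglongrightarrow> 0"
      by (rule *[THEN conjunct2])
  qed
  have B_meas: "B (?t k) \<in> borel_measurable M" if "k \<le> n" for k
    using rep[OF that] by (simp add: is_wiener_integral_def)
  have S_meas: "step_integral W (es k m) \<in> borel_measurable M" if "k \<le> n" for k m
    using es[OF that] t[OF that] by (intro step_integral_measurable conjI W_measurable) (fastforce dest: es[OF that])+
  define e where "e m = (\<Sum>k\<le>n. \<Sum>j<n. \<bar>step_integral (\<lambda>r _. fractional_cumulative \<alpha> {?t j<..?t (Suc j)} r) (es k m) () -
        (if j < k then T / real n else 0)\<bar>)" for m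
  have "e \<longlonglongrightarrow> (\<Sum>k\<le>n. \<Sum>j<n. \<bar>(if j < k then T / real n else 0) - (if j < k then T / real n else 0)\<bar>)"
    unfolding e_def
  proof (intro tendsto_sum tendsto_rabs tendsto_diff tendsto_const)
    fix k j assume "k \<in> {..n}"
    then have k: "k \<le> n" by simp
    have "(\<lambda>m. step_integral (\<lambda>r _. fractional_cumulative \<alpha> {?t j<..?t (Suc j)} r) (es k m) ())
        \<longlonglongrightarrow> measure lborel ({?t j<..?t (Suc j)} \<inter> {0<..<?t k})"
      using rep[OF k] t[OF k] es[OF k] unfolding is_wiener_integral_def
      by (intro step_integral_tendsto_measure[OF \<alpha>] lim_K[OF k]) auto
    then show "(\<lambda>m. step_integral (\<lambda>r _. fractional_cumulative \<alpha> {?t j<..?t (Suc j)} r) (es k m) ())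
        \<longlonglongrightarrow> (if j < k then T / real n else 0)"
      unfolding measure_cell_Int[OF T n k] .
  qed
  then have e_lim: "e \<longlonglongrightarrow> 0" by simp
  let ?E = "exp ((c * (Beta (1 + \<alpha>) \<alpha> / Gamma \<alpha>))\<^sup>2 * (T powr (2 * \<alpha> + 1) / (2 * \<alpha> + 1)) / (2 * (p - 1)))"
  let ?l = "\<lambda>m. \<integral>\<omega>. f (euler_path \<beta> y (\<lambda>k. step_integral W (es k m) \<omega>) n) \<partial>M"
  let ?r = "\<lambda>m. \<integral>\<omega>. f (euler_path \<beta> x (\<lambda>k. step_integral W (es k m) \<omega>) n) powr p \<partial>M"
  have C: "0 \<le> C" using f(1,2)[of 0] by linarith
  have l_lim: "?l \<longlonglongrightarrow> (\<integral>\<omega>. f (euler_path \<beta> y (\<lambda>k. B (?t k) \<omega>) n) \<partial>M)"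
    by (rule expectation_euler_path_tendsto[OF \<kappa> lip S_meas B_meas lim_B f(3,4), where C = C]) (use f in auto)
  have r_lim: "?r \<longlonglongrightarrow> (\<integral>\<omega>. f (euler_path \<beta> x (\<lambda>k. B (?t k) \<omega>) n) powr p \<partial>M)"
  proof (rule expectation_euler_path_tendsto[OF \<kappa> lip S_meas B_meas lim_B,
      where g = "\<lambda>u. f u powr p" and L = "p * C powr (p - 1) * L" and C = "C powr p"])
    fix u v
    have "\<bar>f u powr p - f v powr p\<bar> \<le> p * C powr (p - 1) * \<bar>f u - f v\<bar>"
      using f p by (intro abs_powr_diff_le) auto
    also have "\<dots> \<le> p * C powr (p - 1) * (L * \<bar>u - v\<bar>)"
      using f p by (intro mult_left_mono) auto
    finally show "\<bar>f u powr p - f v powr p\<bar> \<le> p * C powr (p - 1) * L * \<bar>u - v\<bar>" by (simp add: mult.assoc)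
    show "\<bar>f u powr p\<bar> \<le> C powr p" using f p by (auto intro!: powr_mono2)
  qed (use f p in auto)
  have "?l m \<le> ?r m powr (1 / p) * ?E + L * (c * e m * (1 + \<kappa>) ^ n)" for m
    by (rule step_harnack[OF \<alpha> T n \<kappa> lip es c e_def f p])
  moreover have "(\<lambda>m. ?r m powr (1 / p) * ?E + L * (c * e m * (1 + \<kappa>) ^ n)) \<longlonglongrightarrow>
      (\<integral>\<omega>. f (euler_path \<beta> x (\<lambda>k. B (?t k) \<omega>) n) powr p \<partial>M) powr (1 / p) * ?E + L * (c * 0 * (1 + \<kappa>) ^ n)"
  proof (intro tendsto_intros tendsto_powr' r_lim e_lim)
    show "(\<integral>\<omega>. f (euler_path \<beta> x (\<lambda>k. B (?t k) \<omega>) n) powr p \<partial>M) \<noteq> 0 \<or>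
      0 < 1 / p \<and> (\<forall>\<^sub>F m in sequentially. 0 \<le> ?r m)" using p by auto
  qed
  ultimately show ?thesis
    using LIMSEQ_le[OF l_lim, of "\<lambda>m. ?r m powr (1 / p) * ?E + L * (c * e m * (1 + \<kappa>) ^ n)"] by auto
qed

section \<open>Convergence of the Euler scheme\<close>

lemma set_integral_abs_le:
  fixes g :: "real \<Rightarrow> real"
  assumes "a \<le> b" "set_integrable lborel {a<..b} g" "\<And>s. s \<in> {a<..b} \<Longrightarrow> \<bar>g s\<bar> \<le> m"
  shows "\<bar>LINT s:{a<..b}|lborel. g s\<bar> \<le> m * (b - a)"
proof -
  have int: "integrable lborel (\<lambda>s. indicator {a<..b} s * g s)"
    using assms(2) by (simp add: set_integrable_def)
  have "\<bar>\<integral>s. indicator {a<..b} s * g s \<partial>lborel\<bar> \<le> (\<integral>s. \<bar>indicator {a<..b} s * g s\<bar> \<partial>lborel)"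
    by (rule integral_abs_bound)
  also have "\<dots> \<le> (\<integral>s. m * indicator {a<..b} s \<partial>lborel)"
  proof (rule integral_mono)
    show "integrable lborel (\<lambda>s. m * indicator {a<..b} s)" using assms(1) by simp
  qed (use assms(3) int in \<open>auto simp: indicator_def\<close>)
  also have "\<dots> = m * (b - a)" using assms(1) by simp
  finally show ?thesis by (simp add: set_lebesgue_integral_def)
qed

text \<open>The drift is integrated over the cell because \<open>b\<close> is merely measurable in time: a point value \<open>b t u\<close> times the
length of the cell need not be close to the integral.\<close>

definition averaged_drift :: "(real \<Rightarrow> real \<Rightarrow> real) \<Rightarrow> real \<Rightarrow> nat \<Rightarrow> nat \<Rightarrow> real \<Rightarrow> real" where
  "averaged_drift b T n j u = (LINT s:{real j * T / real n<..real (Suc j) * T / real n}|lborel. b s u)"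

lemma grid_points:
  assumes "0 < T" "j < n"
  shows "0 \<le> real j * T / real n" "real j * T / real n \<le> real (Suc j) * T / real n"
    "real (Suc j) * T / real n \<le> T" "real (Suc j) * T / real n - real j * T / real n = T / real n"
proof -
  have "real (Suc j) * T / real n \<le> real n * T / real n"
    using assms by (intro divide_right_mono mult_right_mono) auto
  then show "real (Suc j) * T / real n \<le> T" using assms by simp
  show "real (Suc j) * T / real n - real j * T / real n = T / real n"
    using assms by (simp add: field_simps)
  show "real j * T / real n \<le> real (Suc j) * T / real n"
    using assms by (intro divide_right_mono mult_right_mono) auto
qed (use assms in auto)

lemma averaged_drift_lipschitz:
  assumes T: "0 < T" and K: "0 \<le> K" and lip: "\<And>t u v. t \<in> {0..T} \<Longrightarrow> \<bar>b t u - b t v\<bar> \<le> K * \<bar>u - v\<bar>"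
    and int: "\<And>u. set_integrable lborel {0..T} (\<lambda>s. b s u)" and j: "j < n"
  shows "\<bar>averaged_drift b T n j u - averaged_drift b T n j v\<bar> \<le> K * T / real n * \<bar>u - v\<bar>"
proof -
  let ?a = "real j * T / real n" and ?b = "real (Suc j) * T / real n"
  note g = grid_points[OF T j]
  have sub: "{?a<..?b} \<subseteq> {0..T}" using g by auto
  have int': "set_integrable lborel {?a<..?b} (\<lambda>s. b s u)" for u
    by (rule set_integrable_subset[OF int]) (use sub in auto)
  have "averaged_drift b T n j u - averaged_drift b T n j v = (LINT s:{?a<..?b}|lborel. b s u - b s v)"
    unfolding averaged_drift_def by (rule set_integral_diff(2)[OF int' int', symmetric])
  also have "\<bar>\<dots>\<bar> \<le> K * \<bar>u - v\<bar> * (?b - ?a)"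
  proof (rule set_integral_abs_le[OF g(2)])
    show "set_integrable lborel {?a<..?b} (\<lambda>s. b s u - b s v)" by (rule set_integral_diff(1)[OF int' int'])
    show "\<bar>b s u - b s v\<bar> \<le> K * \<bar>u - v\<bar>" if "s \<in> {?a<..?b}" for s using lip sub that by blast
  qed
  finally show ?thesis unfolding g(4) by (simp add: mult_ac)
qed

text \<open>The statement is about a single trajectory: the noise is additive, so the equation can be read path by path.
On a cell the solution differs from its value at the left end by the modulus of continuity, and the discrete
Gronwall inequality sums these errors.\<close>

lemma euler_path_tendsto_solution:
  fixes b :: "real \<Rightarrow> real \<Rightarrow> real" and X B :: "real \<Rightarrow> real"
  assumes T: "0 < T" and K: "0 \<le> K" and lip: "\<And>t u v. t \<in> {0..T} \<Longrightarrow> \<bar>b t u - b t v\<bar> \<le> K * \<bar>u - v\<bar>"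
    and int: "\<And>u. set_integrable lborel {0..T} (\<lambda>s. b s u)"
    and cont: "continuous_on {0..T} X"
    and X_int: "\<And>t. t \<in> {0..T} \<Longrightarrow> set_integrable lborel {0..t} (\<lambda>s. b s (X s))"
    and X_eq: "\<And>t. t \<in> {0..T} \<Longrightarrow> X t = z + (LINT s:{0..t}|lborel. b s (X s)) + B t"
  shows "(\<lambda>n. euler_path (averaged_drift b T n) z (\<lambda>k. B (real k * T / real n)) n) \<longlonglongrightarrow> X T"
proof (rule LIMSEQ_I)
  fix \<eta> :: real assume \<eta>: "0 < \<eta>"
  \<comment> \<open>The factor that the discrete Gronwall inequality puts in front of \<open>\<epsilon>\<close> is at most \<open>K * T * exp (K * T)\<close>.\<close>
  define \<epsilon> where "\<epsilon> = \<eta> / (K * T * exp (K * T) + 1)"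
  have pos: "0 < K * T * exp (K * T) + 1" using K T by (intro add_nonneg_pos mult_nonneg_nonneg) auto
  have \<epsilon>: "0 < \<epsilon>" using \<eta> pos by (simp add: \<epsilon>_def)
  have \<epsilon>\<eta>: "K * T * \<epsilon> * exp (K * T) < \<eta>"
  proof -
    have "\<epsilon> * (K * T * exp (K * T) + 1) = \<eta>" using pos by (simp add: \<epsilon>_def)
    then show ?thesis using \<epsilon> by (simp add: algebra_simps)
  qed
  have "uniformly_continuous_on {0..T} X" using cont by (rule compact_uniformly_continuous) auto
  then obtain \<delta> where \<delta>: "0 < \<delta>" "\<And>s t. s \<in> {0..T} \<Longrightarrow> t \<in> {0..T} \<Longrightarrow> \<bar>s - t\<bar> < \<delta> \<Longrightarrow> \<bar>X s - X t\<bar> < \<epsilon>"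
    using \<epsilon> unfolding uniformly_continuous_on_def dist_real_def by metis
  obtain n0 :: nat where n0: "T / \<delta> < real n0" using reals_Archimedean2 by blast
  have "\<bar>euler_path (averaged_drift b T n) z (\<lambda>k. B (real k * T / real n)) n - X T\<bar> < \<eta>" if "n0 \<le> n" for n
  proof -
    have "T / \<delta> < real n" using n0 that by simp
    moreover have "0 < T / \<delta>" using T \<delta> by simp
    ultimately have n: "0 < n" by (metis of_nat_0_less_iff less_trans)
    have mesh: "T / real n < \<delta>" using \<open>T / \<delta> < real n\<close> \<delta>(1) n by (simp add: field_simps)
    let ?t = "\<lambda>k. real k * T / real n" and ?\<beta> = "averaged_drift b T n"
    let ?E = "euler_path ?\<beta> z (\<lambda>k. B (?t k))"
    let ?J = "\<lambda>j. {?t j<..?t (Suc j)}"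
    have t: "?t k \<in> {0..T}" if "k \<le> n" for k
      using grid_points[OF T, of "k - 1" n] that T n by (cases k) auto
    have J_sub: "?J j \<subseteq> {0..T}" if "j < n" for j using grid_points[OF T that] by auto
    have X_int': "set_integrable lborel (?J j) (\<lambda>s. b s (X s))" if "j < n" for j
      by (rule set_integrable_subset[OF X_int[of T]]) (use J_sub[OF that] T in auto)
    have int': "set_integrable lborel (?J j) (\<lambda>s. b s u)" if "j < n" for j u
      by (rule set_integrable_subset[OF int]) (use J_sub[OF that] in auto)
    have X_sum: "(LINT s:{0..?t k}|lborel. b s (X s)) = (\<Sum>j<k. LINT s:?J j|lborel. b s (X s))" if "k \<le> n" for k
      using that
    proof (induction k)
      case 0
      have "AE s in lborel. s \<noteq> (0::real)" by (rule AE_lborel_singleton)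
      then have "(LINT s:{0..0}|lborel. b s (X s)) = 0"
        unfolding set_lebesgue_integral_def by (intro integral_eq_zero_AE) (auto elim!: eventually_mono)
      then show ?case by simp
    next
      case (Suc k)
      then have k: "k < n" by simp
      note g = grid_points[OF T k]
      have "{0..?t (Suc k)} = {0..?t k} \<union> ?J k" using g by auto
      then have "(LINT s:{0..?t (Suc k)}|lborel. b s (X s)) = (LINT s:{0..?t k} \<union> ?J k|lborel. b s (X s))" by simp
      also have "\<dots> = (LINT s:{0..?t k}|lborel. b s (X s)) + (LINT s:?J k|lborel. b s (X s))"
        using k t[of k] by (intro set_integral_Un X_int X_int') auto
      finally show ?case using Suc by simp
    qed
    have "\<bar>X (?t n) - ?E n\<bar> \<le> K * T * \<epsilon> * (1 + K * T / real n) ^ n"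
    proof (rule discrete_gronwall[where n = n and d = "\<lambda>k. \<bar>X (?t k) - ?E k\<bar>"])
      fix k assume k: "k \<le> n"
      have cell: "\<bar>(LINT s:?J j|lborel. b s (X s)) - ?\<beta> j (?E j)\<bar> \<le> K * T / real n * (\<epsilon> + \<bar>X (?t j) - ?E j\<bar>)"
        if j: "j < n" for j
      proof -
        note g = grid_points[OF T j]
        have eq: "(LINT s:?J j|lborel. b s (X s)) - ?\<beta> j (?E j) = (LINT s:?J j|lborel. b s (X s) - b s (?E j))"
          unfolding averaged_drift_def by (rule set_integral_diff(2)[OF X_int'[OF j] int'[OF j], symmetric])
        have "\<bar>LINT s:?J j|lborel. b s (X s) - b s (?E j)\<bar> \<le> K * (\<epsilon> + \<bar>X (?t j) - ?E j\<bar>) * (?t (Suc j) - ?t j)"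
        proof (rule set_integral_abs_le[OF g(2)])
          show "set_integrable lborel (?J j) (\<lambda>s. b s (X s) - b s (?E j))"
            by (rule set_integral_diff(1)[OF X_int'[OF j] int'[OF j]])
          fix s assume s: "s \<in> ?J j"
          then have sT: "s \<in> {0..T}" using J_sub[OF j] by blast
          have "\<bar>s - ?t j\<bar> < \<delta>" using s g(4) mesh unfolding greaterThanAtMost_iff by linarith
          then have "\<bar>X s - X (?t j)\<bar> < \<epsilon>" using sT t[of j] j by (intro \<delta>(2)) auto
          then have "\<bar>X s - ?E j\<bar> \<le> \<epsilon> + \<bar>X (?t j) - ?E j\<bar>" by linarith
          then show "\<bar>b s (X s) - b s (?E j)\<bar> \<le> K * (\<epsilon> + \<bar>X (?t j) - ?E j\<bar>)"
            using lip[OF sT, of "X s" "?E j"] K by (meson mult_left_mono order_trans)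
        qed
        then have "\<bar>LINT s:?J j|lborel. b s (X s) - b s (?E j)\<bar> \<le> K * (\<epsilon> + \<bar>X (?t j) - ?E j\<bar>) * (T / real n)"
          by (simp only: g(4))
        moreover have "K * r * (T / real n) = K * T / real n * r" for r by simp
        ultimately show ?thesis unfolding eq by (simp only:)
      qed
      have "X (?t k) - ?E k = (\<Sum>j<k. (LINT s:?J j|lborel. b s (X s)) - ?\<beta> j (?E j))"
        unfolding X_eq[OF t[OF k]] X_sum[OF k] euler_path_eq_sum[of _ _ _ k] by (simp add: sum_subtractf)
      then have "\<bar>X (?t k) - ?E k\<bar> \<le> (\<Sum>j<k. \<bar>(LINT s:?J j|lborel. b s (X s)) - ?\<beta> j (?E j)\<bar>)"
        by (simp only: sum_abs)
      also have "\<dots> \<le> (\<Sum>j<k. K * T / real n * (\<epsilon> + \<bar>X (?t j) - ?E j\<bar>))"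
        using k by (intro sum_mono cell) auto
      also have "\<dots> = real k * (K * T / real n * \<epsilon>) + K * T / real n * (\<Sum>j<k. \<bar>X (?t j) - ?E j\<bar>)"
        by (simp add: distrib_left sum.distrib sum_distrib_left)
      finally have "\<bar>X (?t k) - ?E k\<bar> \<le> real k * (K * T / real n * \<epsilon>) + K * T / real n * (\<Sum>j<k. \<bar>X (?t j) - ?E j\<bar>)" .
      moreover have "real k * (K * T / real n * \<epsilon>) \<le> real n * (K * T / real n * \<epsilon>)"
        using k K T \<epsilon> by (intro mult_right_mono mult_nonneg_nonneg divide_nonneg_nonneg) auto
      moreover have "real n * (K * T / real n * \<epsilon>) = K * T * \<epsilon>" using n by simp
      ultimately show "\<bar>X (?t k) - ?E k\<bar> \<le> K * T * \<epsilon> + K * T / real n * (\<Sum>j<k. \<bar>X (?t j) - ?E j\<bar>)" by linarith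
    qed (use K T in auto)
    also have "\<dots> \<le> K * T * \<epsilon> * exp (K * T)"
    proof (rule mult_left_mono)
      have "(1 + K * T / real n) ^ n \<le> exp (K * T / real n) ^ n"
        using K T by (intro power_mono exp_ge_add_one_self add_nonneg_nonneg divide_nonneg_nonneg mult_nonneg_nonneg) auto
      then show "(1 + K * T / real n) ^ n \<le> exp (K * T)" using n by (simp flip: exp_of_nat_mult)
    qed (use K T \<epsilon> in simp)
    also have "\<dots> < \<eta>" by (rule \<epsilon>\<eta>)
    finally show ?thesis using n by (simp add: abs_minus_commute)
  qed
  then show "\<exists>n0. \<forall>n\<ge>n0. norm (euler_path (averaged_drift b T n) z (\<lambda>k. B (real k * T / real n)) n - X T) < \<eta>"
    by auto
qed

section \<open>From Lipschitz to bounded measurable functions\<close>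

text \<open>The approximation is simultaneous in two measures because the Harnack inequality compares the laws of the
solutions from two starting points.\<close>

definition lipschitz_approximable :: "real measure \<Rightarrow> real measure \<Rightarrow> (real \<Rightarrow> real) \<Rightarrow> bool" where
  "lipschitz_approximable \<mu> \<nu> f \<longleftrightarrow> integrable \<mu> f \<and> integrable \<nu> f \<and>
     (\<forall>\<epsilon>>0. \<exists>g L C. (\<forall>u v. \<bar>g u - g v\<bar> \<le> L * \<bar>u - v\<bar>) \<and> 0 \<le> L \<and> (\<forall>u. \<bar>g u\<bar> \<le> C) \<and>
       (\<integral>u. \<bar>f u - g u\<bar> \<partial>\<mu>) < \<epsilon> \<and> (\<integral>u. \<bar>f u - g u\<bar> \<partial>\<nu>) < \<epsilon>)"

lemma lipschitz_approximableD:
  assumes "lipschitz_approximable \<mu> \<nu> f" "0 < \<epsilon>"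
  obtains g L C where "\<And>u v. \<bar>g u - g v\<bar> \<le> L * \<bar>u - v\<bar>" "0 \<le> L" "\<And>u. \<bar>g u\<bar> \<le> C"
    "(\<integral>u. \<bar>f u - g u\<bar> \<partial>\<mu>) < \<epsilon>" "(\<integral>u. \<bar>f u - g u\<bar> \<partial>\<nu>) < \<epsilon>"
  using assms unfolding lipschitz_approximable_def by meson

context
  fixes \<mu> \<nu> :: "real measure"
  assumes prob: "prob_space \<mu>" "prob_space \<nu>" and sets [measurable_cong, simp]: "sets \<mu> = sets borel" "sets \<nu> = sets borel"
begin

interpretation \<mu>: prob_space \<mu> by (rule prob)
interpretation \<nu>: prob_space \<nu> by (rule prob)

lemma integrable_bounded_Lipschitz:
  fixes g :: "real \<Rightarrow> real"
  assumes "\<And>u v. \<bar>g u - g v\<bar> \<le> L * \<bar>u - v\<bar>" "\<And>u. \<bar>g u\<bar> \<le> C"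
  shows "integrable \<mu> g" "integrable \<nu> g"
proof -
  have [measurable]: "g \<in> borel_measurable borel" using assms(1) by (rule Lipschitz_borel_measurable)
  show "integrable \<mu> g" "integrable \<nu> g"
    using assms(2) by (auto intro!: \<mu>.integrable_const_bound[where B = C] \<nu>.integrable_const_bound[where B = C])
qed

lemma lipschitz_approximable_compact:
  assumes "compact A"
  shows "lipschitz_approximable \<mu> \<nu> (indicator A)"
proof (cases "A = {}")
  case True
  then show ?thesis unfolding lipschitz_approximable_def
    by (auto intro!: exI[of _ "\<lambda>_ :: real. 0 :: real"] exI[of _ "0 :: real"])
next
  case False
  have [measurable]: "A \<in> sets borel" using assms by (simp add: borel_compact)
  define g where "g n u = max 0 (1 - real n * infdist u A)" for n u
  have lip: "\<bar>g n u - g n v\<bar> \<le> real n * \<bar>u - v\<bar>" for n u v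
  proof -
    have "\<bar>infdist u A - infdist v A\<bar> \<le> \<bar>u - v\<bar>"
      using infdist_triangle[of u A v] infdist_triangle[of v A u] by (auto simp: dist_real_def abs_le_iff)
    then have "real n * \<bar>infdist u A - infdist v A\<bar> \<le> real n * \<bar>u - v\<bar>" by (intro mult_left_mono) auto
    moreover have "\<bar>g n u - g n v\<bar> \<le> \<bar>real n * infdist u A - real n * infdist v A\<bar>" by (auto simp: g_def)
    ultimately show ?thesis by (simp add: abs_mult flip: right_diff_distrib)
  qed
  have bnd: "0 \<le> g n u" "g n u \<le> 1" for n u using infdist_nonneg[of u A] by (auto simp: g_def)
  have lim: "(\<lambda>n. g n u) \<longlonglongrightarrow> indicator A u" for u
  proof (cases "u \<in> A")
    case True
    then show ?thesis by (simp add: g_def)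
  next
    assume u: "u \<notin> A"
    then have d: "0 < infdist u A"
      using in_closed_iff_infdist_zero[of A u] compact_imp_closed[OF assms] False infdist_nonneg[of u A] by auto
    obtain n0 :: nat where "1 / infdist u A < real n0" using reals_Archimedean2 by blast
    have "\<forall>\<^sub>F n in sequentially. g n u = 0"
      unfolding eventually_sequentially
    proof (intro exI[of _ n0] allI impI)
      fix n assume "n0 \<le> n"
      then have "1 / infdist u A < real n" using \<open>1 / infdist u A < real n0\<close> by simp
      then have "1 < real n * infdist u A" using d by (simp add: field_simps)
      then show "g n u = 0" by (simp add: g_def)
    qed
    then show ?thesis using u by (simp add: tendsto_eventually)
  qed
  have g_meas [measurable]: "g n \<in> borel_measurable borel" for n by (rule Lipschitz_borel_measurable[OF lip])
  have conv: "(\<lambda>n. \<integral>u. \<bar>indicator A u - g n u\<bar> \<partial>m) \<longlonglongrightarrow> 0" if "prob_space m" "sets m = sets borel" for m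
  proof -
    interpret prob_space m by fact
    note [measurable_cong] = that(2)
    have "(\<lambda>n. \<integral>u. \<bar>indicator A u - g n u\<bar> \<partial>m) \<longlonglongrightarrow> (\<integral>u. \<bar>indicator A u - indicator A u :: real\<bar> \<partial>m)"
    proof (rule integral_dominated_convergence[where w = "\<lambda>_. 1"])
      show "AE u in m. (\<lambda>n. \<bar>indicator A u - g n u\<bar>) \<longlonglongrightarrow> \<bar>indicator A u - indicator A u :: real\<bar>"
        by (intro AE_I2 tendsto_intros lim)
      show "AE u in m. norm \<bar>indicator A u - g n u\<bar> \<le> 1" for n
      proof (rule AE_I2)
        fix u show "norm \<bar>indicator A u - g n u\<bar> \<le> 1"
          using bnd(1)[of n u] bnd(2)[of n u] by (auto simp: indicator_def)
      qed
    qed auto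
    then show ?thesis by simp
  qed
  show ?thesis
    unfolding lipschitz_approximable_def
  proof (intro conjI allI impI)
    show "integrable \<mu> (indicator A :: real \<Rightarrow> real)" "integrable \<nu> (indicator A :: real \<Rightarrow> real)"
      by (auto intro!: \<mu>.integrable_const_bound[where B = 1] \<nu>.integrable_const_bound[where B = 1])
    fix \<epsilon> :: real assume "0 < \<epsilon>"
    have "\<forall>\<^sub>F n in sequentially. (\<integral>u. \<bar>indicator A u - g n u\<bar> \<partial>\<mu>) < \<epsilon>"
      "\<forall>\<^sub>F n in sequentially. (\<integral>u. \<bar>indicator A u - g n u\<bar> \<partial>\<nu>) < \<epsilon>"
      by (intro order_tendstoD(2)[OF conv] prob sets \<open>0 < \<epsilon>\<close>)+
    then have "\<forall>\<^sub>F n in sequentially. (\<integral>u. \<bar>indicator A u - g n u\<bar> \<partial>\<mu>) < \<epsilon> \<and> (\<integral>u. \<bar>indicator A u - g n u\<bar> \<partial>\<nu>) < \<epsilon>"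
      by (rule eventually_conj)
    then obtain n where "(\<integral>u. \<bar>indicator A u - g n u\<bar> \<partial>\<mu>) < \<epsilon> \<and> (\<integral>u. \<bar>indicator A u - g n u\<bar> \<partial>\<nu>) < \<epsilon>"
      by (auto simp: eventually_sequentially)
    then show "\<exists>g L C. (\<forall>u v. \<bar>g u - g v\<bar> \<le> L * \<bar>u - v\<bar>) \<and> 0 \<le> L \<and> (\<forall>u. \<bar>g u\<bar> \<le> C) \<and>
       (\<integral>u. \<bar>indicator A u - g u\<bar> \<partial>\<mu>) < \<epsilon> \<and> (\<integral>u. \<bar>indicator A u - g u\<bar> \<partial>\<nu>) < \<epsilon>"
      using lip bnd by (intro exI[of _ "g n"] exI[of _ "real n"] exI[of _ 1]) auto
  qed
qed

lemma lipschitz_approximable_limit: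
  assumes f: "integrable \<mu> f" "integrable \<nu> f"
    and approx: "\<And>\<epsilon>. 0 < \<epsilon> \<Longrightarrow> \<exists>h. lipschitz_approximable \<mu> \<nu> h \<and> (\<integral>u. \<bar>f u - h u\<bar> \<partial>\<mu>) < \<epsilon> \<and> (\<integral>u. \<bar>f u - h u\<bar> \<partial>\<nu>) < \<epsilon>"
  shows "lipschitz_approximable \<mu> \<nu> f"
  unfolding lipschitz_approximable_def
proof (intro conjI f allI impI)
  fix \<epsilon> :: real assume \<epsilon>: "0 < \<epsilon>"
  then obtain h where h: "lipschitz_approximable \<mu> \<nu> h" "(\<integral>u. \<bar>f u - h u\<bar> \<partial>\<mu>) < \<epsilon> / 2" "(\<integral>u. \<bar>f u - h u\<bar> \<partial>\<nu>) < \<epsilon> / 2"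
    using approx[of "\<epsilon> / 2"] by auto
  obtain g L C where g: "\<And>u v. \<bar>g u - g v\<bar> \<le> L * \<bar>u - v\<bar>" "0 \<le> L" "\<And>u. \<bar>g u\<bar> \<le> C"
    "(\<integral>u. \<bar>h u - g u\<bar> \<partial>\<mu>) < \<epsilon> / 2" "(\<integral>u. \<bar>h u - g u\<bar> \<partial>\<nu>) < \<epsilon> / 2"
    using lipschitz_approximableD[OF h(1), of "\<epsilon> / 2"] \<epsilon> by auto
  have hi: "integrable \<mu> h" "integrable \<nu> h" using h(1) by (auto simp: lipschitz_approximable_def)
  have gi: "integrable \<mu> g" "integrable \<nu> g" using integrable_bounded_Lipschitz[OF g(1,3)] by auto
  have tri: "(\<integral>u. \<bar>f u - g u\<bar> \<partial>m) \<le> (\<integral>u. \<bar>f u - h u\<bar> \<partial>m) + (\<integral>u. \<bar>h u - g u\<bar> \<partial>m)"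
    if "integrable m f" "integrable m g" "integrable m h" for m
  proof -
    have "(\<integral>u. \<bar>f u - g u\<bar> \<partial>m) \<le> (\<integral>u. \<bar>f u - h u\<bar> + \<bar>h u - g u\<bar> \<partial>m)"
      using that by (intro integral_mono) auto
    then show ?thesis using that by simp
  qed
  show "\<exists>g L C. (\<forall>u v. \<bar>g u - g v\<bar> \<le> L * \<bar>u - v\<bar>) \<and> 0 \<le> L \<and> (\<forall>u. \<bar>g u\<bar> \<le> C) \<and>
       (\<integral>u. \<bar>f u - g u\<bar> \<partial>\<mu>) < \<epsilon> \<and> (\<integral>u. \<bar>f u - g u\<bar> \<partial>\<nu>) < \<epsilon>"
    using tri[of \<mu>] tri[of \<nu>] f gi hi g h by (intro exI[of _ g] exI[of _ L] exI[of _ C]) auto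
qed

text \<open>By inner regularity both measures of \<open>A\<close> are almost exhausted by compact subsets; their union serves both.\<close>

lemma lipschitz_approximable_indicator:
  assumes A [measurable]: "A \<in> sets borel"
  shows "lipschitz_approximable \<mu> \<nu> (indicator A)"
proof (rule lipschitz_approximable_limit)
  show "integrable \<mu> (indicator A :: real \<Rightarrow> real)" "integrable \<nu> (indicator A :: real \<Rightarrow> real)"
    by (auto intro!: \<mu>.integrable_const_bound[where B = 1] \<nu>.integrable_const_bound[where B = 1])
  fix \<epsilon> :: real assume \<epsilon>: "0 < \<epsilon>"
  have inner: "\<exists>C\<subseteq>A. compact C \<and> measure m A - measure m C < \<epsilon>" if "prob_space m" "sets m = sets borel" for m
  proof -
    interpret prob_space m by fact
    have "emeasure m A = (SUP C \<in> {C. C \<subseteq> A \<and> compact C}. emeasure m C)"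
      using that(2) A emeasure_space_1 by (intro inner_regular) auto
    moreover have "emeasure m A < (SUP C \<in> {C. C \<subseteq> A \<and> compact C}. emeasure m C) + ennreal \<epsilon>"
      unfolding calculation[symmetric] using \<epsilon> by (simp add: emeasure_eq_measure ennreal_plus[symmetric] ennreal_less_iff del: ennreal_plus)
    show ?thesis
    proof (rule ccontr)
      assume "\<not> ?thesis"
      then have le: "measure m C \<le> measure m A - \<epsilon>" if "C \<subseteq> A" "compact C" for C using that by (force simp: not_less)
      have "0 \<le> measure m A - \<epsilon>" using le[of "{}"] by simp
      have "emeasure m A \<le> ennreal (measure m A - \<epsilon>)"
        unfolding calculation by (rule SUP_least) (auto simp: emeasure_eq_measure intro!: ennreal_leI le)
      then show False using \<epsilon> \<open>0 \<le> measure m A - \<epsilon>\<close> by (simp add: emeasure_eq_measure)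
    qed
  qed
  obtain C where C: "C \<subseteq> A" "compact C" "measure \<mu> A - measure \<mu> C < \<epsilon>" using inner[OF prob(1) sets(1)] by blast
  obtain D where D: "D \<subseteq> A" "compact D" "measure \<nu> A - measure \<nu> D < \<epsilon>" using inner[OF prob(2) sets(2)] by blast
  have CD: "compact (C \<union> D)" "C \<union> D \<subseteq> A" using C D by (auto intro: compact_Un)
  have [measurable]: "C \<in> sets borel" "D \<in> sets borel" using C D by (auto simp: borel_compact)
  have eq: "(\<integral>u. \<bar>indicator A u - indicator (C \<union> D) u :: real\<bar> \<partial>m) = measure m A - measure m (C \<union> D)"
    if "prob_space m" "sets m = sets borel" for m
  proof -
    interpret prob_space m by fact
    note [measurable_cong] = that(2)
    have "(\<integral>u. \<bar>indicator A u - indicator (C \<union> D) u :: real\<bar> \<partial>m) = (\<integral>u. indicator (A - (C \<union> D)) u \<partial>m)"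
      using CD(2) by (intro Bochner_Integration.integral_cong) (auto simp: indicator_def)
    also have "\<dots> = measure m (A - (C \<union> D))" using that(2) by simp
    also have "\<dots> = measure m A - measure m (C \<union> D)" using CD(2) that(2) by (intro finite_measure_Diff) auto
    finally show ?thesis .
  qed
  have "measure \<mu> C \<le> measure \<mu> (C \<union> D)" "measure \<nu> D \<le> measure \<nu> (C \<union> D)"
    by (auto intro!: \<mu>.finite_measure_mono \<nu>.finite_measure_mono)
  then show "\<exists>h. lipschitz_approximable \<mu> \<nu> h \<and> (\<integral>u. \<bar>indicator A u - h u\<bar> \<partial>\<mu>) < \<epsilon> \<and> (\<integral>u. \<bar>indicator A u - h u\<bar> \<partial>\<nu>) < \<epsilon>"
    using C(3) D(3) eq[OF prob(1) sets(1)] eq[OF prob(2) sets(2)]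
    by (intro exI[of _ "indicator (C \<union> D)"] conjI lipschitz_approximable_compact CD) auto
qed

lemma lipschitz_approximable_cmult:
  assumes "lipschitz_approximable \<mu> \<nu> f" "0 \<le> c"
  shows "lipschitz_approximable \<mu> \<nu> (\<lambda>u. c * f u)"
  unfolding lipschitz_approximable_def
proof (intro conjI allI impI)
  show "integrable \<mu> (\<lambda>u. c * f u)" "integrable \<nu> (\<lambda>u. c * f u)"
    using assms by (auto simp: lipschitz_approximable_def)
  fix \<epsilon> :: real assume \<epsilon>: "0 < \<epsilon>"
  have pos: "0 < \<epsilon> / (c + 1)" using \<epsilon> assms by simp
  obtain g L C where g: "\<And>u v. \<bar>g u - g v\<bar> \<le> L * \<bar>u - v\<bar>" "0 \<le> L" "\<And>u. \<bar>g u\<bar> \<le> C"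
    "(\<integral>u. \<bar>f u - g u\<bar> \<partial>\<mu>) < \<epsilon> / (c + 1)" "(\<integral>u. \<bar>f u - g u\<bar> \<partial>\<nu>) < \<epsilon> / (c + 1)"
    using lipschitz_approximableD[OF assms(1) pos] by blast
  have scale: "\<bar>c * a - c * b\<bar> = c * \<bar>a - b\<bar>" for a b
    using assms by (simp add: abs_mult flip: right_diff_distrib)
  have small: "(\<integral>u. \<bar>c * f u - c * g u\<bar> \<partial>m) < \<epsilon>" if "(\<integral>u. \<bar>f u - g u\<bar> \<partial>m) < \<epsilon> / (c + 1)" for m
  proof -
    have "c * (\<integral>u. \<bar>f u - g u\<bar> \<partial>m) \<le> c * (\<epsilon> / (c + 1))" using that assms by (intro mult_left_mono) auto
    also have "\<dots> < \<epsilon>" using \<epsilon> assms by (simp add: field_simps)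
    finally show ?thesis by (simp add: scale)
  qed
  show "\<exists>g L C. (\<forall>u v. \<bar>g u - g v\<bar> \<le> L * \<bar>u - v\<bar>) \<and> 0 \<le> L \<and> (\<forall>u. \<bar>g u\<bar> \<le> C) \<and>
       (\<integral>u. \<bar>c * f u - g u\<bar> \<partial>\<mu>) < \<epsilon> \<and> (\<integral>u. \<bar>c * f u - g u\<bar> \<partial>\<nu>) < \<epsilon>"
    using g assms small[OF g(4)] small[OF g(5)]
    by (intro exI[of _ "\<lambda>u. c * g u"] exI[of _ "c * L"] exI[of _ "c * C"])
      (auto simp: scale abs_mult mult.assoc intro!: mult_left_mono)
qed

lemma lipschitz_approximable_add:
  assumes "lipschitz_approximable \<mu> \<nu> f" "lipschitz_approximable \<mu> \<nu> f'"
  shows "lipschitz_approximable \<mu> \<nu> (\<lambda>u. f u + f' u)"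
  unfolding lipschitz_approximable_def
proof (intro conjI allI impI)
  have fi: "integrable \<mu> f" "integrable \<nu> f" "integrable \<mu> f'" "integrable \<nu> f'"
    using assms by (auto simp: lipschitz_approximable_def)
  then show "integrable \<mu> (\<lambda>u. f u + f' u)" "integrable \<nu> (\<lambda>u. f u + f' u)" by auto
  fix \<epsilon> :: real assume "0 < \<epsilon>"
  then have \<epsilon>: "0 < \<epsilon> / 2" by simp
  obtain g L C where g: "\<And>u v. \<bar>g u - g v\<bar> \<le> L * \<bar>u - v\<bar>" "0 \<le> L" "\<And>u. \<bar>g u\<bar> \<le> C"
    "(\<integral>u. \<bar>f u - g u\<bar> \<partial>\<mu>) < \<epsilon> / 2" "(\<integral>u. \<bar>f u - g u\<bar> \<partial>\<nu>) < \<epsilon> / 2"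
    using lipschitz_approximableD[OF assms(1) \<epsilon>] by blast
  obtain g' L' C' where g': "\<And>u v. \<bar>g' u - g' v\<bar> \<le> L' * \<bar>u - v\<bar>" "0 \<le> L'" "\<And>u. \<bar>g' u\<bar> \<le> C'"
    "(\<integral>u. \<bar>f' u - g' u\<bar> \<partial>\<mu>) < \<epsilon> / 2" "(\<integral>u. \<bar>f' u - g' u\<bar> \<partial>\<nu>) < \<epsilon> / 2"
    using lipschitz_approximableD[OF assms(2) \<epsilon>] by blast
  have gi: "integrable \<mu> g" "integrable \<nu> g" "integrable \<mu> g'" "integrable \<nu> g'"
    using integrable_bounded_Lipschitz[OF g(1,3)] integrable_bounded_Lipschitz[OF g'(1,3)] by auto
  have tri: "(\<integral>u. \<bar>f u + f' u - (g u + g' u)\<bar> \<partial>m) \<le> (\<integral>u. \<bar>f u - g u\<bar> \<partial>m) + (\<integral>u. \<bar>f' u - g' u\<bar> \<partial>m)"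
    if "integrable m f" "integrable m g" "integrable m f'" "integrable m g'" for m
  proof -
    have "(\<integral>u. \<bar>f u + f' u - (g u + g' u)\<bar> \<partial>m) \<le> (\<integral>u. \<bar>f u - g u\<bar> + \<bar>f' u - g' u\<bar> \<partial>m)"
      using that by (intro integral_mono) auto
    then show ?thesis using that by simp
  qed
  have lip: "\<bar>g u + g' u - (g v + g' v)\<bar> \<le> (L + L') * \<bar>u - v\<bar>" for u v
    using g(1)[of u v] g'(1)[of u v] by (simp add: distrib_right)
  have bnd: "\<bar>g u + g' u\<bar> \<le> C + C'" for u using g(3)[of u] g'(3)[of u] by simp
  show "\<exists>g L C. (\<forall>u v. \<bar>g u - g v\<bar> \<le> L * \<bar>u - v\<bar>) \<and> 0 \<le> L \<and> (\<forall>u. \<bar>g u\<bar> \<le> C) \<and>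
       (\<integral>u. \<bar>f u + f' u - g u\<bar> \<partial>\<mu>) < \<epsilon> \<and> (\<integral>u. \<bar>f u + f' u - g u\<bar> \<partial>\<nu>) < \<epsilon>"
    using tri[of \<mu>] tri[of \<nu>] fi gi g(2,4,5) g'(2,4,5) lip bnd
    by (intro exI[of _ "\<lambda>u. g u + g' u"] exI[of _ "L + L'"] exI[of _ "C + C'"]) auto
qed

lemma lipschitz_approximable_bounded:
  assumes "f \<in> borel_measurable borel" "\<And>u. 0 \<le> f u" "\<And>u. f u \<le> C"
  shows "lipschitz_approximable \<mu> \<nu> f"
  using assms(1,2)
proof (induction rule: borel_measurable_induct_real)
  case (set A)
  then show ?case by (rule lipschitz_approximable_indicator)
next
  case (mult u c)
  then show ?case by (intro lipschitz_approximable_cmult)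
next
  case (add u v)
  then show ?case by (intro lipschitz_approximable_add)
next
  case (seq U)
  have [measurable]: "f \<in> borel_measurable borel" "U i \<in> borel_measurable borel" for i by fact+
  have U_nonneg: "0 \<le> U i x" for i x by fact
  have U_approx: "lipschitz_approximable \<mu> \<nu> (U i)" for i by fact
  have inc: "incseq U" by fact
  have lim: "(\<lambda>i. U i x) \<longlonglongrightarrow> f x" for x using seq by simp
  have le: "U i x \<le> f x" for i x
    using inc lim[of x] by (intro incseq_le[of "\<lambda>i. U i x"]) (auto simp: incseq_def le_fun_def)
  show ?case
  proof (rule lipschitz_approximable_limit)
    show "integrable \<mu> f" "integrable \<nu> f"
      using assms by (auto intro!: \<mu>.integrable_const_bound[where B = C] \<nu>.integrable_const_bound[where B = C])
    have conv: "(\<lambda>i. \<integral>u. \<bar>f u - U i u\<bar> \<partial>m) \<longlonglongrightarrow> 0" if "prob_space m" "sets m = sets borel" for m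
    proof -
      interpret prob_space m by fact
      note [measurable_cong] = that(2)
      have "(\<lambda>i. \<integral>u. \<bar>f u - U i u\<bar> \<partial>m) \<longlonglongrightarrow> (\<integral>u. \<bar>f u - f u\<bar> \<partial>m)"
      proof (rule integral_dominated_convergence[where w = "\<lambda>_. C"])
        show "AE u in m. (\<lambda>i. \<bar>f u - U i u\<bar>) \<longlonglongrightarrow> \<bar>f u - f u\<bar>" by (intro AE_I2 tendsto_intros lim)
        show "AE u in m. norm \<bar>f u - U i u\<bar> \<le> C" for i
        proof (rule AE_I2)
          fix u show "norm \<bar>f u - U i u\<bar> \<le> C"
            using le[of i u] U_nonneg[of i u] assms(3)[of u] unfolding real_norm_def by linarith
        qed
      qed auto
      then show ?thesis by simp
    qed
    fix \<epsilon> :: real assume "0 < \<epsilon>"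
    have "\<forall>\<^sub>F i in sequentially. (\<integral>u. \<bar>f u - U i u\<bar> \<partial>\<mu>) < \<epsilon>" "\<forall>\<^sub>F i in sequentially. (\<integral>u. \<bar>f u - U i u\<bar> \<partial>\<nu>) < \<epsilon>"
      by (intro order_tendstoD(2)[OF conv] prob sets \<open>0 < \<epsilon>\<close>)+
    then have "\<forall>\<^sub>F i in sequentially. (\<integral>u. \<bar>f u - U i u\<bar> \<partial>\<mu>) < \<epsilon> \<and> (\<integral>u. \<bar>f u - U i u\<bar> \<partial>\<nu>) < \<epsilon>"
      by (rule eventually_conj)
    then obtain i where "(\<integral>u. \<bar>f u - U i u\<bar> \<partial>\<mu>) < \<epsilon> \<and> (\<integral>u. \<bar>f u - U i u\<bar> \<partial>\<nu>) < \<epsilon>"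
      by (auto simp: eventually_sequentially)
    then show "\<exists>h. lipschitz_approximable \<mu> \<nu> h \<and> (\<integral>u. \<bar>f u - h u\<bar> \<partial>\<mu>) < \<epsilon> \<and> (\<integral>u. \<bar>f u - h u\<bar> \<partial>\<nu>) < \<epsilon>"
      using U_approx by blast
  qed
qed

end

text \<open>Take Lipschitz approximations of \<open>f\<close> in \<open>L\<^sup>1\<close> of both measures and truncate them to \<open>[0, C]\<close>. On this interval
\<open>p\<close>-th powers are Lipschitz, so the \<open>p\<close>-th moments converge as well.\<close>

lemma power_moment_bound_extend:
  fixes \<mu> \<nu> :: "real measure" and f :: "real \<Rightarrow> real"
  assumes \<mu>: "prob_space \<mu>" "sets \<mu> = sets borel" and \<nu>: "prob_space \<nu>" "sets \<nu> = sets borel"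
    and p: "1 < p"
    and lip: "\<And>g L C. (\<And>u. 0 \<le> g u) \<Longrightarrow> (\<And>u. g u \<le> C) \<Longrightarrow> (\<And>u v. \<bar>g u - g v\<bar> \<le> L * \<bar>u - v\<bar>) \<Longrightarrow> 0 \<le> L \<Longrightarrow>
      (\<integral>u. g u \<partial>\<nu>) \<le> (\<integral>u. g u powr p \<partial>\<mu>) powr (1 / p) * A"
    and f: "f \<in> borel_measurable borel" "\<And>u. 0 \<le> f u" "\<And>u. f u \<le> C"
  shows "(\<integral>u. f u \<partial>\<nu>) \<le> (\<integral>u. f u powr p \<partial>\<mu>) powr (1 / p) * A"
proof -
  interpret \<mu>: prob_space \<mu> by fact
  interpret \<nu>: prob_space \<nu> by fact
  note [measurable_cong] = \<mu>(2) \<nu>(2)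
  have C: "0 \<le> C" using f(2,3)[of 0] by linarith
  have approx: "lipschitz_approximable \<mu> \<nu> f"
    by (rule lipschitz_approximable_bounded[OF \<mu>(1) \<nu>(1) \<mu>(2) \<nu>(2) f])
  let ?good = "\<lambda>n h. (\<exists>L. 0 \<le> L \<and> (\<forall>u v. \<bar>h u - h v\<bar> \<le> L * \<bar>u - v\<bar>)) \<and> (\<forall>u. 0 \<le> h u \<and> h u \<le> C) \<and>
      (\<integral>u. \<bar>f u - h u\<bar> \<partial>\<mu>) < inverse (real (Suc n)) \<and> (\<integral>u. \<bar>f u - h u\<bar> \<partial>\<nu>) < inverse (real (Suc n))"
  have "\<exists>h. ?good n h" for n
  proof -
    have pos: "0 < inverse (real (Suc n))" by simp
    obtain g L D where g: "\<And>u v. \<bar>g u - g v\<bar> \<le> L * \<bar>u - v\<bar>" "0 \<le> L" "\<And>u. \<bar>g u\<bar> \<le> D"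
      "(\<integral>u. \<bar>f u - g u\<bar> \<partial>\<mu>) < inverse (real (Suc n))" "(\<integral>u. \<bar>f u - g u\<bar> \<partial>\<nu>) < inverse (real (Suc n))"
      using lipschitz_approximableD[OF approx pos] by blast
    define h where "h u = max 0 (min (g u) C)" for u
    have h_lip: "\<bar>h u - h v\<bar> \<le> L * \<bar>u - v\<bar>" for u v using g(1)[of u v] by (auto simp: h_def)
    have h_bnd: "0 \<le> h u" "h u \<le> C" for u using C by (auto simp: h_def)
    have h_close: "\<bar>f u - h u\<bar> \<le> \<bar>f u - g u\<bar>" for u using f(2,3)[of u] by (auto simp: h_def)
    have [measurable]: "f \<in> borel_measurable borel" "g \<in> borel_measurable borel" "h \<in> borel_measurable borel"
      using f(1) Lipschitz_borel_measurable[OF g(1)] Lipschitz_borel_measurable[OF h_lip] by auto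
    have "(\<integral>u. \<bar>f u - h u\<bar> \<partial>\<mu>) \<le> (\<integral>u. \<bar>f u - g u\<bar> \<partial>\<mu>)"
    proof (rule integral_mono[OF _ _ h_close])
      show "integrable \<mu> (\<lambda>u. \<bar>f u - h u\<bar>)" "integrable \<mu> (\<lambda>u. \<bar>f u - g u\<bar>)"
      proof -
        have "integrable \<mu> f" "integrable \<mu> h" "integrable \<mu> g"
          using f h_bnd g(3)
          by (auto intro!: \<mu>.integrable_const_bound[where B = C and f = f]
              \<mu>.integrable_const_bound[where B = C and f = h] \<mu>.integrable_const_bound[where B = D and f = g])
        then show "integrable \<mu> (\<lambda>u. \<bar>f u - h u\<bar>)" "integrable \<mu> (\<lambda>u. \<bar>f u - g u\<bar>)" by auto
      qed
    qed
    moreover have "(\<integral>u. \<bar>f u - h u\<bar> \<partial>\<nu>) \<le> (\<integral>u. \<bar>f u - g u\<bar> \<partial>\<nu>)"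
    proof (rule integral_mono[OF _ _ h_close])
      show "integrable \<nu> (\<lambda>u. \<bar>f u - h u\<bar>)" "integrable \<nu> (\<lambda>u. \<bar>f u - g u\<bar>)"
      proof -
        have "integrable \<nu> f" "integrable \<nu> h" "integrable \<nu> g"
          using f h_bnd g(3)
          by (auto intro!: \<nu>.integrable_const_bound[where B = C and f = f]
              \<nu>.integrable_const_bound[where B = C and f = h] \<nu>.integrable_const_bound[where B = D and f = g])
        then show "integrable \<nu> (\<lambda>u. \<bar>f u - h u\<bar>)" "integrable \<nu> (\<lambda>u. \<bar>f u - g u\<bar>)" by auto
      qed
    qed
    ultimately have "?good n h" using h_lip h_bnd g(2,4,5) by auto
    then show ?thesis by blast
  qed
  then obtain h where h: "\<forall>n. ?good n (h n)" by (rule choice[OF allI, THEN exE])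
  have h_bnd: "0 \<le> h n u" "h n u \<le> C" for n u using h by auto
  have h_close: "(\<integral>u. \<bar>f u - h n u\<bar> \<partial>\<mu>) < inverse (real (Suc n))" "(\<integral>u. \<bar>f u - h n u\<bar> \<partial>\<nu>) < inverse (real (Suc n))" for n
    using h by auto
  have h_lip: "\<exists>L. 0 \<le> L \<and> (\<forall>u v. \<bar>h n u - h n v\<bar> \<le> L * \<bar>u - v\<bar>)" for n using h by auto
  have [measurable]: "f \<in> borel_measurable borel" "h n \<in> borel_measurable borel" for n
    using f(1) h_lip[of n] by (auto intro: Lipschitz_borel_measurable)
  have conv: "(\<lambda>n. \<integral>u. \<bar>f u - h n u\<bar> \<partial>m) \<longlonglongrightarrow> 0"
    if "\<And>n. (\<integral>u. \<bar>f u - h n u\<bar> \<partial>m) < inverse (real (Suc n))" for m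
  proof (rule tendsto_sandwich[OF _ _ tendsto_const LIMSEQ_inverse_real_of_nat])
    show "\<forall>\<^sub>F n in sequentially. 0 \<le> (\<integral>u. \<bar>f u - h n u\<bar> \<partial>m)"
      by (intro always_eventually allI integral_nonneg_AE AE_I2) auto
    show "\<forall>\<^sub>F n in sequentially. (\<integral>u. \<bar>f u - h n u\<bar> \<partial>m) \<le> inverse (real (Suc n))"
      using that by (intro always_eventually allI less_imp_le)
  qed
  have h_int: "integrable \<mu> (h n)" "integrable \<nu> (h n)" "integrable \<mu> (\<lambda>u. h n u powr p)" for n
    using h_bnd[of n] powr_mono2[OF less_imp_le h_bnd, of p n] p
    by (auto intro!: \<mu>.integrable_const_bound[where B = C] \<nu>.integrable_const_bound[where B = C]
        \<mu>.integrable_const_bound[where B = "C powr p" and f = "\<lambda>u. h n u powr p"])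
  have f_int: "integrable \<mu> f" "integrable \<nu> f" "integrable \<mu> (\<lambda>u. f u powr p)"
    using f powr_mono2[OF less_imp_le f(2,3), of p] p
    by (auto intro!: \<mu>.integrable_const_bound[where B = C] \<nu>.integrable_const_bound[where B = C]
        \<mu>.integrable_const_bound[where B = "C powr p" and f = "\<lambda>u. f u powr p"])
  have lim_\<nu>: "(\<lambda>n. \<integral>u. h n u \<partial>\<nu>) \<longlonglongrightarrow> (\<integral>u. f u \<partial>\<nu>)"
  proof (rule LIM_zero_cancel, rule Lim_null_comparison[OF _ conv[OF h_close(2)]])
    have "\<bar>(\<integral>u. h n u \<partial>\<nu>) - (\<integral>u. f u \<partial>\<nu>)\<bar> \<le> (\<integral>u. \<bar>f u - h n u\<bar> \<partial>\<nu>)" for n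
      using integral_abs_bound[of \<nu> "\<lambda>u. f u - h n u"] h_int(2)[of n] f_int(2) by (simp add: abs_minus_commute)
    then show "\<forall>\<^sub>F n in sequentially. norm ((\<integral>u. h n u \<partial>\<nu>) - (\<integral>u. f u \<partial>\<nu>)) \<le> (\<integral>u. \<bar>f u - h n u\<bar> \<partial>\<nu>)" by simp
  qed
  have lim_\<mu>: "(\<lambda>n. \<integral>u. h n u powr p \<partial>\<mu>) \<longlonglongrightarrow> (\<integral>u. f u powr p \<partial>\<mu>)"
  proof (rule LIM_zero_cancel, rule Lim_null_comparison)
    show "(\<lambda>n. p * C powr (p - 1) * (\<integral>u. \<bar>f u - h n u\<bar> \<partial>\<mu>)) \<longlonglongrightarrow> 0"
      using tendsto_mult_left[OF conv[OF h_close(1)], of "p * C powr (p - 1)"] by simp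
    have "\<bar>(\<integral>u. h n u powr p \<partial>\<mu>) - (\<integral>u. f u powr p \<partial>\<mu>)\<bar> \<le> p * C powr (p - 1) * (\<integral>u. \<bar>f u - h n u\<bar> \<partial>\<mu>)" for n
    proof -
      have "\<bar>\<integral>u. f u powr p - h n u powr p \<partial>\<mu>\<bar> \<le> (\<integral>u. \<bar>f u powr p - h n u powr p\<bar> \<partial>\<mu>)" by (rule integral_abs_bound)
      also have "\<dots> \<le> (\<integral>u. p * C powr (p - 1) * \<bar>f u - h n u\<bar> \<partial>\<mu>)"
        using h_int(1,3)[of n] f_int h_bnd f p by (intro integral_mono abs_powr_diff_le) auto
      finally show ?thesis using h_int(3)[of n] f_int(3) by (simp add: abs_minus_commute)
    qed
    then show "\<forall>\<^sub>F n in sequentially. norm ((\<integral>u. h n u powr p \<partial>\<mu>) - (\<integral>u. f u powr p \<partial>\<mu>)) \<le>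
        p * C powr (p - 1) * (\<integral>u. \<bar>f u - h n u\<bar> \<partial>\<mu>)" by simp
  qed
  have "(\<lambda>n. (\<integral>u. h n u powr p \<partial>\<mu>) powr (1 / p) * A) \<longlonglongrightarrow> (\<integral>u. f u powr p \<partial>\<mu>) powr (1 / p) * A"
    using p by (intro tendsto_intros tendsto_powr' lim_\<mu>) auto
  moreover have "(\<integral>u. h n u \<partial>\<nu>) \<le> (\<integral>u. h n u powr p \<partial>\<mu>) powr (1 / p) * A" for n
    using h_lip[of n] lip[of "h n", OF h_bnd] by blast
  ultimately show ?thesis using LIMSEQ_le[OF lim_\<nu>] by blast
qed

section \<open>The Harnack inequality\<close>

text \<open>The drift rate of the coupled scheme is bounded by \<open>\<bar>y - x\<bar> * (K + 1 / T)\<close> for every \<open>n\<close>, so the bound of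
\<open>euler_harnack_fbm\<close> passes to the limit of the Euler schemes.\<close>

lemma (in fractional_brownian_motion) harnack_lipschitz:
  fixes X :: "real \<Rightarrow> real \<Rightarrow> 'a \<Rightarrow> real"
  assumes H: "0 < H" "H < 1/2" and T: "0 < T" and K: "0 < K"
    and lip: "\<And>t u v. t \<in> {0..T} \<Longrightarrow> \<bar>b t u - b t v\<bar> \<le> K * \<bar>u - v\<bar>"
    and int: "\<And>u. set_integrable lborel {0..T} (\<lambda>s. b s u)"
    and sol: "\<And>z. is_solution M F T B b z (X z)" and p: "1 < p"
    and f: "\<And>u. 0 \<le> f u" "\<And>u. f u \<le> C" "\<And>u v. \<bar>f u - f v\<bar> \<le> L * \<bar>u - v\<bar>" "0 \<le> L"
  shows "(\<integral>\<omega>. f (X y T \<omega>) \<partial>M) \<le> (\<integral>\<omega>. f (X x T \<omega>) powr p \<partial>M) powr (1 / p) *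
    exp ((\<bar>y - x\<bar> * (K + 1 / T) * (Beta (3/2 - H) (1/2 - H) / Gamma (1/2 - H)))\<^sup>2 *
      (T powr (2 - 2 * H) / (2 - 2 * H)) / (2 * (p - 1)))"
proof -
  let ?E = "exp ((\<bar>y - x\<bar> * (K + 1 / T) * (Beta (3/2 - H) (1/2 - H) / Gamma (1/2 - H)))\<^sup>2 *
      (T powr (2 - 2 * H) / (2 - 2 * H)) / (2 * (p - 1)))"
  \<comment> \<open>The index is shifted so that the number of steps is positive.\<close>
  let ?e = "\<lambda>z n \<omega>. euler_path (averaged_drift b T (Suc n)) z (\<lambda>k. B (real k * T / real (Suc n)) \<omega>) (Suc n)"
  have drift_lip: "\<bar>averaged_drift b T n j u - averaged_drift b T n j v\<bar> \<le> K * T / real n * \<bar>u - v\<bar>" if "j < n" for n j u v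
    using T K by (intro averaged_drift_lipschitz lip int that) auto
  have B_meas: "B t \<in> borel_measurable M" if "t \<in> {0..T}" for t
    using B_representation[OF that] by (simp add: is_wiener_integral_def)
  have e_meas: "?e z n \<in> borel_measurable M" for z n
  proof (rule euler_path_measurable)
    fix j assume "j < Suc n"
    then show "averaged_drift b T (Suc n) j \<in> borel_measurable borel"
      by (intro Lipschitz_borel_measurable[OF drift_lip])
  next
    fix j assume "j \<le> Suc n"
    then have "real j * T / real (Suc n) \<in> {0..T}"
      using grid_points[OF T, of "j - 1" "Suc n"] T by (cases j) auto
    then show "B (real j * T / real (Suc n)) \<in> borel_measurable M" by (rule B_meas)
  qed
  have X_meas: "X z T \<in> borel_measurable M" for z
  proof -
    have "X z T \<in> borel_measurable (F T)" using sol[of z] T unfolding is_solution_def by simp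
    then show ?thesis by (rule measurable_from_subalg[OF subalgebra_F])
  qed
  have conv: "AE \<omega> in M. (\<lambda>n. ?e z n \<omega>) \<longlonglongrightarrow> X z T \<omega>" for z
  proof -
    have "AE \<omega> in M. continuous_on {0..T} (\<lambda>t. X z t \<omega>) \<and>
        (\<forall>t \<in> {0..T}. set_integrable lborel {0..t} (\<lambda>s. b s (X z s \<omega>)) \<and>
           X z t \<omega> = z + (LINT s:{0..t}|lborel. b s (X z s \<omega>)) + B t \<omega>)"
      using sol[of z] unfolding is_solution_def by blast
    then show ?thesis
    proof eventually_elim
      case (elim \<omega>)
      have "(\<lambda>n. euler_path (averaged_drift b T n) z (\<lambda>k. B (real k * T / real n) \<omega>) n) \<longlonglongrightarrow> X z T \<omega>"
        by (rule euler_path_tendsto_solution[where B = "\<lambda>t. B t \<omega>" and X = "\<lambda>t. X z t \<omega>", OF T _ lip int])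
          (use elim K in auto)
      then show ?case by (rule LIMSEQ_Suc)
    qed
  qed
  have f_cont: "isCont f u" for u
  proof -
    have "L-lipschitz_on UNIV f" using f by (intro lipschitz_onI) (auto simp: dist_real_def)
    then have "continuous_on UNIV f" by (rule lipschitz_on_continuous_on)
    then show ?thesis by (simp add: continuous_on_eq_continuous_at)
  qed
  have [measurable]: "f \<in> borel_measurable borel" by (rule Lipschitz_borel_measurable[OF f(3)])
  have fp_meas: "(\<lambda>u. f u powr p) \<in> borel_measurable borel" by measurable
  have lim_l: "(\<lambda>n. \<integral>\<omega>. f (?e y n \<omega>) \<partial>M) \<longlonglongrightarrow> (\<integral>\<omega>. f (X y T \<omega>) \<partial>M)"
  proof (rule integral_dominated_convergence[where w = "\<lambda>_. C"])
    show "AE \<omega> in M. (\<lambda>n. f (?e y n \<omega>)) \<longlonglongrightarrow> f (X y T \<omega>)"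
      using conv[of y] by eventually_elim (rule isCont_tendsto_compose[OF f_cont])
  qed (use e_meas X_meas f in \<open>auto intro!: measurable_compose[where g = f]\<close>)
  have lim_r: "(\<lambda>n. \<integral>\<omega>. f (?e x n \<omega>) powr p \<partial>M) \<longlonglongrightarrow> (\<integral>\<omega>. f (X x T \<omega>) powr p \<partial>M)"
  proof (rule integral_dominated_convergence[where w = "\<lambda>_. C powr p"])
    show "AE \<omega> in M. (\<lambda>n. f (?e x n \<omega>) powr p) \<longlonglongrightarrow> f (X x T \<omega>) powr p"
      using conv[of x]
    proof eventually_elim
      case (elim \<omega>)
      then show ?case using p f(1)
        by (intro tendsto_powr' tendsto_const isCont_tendsto_compose[OF f_cont]) auto
    qed
    show "AE \<omega> in M. norm (f (?e x n \<omega>) powr p) \<le> C powr p" for n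
      using f p by (intro AE_I2) (auto intro!: powr_mono2)
    show "(\<lambda>\<omega>. f (?e x n \<omega>) powr p) \<in> borel_measurable M" for n
      by (rule measurable_compose[OF e_meas fp_meas])
    show "(\<lambda>\<omega>. f (X x T \<omega>) powr p) \<in> borel_measurable M"
      by (rule measurable_compose[OF X_meas fp_meas])
  qed simp
  have "(\<integral>\<omega>. f (?e y n \<omega>) \<partial>M) \<le> (\<integral>\<omega>. f (?e x n \<omega>) powr p \<partial>M) powr (1 / p) * ?E" for n
  proof -
    have c: "\<bar>y - x\<bar> * (K + 1 / T) = \<bar>y - x\<bar> * (K * T / real (Suc n) + 1 / real (Suc n)) / (T / real (Suc n))"
    proof -
      have "d * (K + 1 / T) = d * (K * T / m + 1 / m) / (T / m)" if "0 < m" for d m :: real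
        using that T by (simp add: field_simps)
      then show ?thesis by simp
    qed
    have K0: "0 \<le> K * T / real (Suc n)" using K T by simp
    have "1 + (1/2 - H) = 3/2 - H" "2 * (1/2 - H) + 1 = 2 - 2 * H" by auto
    with euler_harnack_fbm[where n = "Suc n" and \<beta> = "averaged_drift b T (Suc n)", OF H T zero_less_Suc K0 drift_lip c f p]
    show ?thesis by (simp only:)
  qed
  moreover have "(\<lambda>n. (\<integral>\<omega>. f (?e x n \<omega>) powr p \<partial>M) powr (1 / p) * ?E) \<longlonglongrightarrow> (\<integral>\<omega>. f (X x T \<omega>) powr p \<partial>M) powr (1 / p) * ?E"
    using p by (intro tendsto_intros tendsto_powr' lim_r) auto
  ultimately show ?thesis using LIMSEQ_le[OF lim_l] by blast
qed

lemma drift_set_integrable: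
  fixes b :: "real \<Rightarrow> real \<Rightarrow> real"
  assumes b: "(\<lambda>(t, z). b t z) \<in> borel_measurable (restrict_space borel ({0..T} \<times> UNIV))"
    and lip: "\<And>t u v. t \<in> {0..T} \<Longrightarrow> \<bar>b t u - b t v\<bar> \<le> K * \<bar>u - v\<bar>"
    and bdd: "bounded ((\<lambda>t. b t 0) ` {0..T})"
  shows "set_integrable lborel {0..T} (\<lambda>s. b s u)"
proof -
  have "{0..T} \<times> UNIV \<in> sets (borel :: (real \<times> real) measure)"
    by (intro borel_closed closed_Times) auto
  then have "(\<lambda>p. indicator ({0..T} \<times> UNIV) p *\<^sub>R (case p of (t, z) \<Rightarrow> b t z)) \<in> borel_measurable borel"
    using b by (subst (asm) borel_measurable_restrict_space_iff) auto
  from measurable_compose[OF _ this, of "\<lambda>s. (s, u)" borel]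
  have meas: "(\<lambda>s. indicator {0..T} s *\<^sub>R b s u) \<in> borel_measurable borel"
    by (simp add: indicator_times)
  from bdd obtain m where "\<forall>x\<in>(\<lambda>t. b t 0) ` {0..T}. norm x \<le> m" unfolding bounded_iff by blast
  then have m: "\<bar>b t 0\<bar> \<le> m" if "t \<in> {0..T}" for t using that by simp
  have bnd: "\<bar>b s u\<bar> \<le> \<bar>m + K * \<bar>u\<bar>\<bar>" if "s \<in> {0..T}" for s
    using m[OF that] lip[OF that, of u 0] by simp
  show ?thesis
    unfolding set_integrable_def
  proof (rule Bochner_Integration.integrable_bound)
    show "integrable lborel (\<lambda>s. (m + K * \<bar>u\<bar>) * indicator {0..T} s)" by (cases "0 \<le> T") auto
    show "AE s in lborel. norm (indicator {0..T} s *\<^sub>R b s u) \<le> norm ((m + K * \<bar>u\<bar>) * indicator {0..T} s)"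
      using bnd by (intro AE_I2) (auto simp: indicator_def)
  qed (use meas in simp)
qed

text \<open>For \<open>z > 0\<close> this is \<open>1 \<le> z * coth z\<close>.\<close>

lemma one_minus_exp_bound:
  fixes z :: real
  assumes "0 \<le> z"
  shows "(1 + z) * (1 - exp (- 2 * z)) \<le> 2 * z"
proof -
  let ?f = "\<lambda>z :: real. (1 + z) * exp (- 2 * z) - 1 + z"
  have "?f 0 \<le> ?f z"
  proof (rule DERIV_nonneg_imp_nondecreasing[OF assms])
    fix x :: real assume x: "0 \<le> x" "x \<le> z"
    have "(?f has_real_derivative (exp (- 2 * x) + (1 + x) * (exp (- 2 * x) * (- 2)) + 1)) (at x)"
      by (auto intro!: derivative_eq_intros)
    moreover have "0 \<le> exp (- 2 * x) + (1 + x) * (exp (- 2 * x) * (- 2)) + 1"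
    proof -
      have "(1 + 2 * x) * exp (- 2 * x) \<le> exp (2 * x) * exp (- 2 * x)"
        using exp_ge_add_one_self[of "2 * x"] by (intro mult_right_mono) auto
      also have "\<dots> = 1" by (simp flip: exp_add)
      finally show ?thesis by (simp add: algebra_simps)
    qed
    ultimately show "\<exists>y. (?f has_real_derivative y) (at x) \<and> 0 \<le> y" by blast
  qed
  then show ?thesis by (simp add: algebra_simps)
qed

text \<open>The elementary inequality \<open>K + 1 / T \<le> 2 * K / (1 - exp (- 2 * K * T))\<close> brings the exponent to the stated form.\<close>

lemma harnack_exponent_le:
  fixes H T K p d \<beta> :: real
  assumes "H < 1/2" "0 < T" "0 < K" "1 < p"
    and \<beta>: "\<beta> = Beta (3/2 - H) (1/2 - H) / Gamma (1/2 - H)"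
  shows "p * ((d * (K + 1 / T) * \<beta>)\<^sup>2 * (T powr (2 - 2 * H) / (2 - 2 * H)) / (2 * (p - 1))) \<le>
    p / (p - 1) * harnack_const T K H * d\<^sup>2"
proof -
  define r where "r = 1 - exp (- 2 * K * T)"
  have r: "0 < r" using assms by (simp add: r_def)
  have "(1 + K * T) * r \<le> 2 * (K * T)"
    using one_minus_exp_bound[of "K * T"] assms by (simp add: r_def mult.assoc)
  then have "K + 1 / T \<le> 2 * K / r" using r assms by (simp add: field_simps)
  then have sq: "(K + 1 / T)\<^sup>2 \<le> (2 * K / r)\<^sup>2" using assms by (intro power_mono) auto
  have C: "harnack_const T K H = \<beta>\<^sup>2 * (T powr (2 - 2 * H) * K\<^sup>2 / (r\<^sup>2 * (1 - H)))"
    using assms(3) by (simp add: harnack_const_def \<beta> r_def power_int_minus field_simps)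
  let ?w = "p * d\<^sup>2 * \<beta>\<^sup>2 * T powr (2 - 2 * H) / (4 * (1 - H) * (p - 1))"
  have w: "0 \<le> ?w" using assms by (intro divide_nonneg_nonneg mult_nonneg_nonneg) auto
  have "p * ((d * (K + 1 / T) * \<beta>)\<^sup>2 * (T powr (2 - 2 * H) / (2 - 2 * H)) / (2 * (p - 1))) = ?w * (K + 1 / T)\<^sup>2"
  proof -
    have "2 - 2 * H = 2 * (1 - H)" by simp
    then show ?thesis by (simp add: power_mult_distrib mult_ac) (simp add: algebra_simps)
  qed
  also have "\<dots> \<le> ?w * (2 * K / r)\<^sup>2" by (rule mult_left_mono[OF sq w])
  also have "\<dots> = p / (p - 1) * harnack_const T K H * d\<^sup>2"
  proof -
    have alg: "p * v * q * t / (4 * a * e) * (2 * K / r)\<^sup>2 = p / e * (q * (t * K\<^sup>2 / (r\<^sup>2 * a))) * v"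
      if "a \<noteq> 0" "e \<noteq> 0" for v q t a e :: real
      using that r by (simp add: field_simps power2_eq_square)
    have "1 - H \<noteq> 0" "p - 1 \<noteq> 0" using assms(1,4) by auto
    then show ?thesis unfolding C by (rule alg)
  qed
  finally show ?thesis .
qed

theorem theorem3p1:
  fixes M :: "'a measure" and F :: "real \<Rightarrow> 'a measure"
    and W B :: "real \<Rightarrow> 'a \<Rightarrow> real"
    and X :: "real \<Rightarrow> real \<Rightarrow> 'a \<Rightarrow> real"
    and b :: "real \<Rightarrow> real \<Rightarrow> real" and f :: "real \<Rightarrow> real"
    and H T K p x y :: real
  assumes "0 < H" "H < 1/2" and "0 < T"
    and "fractional_brownian_motion M F T W H B"
    and "(\<lambda>(t, z). b t z) \<in> borel_measurable (restrict_space borel ({0..T} \<times> UNIV))"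
    and "0 < K"
    and "\<And>t u v. t \<in> {0..T} \<Longrightarrow> \<bar>b t u - b t v\<bar> \<le> K * \<bar>u - v\<bar>"
    and "bounded ((\<lambda>t. b t 0) ` {0..T})"
    and "\<And>z. is_solution M F T B b z (X z)"
    and "1 < p"
    and "f \<in> borel_measurable borel" and "bounded (range f)" and "\<And>z. 0 \<le> f z"
  shows "transition_op M T X f y powr p
    \<le> transition_op M T X (\<lambda>z. f z powr p) x *
       exp (p / (p - 1) * harnack_const T K H * \<bar>x - y\<bar>\<^sup>2)"
proof -
  interpret fractional_brownian_motion M F T W H B by fact
  define \<beta> where "\<beta> = Beta (3/2 - H) (1/2 - H) / Gamma (1/2 - H)"
  define D where "D = (\<bar>y - x\<bar> * (K + 1 / T) * \<beta>)\<^sup>2 * (T powr (2 - 2 * H) / (2 - 2 * H)) / (2 * (p - 1))"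
  have X_meas: "X z T \<in> borel_measurable M" for z
  proof -
    have "X z T \<in> borel_measurable (F T)" using assms(9)[of z] \<open>0 < T\<close> unfolding is_solution_def by simp
    then show ?thesis by (rule measurable_from_subalg[OF subalgebra_F])
  qed
  obtain C where C: "\<And>u. f u \<le> C" using \<open>bounded (range f)\<close> unfolding bounded_iff by (auto simp: abs_le_iff)
  let ?\<mu> = "\<lambda>z. distr M borel (X z T)"
  have prob: "prob_space (?\<mu> z)" for z by (rule prob_space_distr[OF X_meas])
  have law: "(\<integral>u. g u \<partial>?\<mu> z) = (\<integral>\<omega>. g (X z T \<omega>) \<partial>M)" if "g \<in> borel_measurable borel" for g :: "real \<Rightarrow> real" and z
    by (rule integral_distr[OF X_meas that])
  have int: "set_integrable lborel {0..T} (\<lambda>s. b s u)" for u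
    by (rule drift_set_integrable[OF assms(5,7,8)])
  have "(\<integral>u. f u \<partial>?\<mu> y) \<le> (\<integral>u. f u powr p \<partial>?\<mu> x) powr (1 / p) * exp D"
  proof (rule power_moment_bound_extend[OF prob _ prob _ \<open>1 < p\<close> _ assms(11,13) C])
    fix g :: "real \<Rightarrow> real" and L C'
    assume g: "\<And>u. 0 \<le> g u" "\<And>u. g u \<le> C'" "\<And>u v. \<bar>g u - g v\<bar> \<le> L * \<bar>u - v\<bar>" "0 \<le> L"
    have "g \<in> borel_measurable borel" by (rule Lipschitz_borel_measurable[OF g(3)])
    then have "(\<integral>u. g u \<partial>?\<mu> y) = (\<integral>\<omega>. g (X y T \<omega>) \<partial>M)"
      "(\<integral>u. g u powr p \<partial>?\<mu> x) = (\<integral>\<omega>. g (X x T \<omega>) powr p \<partial>M)" by (auto intro!: law)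
    then show "(\<integral>u. g u \<partial>?\<mu> y) \<le> (\<integral>u. g u powr p \<partial>?\<mu> x) powr (1 / p) * exp D"
      unfolding D_def \<beta>_def
      using harnack_lipschitz[OF assms(1-3,6,7) int assms(9,10) g, of y x] by simp
  qed auto
  then have le: "transition_op M T X f y \<le> transition_op M T X (\<lambda>z. f z powr p) x powr (1 / p) * exp D"
    using assms(11) by (simp add: transition_op_def law)
  have nonneg: "0 \<le> transition_op M T X f y" "0 \<le> transition_op M T X (\<lambda>z. f z powr p) x"
    unfolding transition_op_def using assms(13) by (auto intro!: integral_nonneg_AE)
  have "transition_op M T X f y powr p \<le> (transition_op M T X (\<lambda>z. f z powr p) x powr (1 / p) * exp D) powr p"
    using le nonneg \<open>1 < p\<close> by (intro powr_mono2) auto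
  also have "\<dots> = transition_op M T X (\<lambda>z. f z powr p) x * exp (p * D)"
    using nonneg \<open>1 < p\<close> by (simp add: powr_mult powr_powr exp_powr_real mult.commute)
  also have "\<dots> \<le> transition_op M T X (\<lambda>z. f z powr p) x * exp (p / (p - 1) * harnack_const T K H * \<bar>x - y\<bar>\<^sup>2)"
  proof (rule mult_left_mono[OF _ nonneg(2)])
    show "exp (p * D) \<le> exp (p / (p - 1) * harnack_const T K H * \<bar>x - y\<bar>\<^sup>2)"
      using harnack_exponent_le[OF assms(2,3,6,10) \<beta>_def, of "\<bar>y - x\<bar>"]
      unfolding D_def by (simp only: exp_le_cancel_iff abs_minus_commute[of x y])
  qed
  finally show ?thesis .
qed

end
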